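(* Let $p>2$ be a prime and let $(a,b,c)$ be a solution in the first case of Fermat's equation, i.e. nonzero pairwise relatively prime integers with $a^p+b^p+c^p=0$ and $p\nmid abc$. Let $\chi\neq\chi_0$ be an even character of $g$ and let $\chi^*=\omega\chi^{-1}$ (so $\chi^*$ is odd and distinct from $\omega$). Then $$M_{\chi^*}\Big(\frac{-y}{x}\Big)\cdot M_{\chi}\Big(\frac{-y}{x}\Big)\equiv 0\pmod p$$ for each of the six pairs $(x,y)\in\{(a,b),(b,a),(b,c),(c,b),(c,a),(a,c)\}$.
   Context: $\zeta$ is a primitive $p$-th root of unity, $K=\mathbb{Q}(\zeta)$, $g=\mathrm{Gal}(K/\mathbb{Q})=\{s_k:1\le k\le p-1\}$ with $s_k(\zeta)=\zeta^k$. $\omega$ is the Teichmüller character: $\omega(k)=\omega(s_k)\in\mathbb{Z}_p^\times$ is the $(p-1)$-th root of unity congruent to $k$ modulo $p$. The $p$-adic characters of $g$ are the powers of $\omega$; $\chi_0$ is the trivial (unit) character; $\chi$ is even (odd) if $\chi(-1)=1$ ($=-1$). For a character $\varphi$ of $g$, $M_\varphi(Z)=\sum_{k=1}^{p-1}\varphi^{-1}(k)Z^k\in\mathbb{Z}_p[Z]$ (modified Mirimanoff polynomial); the congruence is in $\mathbb{Z}_p$. *)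

theory Defs
  imports
    "HOL-Algebra.UnivPoly"
    "HOL-Algebra.Bij"
    "HOL-Algebra.Generated_Fields"
    "HOL-Algebra.Algebraic_Closure_Type"
    Complex_Main
begin

(* so that "prime" is the one of HOL-Computational_Algebra *)
hide_const (open) Divisibility.prime

section \<open>The ring of p-adic integers\<close>

text \<open>The inverse limit of the rings Z/p^n for n = 1, 2, ...; component n of a sequence is
  the standard representative of a residue class modulo p^(n+1).\<close>

definition Zp :: "nat \<Rightarrow> (nat \<Rightarrow> int) ring" where
  "Zp p = \<lparr>
     carrier = {x. \<forall>n. x n \<in> {0..<int p ^ Suc n} \<and> x (Suc n) mod int p ^ Suc n = x n},
     monoid.mult = (\<lambda>x y n. (x n * y n) mod int p ^ Suc n),
     one = (\<lambda>n. 1 mod int p ^ Suc n),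
     ring.zero = (\<lambda>n. 0),
     add = (\<lambda>x y n. (x n + y n) mod int p ^ Suc n)\<rparr>"

definition Zp_of_int :: "nat \<Rightarrow> int \<Rightarrow> nat \<Rightarrow> int" where
  "Zp_of_int p a = (\<lambda>n. a mod int p ^ Suc n)"

definition Zp_cong :: "nat \<Rightarrow> (nat \<Rightarrow> int) \<Rightarrow> (nat \<Rightarrow> int) \<Rightarrow> bool" where
  "Zp_cong p u v \<longleftrightarrow> u \<ominus>\<^bsub>Zp p\<^esub> v \<in> PIdl\<^bsub>Zp p\<^esub> (Zp_of_int p (int p))"

lemma Zp_of_int_closed: "p > 0 \<Longrightarrow> Zp_of_int p a \<in> carrier (Zp p)"
  by (auto simp: Zp_def Zp_of_int_def intro!: mod_mod_cancel)

lemma Zp_cring: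
  assumes "p > 0"
  shows "cring (Zp p)"
proof -
  have pos: "0 < int p ^ Suc n" for n
    using assms by simp
  have m: "(z mod int p ^ Suc (Suc n)) mod int p ^ Suc n = z mod int p ^ Suc n" for z n
    by (rule mod_mod_cancel) simp
  have carr: "x \<in> carrier (Zp p) \<longleftrightarrow>
      (\<forall>n. 0 \<le> x n \<and> x n < int p ^ Suc n \<and> x (Suc n) mod int p ^ Suc n = x n)" for x
    by (auto simp: Zp_def simp del: power_Suc)
  have closed: "(\<lambda>n. f n mod int p ^ Suc n) \<in> carrier (Zp p)"
    if "\<And>n. f (Suc n) mod int p ^ Suc n = f n mod int p ^ Suc n" for f
    using pos m that by (simp add: carr del: power_Suc)
  have ops: "x \<otimes>\<^bsub>Zp p\<^esub> y = (\<lambda>n. (x n * y n) mod int p ^ Suc n)"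
    "x \<oplus>\<^bsub>Zp p\<^esub> y = (\<lambda>n. (x n + y n) mod int p ^ Suc n)"
    "\<one>\<^bsub>Zp p\<^esub> = (\<lambda>n. 1 mod int p ^ Suc n)" "\<zero>\<^bsub>Zp p\<^esub> = (\<lambda>n. 0)" for x y
    by (simp_all add: Zp_def)
  have small: "x n mod int p ^ Suc n = x n" if "x \<in> carrier (Zp p)" for x n
    using that by (simp add: carr del: power_Suc)
  have step: "x (Suc n) mod int p ^ Suc n = x n" if "x \<in> carrier (Zp p)" for x n
    using that by (simp add: carr del: power_Suc)
  have add_closed: "x \<oplus>\<^bsub>Zp p\<^esub> y \<in> carrier (Zp p)"
    and mult_closed: "x \<otimes>\<^bsub>Zp p\<^esub> y \<in> carrier (Zp p)"
    if "x \<in> carrier (Zp p)" "y \<in> carrier (Zp p)" for x y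
    unfolding ops
    by (rule closed, metis mod_add_eq step that small) (rule closed, metis mod_mult_eq step that small)
  show ?thesis
  proof (intro cringI abelian_groupI comm_monoidI)
    fix x assume x: "x \<in> carrier (Zp p)"
    have "(\<lambda>n. (- x n) mod int p ^ Suc n) \<in> carrier (Zp p)"
      by (rule closed, metis mod_minus_eq step x small)
    moreover have "(\<lambda>n. (- x n) mod int p ^ Suc n) \<oplus>\<^bsub>Zp p\<^esub> x = \<zero>\<^bsub>Zp p\<^esub>"
      by (simp add: ops mod_add_left_eq del: power_Suc)
    ultimately show "\<exists>y\<in>carrier (Zp p). y \<oplus>\<^bsub>Zp p\<^esub> x = \<zero>\<^bsub>Zp p\<^esub>" by blast
  next
    show "\<zero>\<^bsub>Zp p\<^esub> \<in> carrier (Zp p)" using pos by (simp add: carr ops del: power_Suc)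
  next
    show "\<one>\<^bsub>Zp p\<^esub> \<in> carrier (Zp p)" unfolding ops by (rule closed) simp
  qed (simp_all add: add_closed mult_closed,
      simp_all add: ops small mod_mult_left_eq mod_mult_right_eq mod_add_left_eq mod_add_right_eq
        mod_add_eq algebra_simps del: power_Suc)
qed

section \<open>The Galois group of a cyclotomic field\<close>

definition primitive_root_of_unity :: "nat \<Rightarrow> complex \<Rightarrow> bool" where
  "primitive_root_of_unity n z \<longleftrightarrow> z ^ n = 1 \<and> (\<forall>m\<in>{0<..<n}. z ^ m \<noteq> 1)"

text \<open>The field Q(z). It suffices to generate by z, since a subfield contains 1
  and hence the rationals.\<close>

definition Q_adjoin :: "complex \<Rightarrow> complex ring" where
  "Q_adjoin z = ring_of_type_algebra
     \<lparr>carrier := generate_field (ring_of_type_algebra :: complex ring) {z}\<rparr>"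

text \<open>Gal(Q(z)/Q), with composition; its elements are extensional functions, that is,
  undefined outside Q(z).\<close>

definition gal :: "complex \<Rightarrow> (complex \<Rightarrow> complex) monoid" where
  "gal z = BijGroup (carrier (Q_adjoin z))
     \<lparr>carrier := {\<sigma> \<in> Bij (carrier (Q_adjoin z)).
        \<sigma> \<in> ring_iso (Q_adjoin z) (Q_adjoin z) \<and> (\<forall>q\<in>\<rat>. \<sigma> q = q)}\<rparr>"

definition gal_s :: "complex \<Rightarrow> int \<Rightarrow> complex \<Rightarrow> complex" where
  "gal_s z k = (THE \<sigma>. \<sigma> \<in> carrier (gal z) \<and> \<sigma> z = z powi k)"

section \<open>Characters\<close>

text \<open>Below, z is meant to be a primitive p-th root of unity, and gal_s z k is the
  element of gal z written s_k; in particular the value of a character at an integer k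
  is its value at gal_s z k.\<close>

definition padic_chars :: "nat \<Rightarrow> complex \<Rightarrow> ((complex \<Rightarrow> complex) \<Rightarrow> nat \<Rightarrow> int) set" where
  "padic_chars p z = hom (gal z) (units_of (Zp p)) \<inter> extensional (carrier (gal z))"

definition unit_char :: "nat \<Rightarrow> complex \<Rightarrow> (complex \<Rightarrow> complex) \<Rightarrow> nat \<Rightarrow> int" where
  "unit_char p z = (\<lambda>\<sigma>\<in>carrier (gal z). \<one>\<^bsub>Zp p\<^esub>)"

definition even_char :: "nat \<Rightarrow> complex \<Rightarrow> ((complex \<Rightarrow> complex) \<Rightarrow> nat \<Rightarrow> int) \<Rightarrow> bool" where
  "even_char p z \<chi> \<longleftrightarrow> \<chi> (gal_s z (- 1)) = \<one>\<^bsub>Zp p\<^esub>"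

definition odd_char :: "nat \<Rightarrow> complex \<Rightarrow> ((complex \<Rightarrow> complex) \<Rightarrow> nat \<Rightarrow> int) \<Rightarrow> bool" where
  "odd_char p z \<chi> \<longleftrightarrow> \<chi> (gal_s z (- 1)) = \<ominus>\<^bsub>Zp p\<^esub> \<one>\<^bsub>Zp p\<^esub>"

text \<open>Over an odd prime p there is exactly one such u for each k prime to p (Hensel's lemma);
  this is the Teichmueller representative.\<close>

definition teichmuller :: "nat \<Rightarrow> int \<Rightarrow> nat \<Rightarrow> int" where
  "teichmuller p k = (THE u. u \<in> Units (Zp p) \<and> u [^]\<^bsub>Zp p\<^esub> (p - 1) = \<one>\<^bsub>Zp p\<^esub> \<and>
     Zp_cong p u (Zp_of_int p k))"

definition omega_char :: "nat \<Rightarrow> complex \<Rightarrow> (complex \<Rightarrow> complex) \<Rightarrow> nat \<Rightarrow> int" where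
  "omega_char p z = (\<lambda>\<sigma>\<in>carrier (gal z).
     teichmuller p (THE k. k \<in> {1..int p - 1} \<and> \<sigma> = gal_s z k))"

definition dual_char :: "nat \<Rightarrow> complex \<Rightarrow> ((complex \<Rightarrow> complex) \<Rightarrow> nat \<Rightarrow> int) \<Rightarrow>
    (complex \<Rightarrow> complex) \<Rightarrow> nat \<Rightarrow> int" where
  "dual_char p z \<chi> = (\<lambda>\<sigma>\<in>carrier (gal z). omega_char p z \<sigma> \<otimes>\<^bsub>Zp p\<^esub> inv\<^bsub>Zp p\<^esub> (\<chi> \<sigma>))"

section \<open>Modified Mirimanoff polynomials\<close>

definition mirimanoff :: "nat \<Rightarrow> complex \<Rightarrow> ((complex \<Rightarrow> complex) \<Rightarrow> nat \<Rightarrow> int) \<Rightarrow>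
    nat \<Rightarrow> nat \<Rightarrow> int" where
  "mirimanoff p z \<phi> = (\<Oplus>\<^bsub>UP (Zp p)\<^esub> k \<in> {1..p - 1}.
     up_ring.monom (UP (Zp p)) (inv\<^bsub>Zp p\<^esub> (\<phi> (gal_s z (int k)))) k)"

definition mirimanoff_at :: "nat \<Rightarrow> complex \<Rightarrow> ((complex \<Rightarrow> complex) \<Rightarrow> nat \<Rightarrow> int) \<Rightarrow>
    (nat \<Rightarrow> int) \<Rightarrow> nat \<Rightarrow> int" where
  "mirimanoff_at p z \<phi> t = UnivPoly.eval (Zp p) (Zp p) (\<lambda>u. u) t (mirimanoff p z \<phi>)"

end

theory Submission
  imports
    Defs
    "HOL-Number_Theory.Number_Theory"
    "HOL-Computational_Algebra.Nth_Powers"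
begin

text \<open>
  Modulo p the assertion says that \<open>\<phi>\<^sub>m(t) \<phi>\<^sub>p\<^sub>-\<^sub>m(t) = 0\<close>, where \<open>\<chi> = \<omega>\<^sup>m\<close>,
  \<open>\<phi>\<^sub>n(t)\<close> is the sum of the \<open>k\<^sup>n\<^sup>-\<^sup>1 t\<^sup>k\<close> for 0 < k < p, and t = -y/x. Write w for the p-th root of
  (x^p + y^p)/(x + y). Every prime factor q of w splits completely in Q(zeta), and -x/y is a
  p-th root of unity h modulo w^p. By Stickelberger's factorization, a product G of Jacobi sums
  of the primes q makes w^p divide A G^p, where A is the product of the conjugates of
  x + zeta y given by a Stickelberger element; no ideals are needed, since divisibility can be
  tested by substituting the powers of h for zeta. Comparing absolute values,
  A G^p = \<plusminus>w^p zeta^r, so A is a constant times a power of zeta modulo p, and its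
  logarithmic derivatives give Kummer's congruences. Finally the product
  \<open>\<phi>\<^sub>m \<phi>\<^sub>p\<^sub>-\<^sub>m\<close> is a combination of the Kummer congruences: collecting its terms
  \<open>t\<^sup>k\<^sup>+\<^sup>l\<close> according to s = l/k, the reduction of the exponent k + l modulo p - 1 is governed
  by the carries that define the Stickelberger elements.
\<close>

section \<open>Mirimanoff's congruences as a consequence of Kummer's\<close>

text \<open>The obstacle is that x + zeta y generates only the p-th power of an ideal, and that
  ideal need not be principal. A Stickelberger element makes it principal, with a product G of
  Jacobi sums as generator. So A G^p can be compared with the rational integer w^p, and what is left
  over has absolute value 1, hence is a signed root of unity. The exponent p on G also removes G
  from the logarithmic derivative modulo p.

  On the p-adic side only residues matter: character values are (p-1)-th roots of unity, which are
  determined modulo p. If \<chi> reduces to k^m, its dual reduces to k^(p-m). Since M uses the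
  inverse character, exponent e gives \<phi> with index p - e; so M of \<chi> has index p - m and M
  of the dual has index m. Nontriviality of \<chi> excludes m = 0 and \<chi>(-1) = 1 excludes m = 1,
  so m lies in 2..p-2, the range of the indices in Kummer's congruences. The two remaining indices
  of the Fourier expansion behave differently: for n = 1 the factor (t - 1) \<phi>_1 = t^p - t
  vanishes, and n = p - 1 contributes a term whose dependence on s is only through the factor 1 +
  s.\<close>

lemma bij_betw_mult_mod:
  fixes q a :: nat
  assumes "prime q" "\<not> q dvd a"
  shows "bij_betw (\<lambda>k. (a * k) mod q) {1..<q} {1..<q}"
proof -
  have inj: "inj_on (\<lambda>k. (a * k) mod q) {1..<q}"
  proof (rule inj_onI)
    fix k l assume kl: "k \<in> {1..<q}" "l \<in> {1..<q}" "(a * k) mod q = (a * l) mod q"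
    have "coprime a q" using prime_imp_coprime[OF assms] by (simp add: coprime_commute)
    with kl(3) have "[k = l] (mod q)"
      using cong_mult_lcancel_nat by (auto simp: cong_def[symmetric])
    thus "k = l" using kl by (simp add: cong_def)
  qed
  have "(\<lambda>k. (a * k) mod q) ` {1..<q} \<subseteq> {1..<q}"
  proof (intro image_subsetI)
    fix k assume k: "k \<in> {1..<q}"
    hence "\<not> q dvd k" by (auto dest: nat_dvd_not_less)
    with assms have "\<not> q dvd a * k" by (simp add: prime_dvd_mult_iff)
    thus "(a * k) mod q \<in> {1..<q}"
      using prime_gt_0_nat[OF assms(1)] by (simp add: mod_greater_zero_iff_not_dvd Suc_le_eq)
  qed
  with inj show ?thesis by (simp add: bij_betw_def endo_inj_surj)
qed

lemma cong_int_mod: "[int (n mod q) = int n] (mod int q)"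
  by (simp add: cong_def zmod_int)

lemma cong_int_mod_power: "[int (n mod q) ^ k = int n ^ k] (mod int q)"
  by (rule cong_pow[OF cong_int_mod])

lemma not_dvd_of_range: "k \<in> {1..<q} \<Longrightarrow> \<not> (q::nat) dvd k"
  by (auto dest: nat_dvd_not_less)

lemma fermat_int:
  fixes x :: int
  assumes "prime q" "\<not> int q dvd x"
  shows "[x ^ (q - 1) = 1] (mod int q)"
proof -
  define k where "k = nat (x mod int q)"
  have q0: "int q > 0" using assms(1) prime_gt_0_nat by simp
  have k: "int k = x mod int q" using q0 by (simp add: k_def)
  hence "\<not> int q dvd int k" using assms(2) by (simp add: dvd_mod_iff)
  hence "[k ^ (q - 1) = 1] (mod q)" using fermat_theorem[OF assms(1)] by simp
  hence "[int k ^ (q - 1) = 1] (mod int q)" 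
    by (metis cong_int_iff of_nat_1 of_nat_power)
  moreover have "[x = int k] (mod int q)" by (simp add: k cong_def)
  ultimately show ?thesis using cong_pow cong_trans by blast
qed

text \<open>By Bezout h itself is a quotient of a power of h^m by a power of h^n. Applied with one
  exponent equal to p, this shows that a nontrivial p-th root of unity modulo a prime has order
  exactly p.\<close>

lemma cong_1_of_coprime_powers:
  fixes h M :: int and m n :: nat
  assumes "coprime m n" "[h ^ m = 1] (mod M)" "[h ^ n = 1] (mod M)"
  shows "[h = 1] (mod M)"
proof (cases "m = 0")
  case True
  thus ?thesis using assms by simp
next
  case False
  then obtain a b where "m * a = n * b + 1"
    using coprime_bezout_strong[of m n] assms(1) bezout_nat[of m n] by (metis coprime_iff_gcd_eq_1)
  hence "(h ^ m) ^ a = (h ^ n) ^ b * h" by (simp flip: power_mult)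
  moreover have "[(h ^ m) ^ a = 1 ^ a] (mod M)" by (intro cong_pow assms)
  moreover have "[(h ^ n) ^ b * h = 1 ^ b * h] (mod M)" by (intro cong_mult cong_pow assms cong_refl)
  ultimately show ?thesis by (metis cong_sym cong_trans mult_1 power_one)
qed

text \<open>Multiplication by a primitive root g permutes the nonzero residues and multiplies the
  sum by g^n, which is not 1 for 0 < n < q - 1.\<close>

lemma power_sum_cong_0:
  fixes q n :: nat
  assumes q: "prime q" and n: "0 < n" "n < q - 1"
  shows "[(\<Sum>k\<in>{1..<q}. int k ^ n) = 0] (mod int q)"
proof -
  obtain g where g: "residue_primroot q g"
    using prime_primitive_root_exists[of q] q prime_gt_1_nat by blast
  have cop: "coprime g q" using g by (auto simp: residue_primroot_def coprime_commute)
  have ndvd: "\<not> q dvd g" 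
    using cop q by (metis coprime_absorb_right coprime_commute not_prime_unit)
  have ord: "ord q g = q - 1" using g q by (simp add: residue_primroot_def totient_prime)
  have "\<not> [g ^ n = 1] (mod q)"
    using n ord ord_divides[of g n q] by (auto dest: nat_dvd_not_less)
  hence ne: "\<not> int q dvd int g ^ n - 1"
    by (metis cong_iff_dvd_diff cong_int_iff of_nat_1 of_nat_power)
  define S where "S = (\<Sum>k\<in>{1..<q}. int k ^ n)"
  have "S = (\<Sum>k\<in>{1..<q}. int ((g * k) mod q) ^ n)"
    unfolding S_def by (rule sum.reindex_bij_betw[OF bij_betw_mult_mod[OF q ndvd], symmetric])
  also have "[\<dots> = (\<Sum>k\<in>{1..<q}. int (g * k) ^ n)] (mod int q)"
    by (intro cong_sum cong_int_mod_power)
  also have "(\<Sum>k\<in>{1..<q}. int (g * k) ^ n) = int g ^ n * S"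
    by (simp add: S_def sum_distrib_left power_mult_distrib)
  finally have "[S = int g ^ n * S] (mod int q)" .
  hence "int q dvd int g ^ n * S - S" by (metis cong_iff_dvd_diff cong_sym)
  also have "int g ^ n * S - S = (int g ^ n - 1) * S" by (simp add: algebra_simps)
  finally have "int q dvd S" using ne q by (metis prime_dvd_mult_iff prime_nat_int_transfer)
  thus ?thesis by (simp add: S_def cong_0_iff)
qed

text \<open>All power sums over Z/q of exponent below q - 1 vanish, the one of exponent 0 because it
  equals q. This is the source both of the vanishing of Jacobi sums and of the vanishing moments of
  the cyclotomic polynomial.\<close>

lemma sum_poly_cong_0:
  fixes q :: nat and P :: "int poly"
  assumes q: "prime q" and d: "degree P < q - 1"
  shows "[(\<Sum>u<q. poly P (int u)) = 0] (mod int q)"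
proof -
  have s: "[(\<Sum>u<q. int u ^ n) = 0] (mod int q)" if "n < q - 1" for n
  proof (cases "n = 0")
    case False
    have "{..<q} = insert 0 {1..<q}" using prime_gt_0_nat[OF q] by auto
    hence "(\<Sum>u<q. int u ^ n) = (\<Sum>u\<in>{1..<q}. int u ^ n)" using False by simp
    thus ?thesis using power_sum_cong_0[OF q _ that] False by simp
  qed (simp add: cong_0_iff)
  have "(\<Sum>u<q. poly P (int u)) = (\<Sum>i\<le>degree P. coeff P i * (\<Sum>u<q. int u ^ i))"
    by (simp add: poly_altdef sum_distrib_left sum.swap[of _ "{..<q}"])
  also have "[\<dots> = (\<Sum>i\<le>degree P. coeff P i * 0)] (mod int q)"
    using d by (intro cong_sum cong_mult s) auto
  finally show ?thesis by simp
qed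

section \<open>The sums \<phi>_n(t), their Fourier inversion, and carries\<close>

definition mirimanoff_sum :: "nat \<Rightarrow> int \<Rightarrow> nat \<Rightarrow> int" where
  "mirimanoff_sum p t n = (\<Sum>k\<in>{1..<p}. int k ^ (n - 1) * t ^ k)"

text \<open>The support of the Stickelberger element with coefficients
  \<open>\<lfloor>(s + 1) j / p\<rfloor> - \<lfloor>s j / p\<rfloor>\<close>.\<close>

definition carry :: "nat \<Rightarrow> nat \<Rightarrow> nat set" where
  "carry p s = {j \<in> {1..<p}. p < j + (s * j) mod p}"

text \<open>Fourier inversion on the unit group of Z/p: the sum over n of k^(n-1) l^(p-1-n) is (p-1)
  l^(p-2) for k = l, and otherwise the quotient of k^(p-1) - l^(p-1), which is 0 modulo p, by the
  unit k - l. It isolates a single term t^l / l.\<close>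

lemma mirimanoff_sum_fourier:
  assumes p: "prime p" and l: "l \<in> {1..<p}"
  shows "[int l ^ (p - 2) * t ^ l = - (\<Sum>n\<in>{1..<p}. mirimanoff_sum p t n * int l ^ (p - 1 - n))] (mod int p)"
proof -
  have p2: "p \<ge> 2" using p prime_ge_2_nat by blast
  have nd: "\<not> int p dvd int k" if "k \<in> {1..<p}" for k
    using that not_dvd_of_range by simp
  have kl: "[(\<Sum>n\<in>{1..<p}. int k ^ (n - 1) * int l ^ (p - 1 - n)) = (if k = l then - (int l ^ (p-2)) else 0)] (mod int p)"
    if k: "k \<in> {1..<p}" for k
  proof (cases "k = l")
    case True
    have "(\<Sum>n\<in>{1..<p}. int k ^ (n - 1) * int l ^ (p - 1 - n)) = (\<Sum>n\<in>{1..<p}. int l ^ (p - 2))"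
      using True by (intro sum.cong) (auto simp flip: power_add)
    also have "\<dots> = (int p - 1) * int l ^ (p - 2)" using p2 by (simp add: of_nat_diff)
    also have "[\<dots> = - (int l ^ (p-2))] (mod int p)"
      by (simp add: cong_iff_dvd_diff algebra_simps)
    finally show ?thesis using True by simp
  next
    case False
    have "(\<Sum>n\<in>{1..<p}. int k ^ (n - 1) * int l ^ (p - 1 - n)) = (\<Sum>i<p-1. int l ^ (p - 1 - Suc i) * int k ^ i)"
      by (rule sum.reindex_bij_witness[of _ Suc "\<lambda>n. n - 1"]) auto
    hence "(int k - int l) * (\<Sum>n\<in>{1..<p}. int k ^ (n - 1) * int l ^ (p - 1 - n)) = int k ^ (p - 1) - int l ^ (p - 1)"
      using power_diff_sumr2[of "int k" "p-1" "int l"] by simp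
    moreover have "[int k ^ (p - 1) = int l ^ (p - 1)] (mod int p)"
      using fermat_int[OF p nd[OF k]] fermat_int[OF p nd[OF l]] cong_sym cong_trans by blast
    ultimately have "int p dvd (int k - int l) * (\<Sum>n\<in>{1..<p}. int k ^ (n - 1) * int l ^ (p - 1 - n))"
      by (simp add: cong_iff_dvd_diff)
    moreover have "\<not> int p dvd int k - int l"
      using False k l 
      by (metis atLeastLessThan_iff cong_def cong_iff_dvd_diff cong_int_iff mod_less)
    ultimately show ?thesis using p False
      by (simp add: prime_dvd_mult_iff cong_0_iff)
  qed
  have "(\<Sum>n\<in>{1..<p}. mirimanoff_sum p t n * int l ^ (p - 1 - n)) = 
    (\<Sum>k\<in>{1..<p}. t ^ k * (\<Sum>n\<in>{1..<p}. int k ^ (n - 1) * int l ^ (p - 1 - n)))"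
    unfolding mirimanoff_sum_def sum_distrib_left sum_distrib_right
    by (subst sum.swap) (simp add: mult_ac)
  also have "[\<dots> = (\<Sum>k\<in>{1..<p}. t ^ k * (if k = l then - (int l ^ (p-2)) else 0))] (mod int p)"
    by (intro cong_sum cong_mult kl) auto
  also have "(\<Sum>k\<in>{1..<p}. t ^ k * (if k = l then - (int l ^ (p-2)) else 0)) = - (int l ^ (p - 2) * t ^ l)"
    using l by (simp add: if_distrib cong: if_cong)
  finally have "[(\<Sum>n\<in>{1..<p}. mirimanoff_sum p t n * int l ^ (p - 1 - n)) = - (int l ^ (p - 2) * t ^ l)] (mod int p)" .
  from cong_uminus[OF cong_sym[OF this]] show ?thesis by simp
qed

text \<open>Replacing j by p - j replaces j + (s j mod p) by 2p minus that number, and the middle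
  value p never occurs because p does not divide s + 1. Hence carry sets have (p-1)/2 elements, and
  complex conjugation exchanges a carry set with its complement.\<close>

lemma carry_reflection:
  assumes p: "prime p" "p > 2" and s: "s \<in> {1..p-2}"
  shows "bij_betw (\<lambda>j. p - j) (carry p s) ({1..<p} - carry p s)"
proof -
  have r: "(s * (p - j)) mod p = p - (s * j) mod p" "0 < (s * j) mod p" "j + s * j mod p \<noteq> p" if j: "j \<in> {1..<p}" for j
  proof -
    have "\<not> p dvd s" "\<not> p dvd j" "\<not> p dvd s + 1" using p j s by (auto dest!: dvd_imp_le)
    note nd = this
    have "\<not> p dvd s * j" using p nd by (auto simp: prime_dvd_mult_iff)
    thus pos: "0 < (s * j) mod p" by (simp add: mod_greater_zero_iff_not_dvd)
    have lt: "(s * j) mod p < p" using j by auto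
    have "(s * (p - j) + s * j) mod p = 0" using j by (simp flip: distrib_left)
    hence "((s * (p - j)) mod p + (s * j) mod p) mod p = 0" by (simp add: mod_add_eq)
    then obtain c where c: "(s * (p - j)) mod p + (s * j) mod p = p * c" by auto
    moreover have "(s * (p - j)) mod p < p" using j by auto
    ultimately have "p * c < p * 2" "0 < p * c" using lt pos by linarith+
    hence "c = 1" using p by simp
    thus "(s * (p - j)) mod p = p - (s * j) mod p" using c by simp
    have "\<not> p dvd j * (s + 1)" using p nd prime_dvd_mult_iff by blast
    hence "(j + s * j) mod p \<noteq> 0" by (simp add: algebra_simps dvd_eq_mod_eq_0)
    hence "(j + s * j mod p) mod p \<noteq> 0" by (simp add: mod_add_right_eq)
    thus "j + s * j mod p \<noteq> p" by auto
  qed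
  show ?thesis
  proof (rule bij_betwI[where g = "\<lambda>j. p - j"])
    show "(\<lambda>j. p - j) \<in> carry p s \<rightarrow> {1..<p} - carry p s"
    proof
      fix j assume "j \<in> carry p s"
      hence j: "j \<in> {1..<p}" "p < j + (s * j) mod p" by (auto simp: carry_def)
      thus "p - j \<in> {1..<p} - carry p s" using r[OF j(1)] by (auto simp: carry_def)
    qed
    show "(\<lambda>j. p - j) \<in> {1..<p} - carry p s \<rightarrow> carry p s"
    proof
      fix j assume "j \<in> {1..<p} - carry p s"
      hence j: "j \<in> {1..<p}" "\<not> p < j + (s * j) mod p" by (auto simp: carry_def)
      thus "p - j \<in> carry p s" using r[OF j(1)] by (auto simp: carry_def)
    qed
  qed (auto simp: carry_def)
qed

text \<open>Grouping the product by s = l/k modulo p turns it into the sum of s^(p-1-m) P(s).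
  Kummer's congruences make P(s) a constant multiple of 1 + s, and then two vanishing power sums in
  s finish the proof.\<close>

lemma mirimanoff_of_kummer:
  fixes t :: int
  assumes p: "prime p" "p > 2" and t: "\<not> int p dvd t"
  and kummer: "\<And>s n. s \<in> {1..p-2} \<Longrightarrow> n \<in> {2..p-2} \<Longrightarrow>
       [mirimanoff_sum p t n * (\<Sum>j\<in>carry p s. int j ^ (p - 1 - n)) = 0] (mod int p)"
  and m: "m \<in> {2..p-2}"
  shows "[mirimanoff_sum p t m * mirimanoff_sum p t (p - m) = 0] (mod int p)"
proof -
  \<comment> \<open>For l = s k the weights k^(m-1) and l^(p-1-m) multiply to s^(p-1-m) k^(p-2), and
    k^(p-2) stands for 1/k; so P no longer depends on m.\<close>
  define P where "P s = (\<Sum>k\<in>{1..<p}. int k ^ (p - 2) * t ^ (k + (s * k) mod p))" for s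
  \<comment> \<open>Every carry set with 1 \<le> s \<le> p - 2 has (p-1)/2 elements; s = 1 serves as
    the representative.\<close>
  define C where "C = int (card (carry p 1))"
  have tp: "[t ^ p = t] (mod int p)"
  proof -
    have "[t * t ^ (p - 1) = t * 1] (mod int p)" by (intro cong_mult fermat_int p t cong_refl)
    thus ?thesis using p by (simp flip: power_Suc)
  qed
  have nd: "\<not> p dvd k" if "k \<in> {1..<p}" for k using that by (rule not_dvd_of_range)
  \<comment> \<open>This takes care of the index n = 1, for which no Kummer congruence is
    assumed.\<close>
  have phi1: "[(t - 1) * mirimanoff_sum p t 1 = 0] (mod int p)"
  proof -
    have "(t - 1) * mirimanoff_sum p t 1 = t ^ p - t" 
    proof -
      have "{..<p} = insert 0 {1..<p}" using p by auto
      hence "(\<Sum>k<p. t^k) = 1 + mirimanoff_sum p t 1" by (simp add: mirimanoff_sum_def)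
      moreover have "(t - 1) * (\<Sum>k<p. t^k) = t ^ p - 1" using power_diff_1_eq[of t p] by simp
      ultimately show ?thesis by (simp add: algebra_simps)
    qed
    thus ?thesis using tp by (simp add: cong_iff_dvd_diff)
  qed
  have card: "2 * int (card (carry p s)) = int p - 1" if s: "s \<in> {1..p-2}" for s
  proof -
    have "card (carry p s) = card ({1..<p} - carry p s)"
      using bij_betw_same_card[OF carry_reflection[OF p s]] .
    also have "\<dots> = (p - 1) - card (carry p s)"
      by (subst card_Diff_subset) (auto simp: carry_def)
    finally have "2 * card (carry p s) = p - 1"
      by (metis (no_types, lifting) card_mono carry_def card_atLeastLessThan finite_atLeastLessThan mem_Collect_eq subsetI le_add_diff_inverse mult_2)
    thus ?thesis using p by (simp add: of_nat_diff flip: of_nat_mult)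
  qed
  have cardC: "int (card (carry p s)) = C" if s: "s \<in> {1..p-2}" for s
    proof -
    have "(1::nat) \<in> {1..p-2}" using p by auto
    thus ?thesis using card[OF s] card[of 1] by (simp add: C_def)
  qed
  \<comment> \<open>The first summand comes from the exponents without carry; the second is the only
    surviving Fourier term, n = p - 1, whose sum over the carry set is just its cardinality.\<close>
  define Q where "Q = mirimanoff_sum p t (p - 1) * (1 - (t - 1) * C)"
  have Peq: "[P s = (1 + int s) * Q] (mod int p)" if s: "s \<in> {1..<p}" for s
  proof (cases "s = p - 1")
    case True
    \<comment> \<open>For s = p - 1 the residue of s k is p - k, so t^p comes out of the sum and a
      vanishing power sum remains; the factor 1 + s = p vanishes on the other side.\<close>
    have e: "k + (s * k) mod p = p" if k: "k \<in> {1..<p}" for k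
    proof -
      have "(s * k + k) mod p = 0" using True p by (simp add: algebra_simps diff_mult_distrib)
      hence "((s * k) mod p + k) mod p = 0" by (simp add: mod_add_left_eq)
      then obtain c where c: "(s * k) mod p + k = p * c" by auto
      moreover have "(s * k) mod p < p" using k by auto
      ultimately have "p * c < p * 2" "0 < p * c" using k unfolding atLeastLessThan_iff by linarith+
      hence "c = 1" using p by simp
      with c show ?thesis by simp
    qed
    have "P s = t ^ p * (\<Sum>k\<in>{1..<p}. int k ^ (p - 2))"
      unfolding P_def sum_distrib_left by (intro sum.cong) (auto simp: e)
    also have "[\<dots> = t ^ p * 0] (mod int p)"
      using p by (intro cong_mult power_sum_cong_0) auto
    finally have "[P s = 0] (mod int p)" by simp
    moreover have "[(1 + int s) * Q = 0] (mod int p)" using True p by (simp add: cong_0_iff of_nat_diff)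
    ultimately show ?thesis using cong_sym cong_trans by blast
  next
    case False
    hence s': "s \<in> {1..p-2}" using s by auto
    define l where "l k = ((1 + s) * k) mod p" for k
    have ns: "\<not> p dvd (1 + s)" using s' p by (auto dest!: dvd_imp_le)
    have bij: "bij_betw l {1..<p} {1..<p}" unfolding l_def by (rule bij_betw_mult_mod[OF p(1) ns])
    have lr: "l k \<in> {1..<p}" if "k \<in> {1..<p}" for k using bij that bij_betwE by blast
    have inv: "[int k ^ (p - 2) = (1 + int s) * int (l k) ^ (p - 2)] (mod int p)" if k: "k \<in> {1..<p}" for k
    proof -
      have "[(1 + int s) * int (l k) ^ (p - 2) = (1 + int s) * int ((1 + s) * k) ^ (p - 2)] (mod int p)"
        unfolding l_def by (intro cong_mult cong_int_mod_power cong_refl)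
      also have "(1 + int s) * int ((1 + s) * k) ^ (p - 2) = (1 + int s) ^ Suc (p - 2) * int k ^ (p - 2)"
        by (simp only: of_nat_mult of_nat_add of_nat_1 power_mult_distrib power_Suc mult_ac)
      also have "Suc (p - 2) = p - 1" using p by simp
      also have "[(1 + int s) ^ (p - 1) * int k ^ (p - 2) = 1 * int k ^ (p - 2)] (mod int p)"
        using ns by (intro cong_mult fermat_int p cong_refl) (metis int_dvd_int_iff of_nat_1 of_nat_add)
      finally show ?thesis by (simp add: cong_sym)
    qed
    \<comment> \<open>Passing from k + (s k mod p) to its residue l drops a factor t^p, that is t
      modulo p, exactly when a carry occurs.\<close>
    have tk: "[t ^ (k + (s * k) mod p) = t ^ l k * (1 + (t - 1) * (if k \<in> carry p s then 1 else 0))] (mod int p)" 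
      if k: "k \<in> {1..<p}" for k
    proof -
      define r where "r = (s * k) mod p"
      have l: "l k = (k + r) mod p" by (simp add: l_def r_def mod_add_right_eq)
      have rp: "r < p" using k by (simp add: r_def)
      have "k + r = l k + p * (if k \<in> carry p s then 1 else 0)"
      proof (cases "k + r < p")
        case True
        thus ?thesis using l by (simp add: carry_def r_def[symmetric])
      next
        case False
        hence "(k + r) mod p = k + r - p" using k rp by (simp add: le_mod_geq)
        with lr[OF k] l False have "p < k + r" by auto
        with l k \<open>(k + r) mod p = k + r - p\<close> show ?thesis by (simp add: carry_def r_def[symmetric])
      qed
      hence "k + (s * k) mod p = l k + p * (if k \<in> carry p s then 1 else 0)" by (simp only: r_def)
      hence "t ^ (k + (s * k) mod p) = t ^ l k * (if k \<in> carry p s then t ^ p else 1)"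
        by (simp add: power_add)
      also have "[\<dots> = t ^ l k * (if k \<in> carry p s then t else 1)] (mod int p)"
        using tp by (intro cong_mult cong_refl) auto
      finally show ?thesis by (simp split: if_splits)
    qed
    have "[P s = (\<Sum>k\<in>{1..<p}. ((1 + int s) * int (l k) ^ (p - 2)) * (t ^ l k * (1 + (t - 1) * (if k \<in> carry p s then 1 else 0))))] (mod int p)"
      unfolding P_def by (intro cong_sum cong_mult inv tk)
    also have "(\<Sum>k\<in>{1..<p}. ((1 + int s) * int (l k) ^ (p - 2)) * (t ^ l k * (1 + (t - 1) * (if k \<in> carry p s then 1 else 0)))) = 
       (1 + int s) * ((\<Sum>k\<in>{1..<p}. int (l k) ^ (p - 2) * t ^ l k) + (t - 1) * (\<Sum>k\<in>{1..<p}. if k \<in> carry p s then int (l k) ^ (p - 2) * t ^ l k else 0))"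
      unfolding sum_distrib_left sum.distrib[symmetric]
      by (intro sum.cong) (auto simp: algebra_simps)
    also have "(\<Sum>k\<in>{1..<p}. int (l k) ^ (p - 2) * t ^ l k) = mirimanoff_sum p t (p - 1)"
      using sum.reindex_bij_betw[OF bij, of "\<lambda>k. int k ^ (p - 2) * t ^ k"] by (simp add: mirimanoff_sum_def numeral_2_eq_2)
    also have "(\<Sum>k\<in>{1..<p}. if k \<in> carry p s then int (l k) ^ (p - 2) * t ^ l k else 0) = 
      (\<Sum>k\<in>carry p s. int (l k) ^ (p - 2) * t ^ l k)"
      by (rule sum.mono_neutral_cong_right) (auto simp: carry_def)
    finally have 1: "[P s = (1 + int s) * (mirimanoff_sum p t (p - 1) + (t - 1) * (\<Sum>k\<in>carry p s. int (l k) ^ (p - 2) * t ^ l k))] (mod int p)" .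
    have "[(t - 1) * (\<Sum>k\<in>carry p s. int (l k) ^ (p - 2) * t ^ l k) = 
       (t - 1) * (\<Sum>k\<in>carry p s. - (\<Sum>n\<in>{1..<p}. mirimanoff_sum p t n * int (l k) ^ (p - 1 - n)))] (mod int p)"
      by (intro cong_mult cong_refl cong_sum mirimanoff_sum_fourier p lr) (auto simp: carry_def)
    also have "[(t - 1) * (\<Sum>k\<in>carry p s. - (\<Sum>n\<in>{1..<p}. mirimanoff_sum p t n * int (l k) ^ (p - 1 - n))) =
       (t - 1) * (\<Sum>k\<in>carry p s. - (\<Sum>n\<in>{1..<p}. mirimanoff_sum p t n * int ((1 + s) * k) ^ (p - 1 - n)))] (mod int p)"
      unfolding cong_minus_minus_iff l_def
      by (intro cong_mult cong_refl cong_sum) (subst cong_minus_minus_iff, intro cong_mult cong_refl cong_sum cong_int_mod_power)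
    also have "(t - 1) * (\<Sum>k\<in>carry p s. - (\<Sum>n\<in>{1..<p}. mirimanoff_sum p t n * int ((1 + s) * k) ^ (p - 1 - n))) = 
       (\<Sum>n\<in>{1..<p}. - ((t - 1) * (1 + int s) ^ (p - 1 - n) * (mirimanoff_sum p t n * (\<Sum>k\<in>carry p s. int k ^ (p - 1 - n)))))"
      (is "?L = ?R")
    proof -
      have e: "int ((1 + s) * k) ^ n = (1 + int s) ^ n * int k ^ n" for k n
        by (simp only: of_nat_mult of_nat_add of_nat_1 power_mult_distrib)
      have "?L = - (\<Sum>k\<in>carry p s. \<Sum>n\<in>{1..<p}. (t - 1) * (mirimanoff_sum p t n * ((1 + int s) ^ (p - 1 - n) * int k ^ (p - 1 - n))))"
        unfolding e by (simp add: sum_negf sum_distrib_left)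
      also have "\<dots> = - (\<Sum>n\<in>{1..<p}. \<Sum>k\<in>carry p s. (t - 1) * (mirimanoff_sum p t n * ((1 + int s) ^ (p - 1 - n) * int k ^ (p - 1 - n))))"
        by (subst sum.swap) (rule refl)
      also have "\<dots> = ?R"
        unfolding sum_negf sum_distrib_left by (simp only: mult_ac)
      finally show ?thesis .
    qed
    also have "[\<dots> = (\<Sum>n\<in>{1..<p}. if n = p - 1 then - ((t - 1) * mirimanoff_sum p t (p - 1) * C) else 0)] (mod int p)"
    proof (rule cong_sum)
      fix n assume n: "n \<in> {1..<p}"
      consider "n = 1" | "n = p - 1" | "n \<in> {2..p-2}" using n by fastforce
      thus "[- ((t - 1) * (1 + int s) ^ (p - 1 - n) * (mirimanoff_sum p t n * (\<Sum>k\<in>carry p s. int k ^ (p - 1 - n)))) = 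
          (if n = p - 1 then - ((t - 1) * mirimanoff_sum p t (p - 1) * C) else 0)] (mod int p)"
      proof cases
        case 1
        have "- ((t - 1) * (1 + int s) ^ (p - 1 - n) * (mirimanoff_sum p t n * (\<Sum>k\<in>carry p s. int k ^ (p - 1 - n)))) = 
          ((t - 1) * mirimanoff_sum p t 1) * (- ((1 + int s) ^ (p - 1 - n) * (\<Sum>k\<in>carry p s. int k ^ (p - 1 - n))))"
          using 1 by (simp add: algebra_simps)
        also have "[\<dots> = 0 * (- ((1 + int s) ^ (p - 1 - n) * (\<Sum>k\<in>carry p s. int k ^ (p - 1 - n))))] (mod int p)"
          by (intro cong_mult phi1 cong_refl)
        finally show ?thesis using 1 p by auto
      next
        case 2
        thus ?thesis using cardC[OF s'] by (simp add: algebra_simps)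
      next
        case 3
        have "[- ((t - 1) * (1 + int s) ^ (p - 1 - n) * (mirimanoff_sum p t n * (\<Sum>k\<in>carry p s. int k ^ (p - 1 - n)))) =
          - ((t - 1) * (1 + int s) ^ (p - 1 - n) * 0)] (mod int p)"
          unfolding cong_minus_minus_iff by (intro cong_mult cong_refl kummer s' 3)
        moreover have "n \<noteq> p - 1" using 3 by auto
        ultimately show ?thesis by simp
      qed
    qed
    also have "(\<Sum>n\<in>{1..<p}. if n = p - 1 then - ((t - 1) * mirimanoff_sum p t (p - 1) * C) else 0) = - ((t - 1) * mirimanoff_sum p t (p - 1) * C)"
      using p by simp
    finally have 2: "[(t - 1) * (\<Sum>k\<in>carry p s. int (l k) ^ (p - 2) * t ^ l k) = - ((t - 1) * mirimanoff_sum p t (p - 1) * C)] (mod int p)" .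
    have "[(1 + int s) * (mirimanoff_sum p t (p - 1) + (t - 1) * (\<Sum>k\<in>carry p s. int (l k) ^ (p - 2) * t ^ l k)) = 
       (1 + int s) * (mirimanoff_sum p t (p - 1) + (- ((t - 1) * mirimanoff_sum p t (p - 1) * C)))] (mod int p)"
      by (intro cong_mult cong_add cong_refl 2)
    with 1 have "[P s = (1 + int s) * (mirimanoff_sum p t (p - 1) + (- ((t - 1) * mirimanoff_sum p t (p - 1) * C)))] (mod int p)"
      using cong_trans by blast
    thus ?thesis by (simp add: Q_def algebra_simps)
  qed
  have "mirimanoff_sum p t m * mirimanoff_sum p t (p - m) = (\<Sum>k\<in>{1..<p}. int k ^ (m - 1) * t ^ k * mirimanoff_sum p t (p - m))"
    by (simp add: mirimanoff_sum_def[of _ _ m] sum_distrib_right)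
  also have "\<dots> = (\<Sum>k\<in>{1..<p}. int k ^ (m - 1) * t ^ k * (\<Sum>s\<in>{1..<p}. int ((k * s) mod p) ^ (p - 1 - m) * t ^ ((k * s) mod p)))"
  proof (intro sum.cong refl)
    fix k assume k: "k \<in> {1..<p}"
    show "int k ^ (m - 1) * t ^ k * mirimanoff_sum p t (p - m) = int k ^ (m - 1) * t ^ k * (\<Sum>s\<in>{1..<p}. int ((k * s) mod p) ^ (p - 1 - m) * t ^ ((k * s) mod p))"
      using sum.reindex_bij_betw[OF bij_betw_mult_mod[OF p(1) nd[OF k]], of "\<lambda>l. int l ^ (p - 1 - m) * t ^ l"]
      by (simp add: mirimanoff_sum_def diff_commute)
  qed
  finally have 1: "mirimanoff_sum p t m * mirimanoff_sum p t (p - m) = \<dots>" .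
  have 2: "[(\<Sum>k\<in>{1..<p}. int k ^ (m - 1) * t ^ k * (\<Sum>s\<in>{1..<p}. int ((k * s) mod p) ^ (p - 1 - m) * t ^ ((k * s) mod p))) = (\<Sum>k\<in>{1..<p}. int k ^ (m - 1) * t ^ k * (\<Sum>s\<in>{1..<p}. int (k * s) ^ (p - 1 - m) * t ^ ((k * s) mod p)))] (mod int p)"
    by (rule cong_sum, rule cong_mult[OF cong_refl], rule cong_sum, rule cong_mult[OF cong_int_mod_power cong_refl])
  have 3: "(\<Sum>k\<in>{1..<p}. int k ^ (m - 1) * t ^ k * (\<Sum>s\<in>{1..<p}. int (k * s) ^ (p - 1 - m) * t ^ ((k * s) mod p))) = 
    (\<Sum>s\<in>{1..<p}. int s ^ (p - 1 - m) * P s)"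
    (is "?L = ?R")
  proof -
    have e: "int k ^ (m - 1) * t ^ k * (int (k * s) ^ (p - 1 - m) * t ^ (k * s mod p)) = int s ^ (p - 1 - m) * (int k ^ (p - 2) * t ^ (k + s * k mod p))"
      for s k
    proof -
      have "int k ^ (p - 2) = int k ^ (m - 1) * int k ^ (p - 1 - m)" using m by (auto simp: numeral_2_eq_2 simp flip: power_add)
      thus ?thesis by (simp only: power_add power_mult_distrib of_nat_mult mult_ac)
    qed
    have "?L = (\<Sum>k\<in>{1..<p}. \<Sum>s\<in>{1..<p}. int s ^ (p - 1 - m) * (int k ^ (p - 2) * t ^ (k + s * k mod p)))"
      by (simp only: sum_distrib_left e)
    also have "\<dots> = (\<Sum>s\<in>{1..<p}. \<Sum>k\<in>{1..<p}. int s ^ (p - 1 - m) * (int k ^ (p - 2) * t ^ (k + s * k mod p)))"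
      by (rule sum.swap)
    finally show ?thesis by (simp only: P_def sum_distrib_left)
  qed
  have "[(\<Sum>s\<in>{1..<p}. int s ^ (p - 1 - m) * P s) = (\<Sum>s\<in>{1..<p}. int s ^ (p - 1 - m) * ((1 + int s) * Q))] (mod int p)"
    by (rule cong_sum, rule cong_mult[OF cong_refl Peq])
  also have "(\<Sum>s\<in>{1..<p}. int s ^ (p - 1 - m) * ((1 + int s) * Q)) = 
     Q * ((\<Sum>s\<in>{1..<p}. int s ^ (p - 1 - m)) + (\<Sum>s\<in>{1..<p}. int s ^ Suc (p - 1 - m)))"
    by (simp add: sum_distrib_left algebra_simps flip: sum.distrib)
  \<comment> \<open>For m in 2..p-2 both exponents, p - 1 - m and p - m, lie strictly between 0 and
    p - 1.\<close>
  also have "[\<dots> = Q * (0 + 0)] (mod int p)"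
    using m by (intro cong_mult cong_add cong_refl power_sum_cong_0 p) auto
  finally have "[(\<Sum>s\<in>{1..<p}. int s ^ (p - 1 - m) * P s) = 0] (mod int p)" by simp
  thus ?thesis using 2 unfolding 1 3 by (rule cong_trans[rotated])
qed

section \<open>The ring of cyclotomic integers\<close>

text \<open>Elements of Z[zeta] are represented by integer polynomials. The same polynomial can then
  be read at zeta, at a conjugate zeta^k, or at a residue h^j modulo an integer, which replaces
  reduction modulo prime ideals.\<close>

definition ev :: "int poly \<Rightarrow> complex \<Rightarrow> complex" where
  "ev f z = poly (map_poly of_int f) z"

lemma ev_0 [simp]: "ev 0 z = 0" and ev_pCons [simp]: "ev (pCons a f) z = of_int a + z * ev f z"
  by (simp_all add: ev_def map_poly_pCons)

lemma ev_1 [simp]: "ev 1 z = 1"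
  by (simp add: one_pCons)

lemma ev_add [simp]: "ev (f + g) z = ev f z + ev g z"
proof (induction f arbitrary: g)
  case (pCons a f)
  thus ?case by (cases g) (simp add: algebra_simps)
qed simp

lemma ev_smult [simp]: "ev (smult a f) z = of_int a * ev f z"
  by (induction f) (simp_all add: algebra_simps)

lemma ev_minus [simp]: "ev (- f) z = - ev f z"
  using ev_smult[of "-1" f z] by (simp del: ev_smult)

lemma ev_diff [simp]: "ev (f - g) z = ev f z - ev g z"
  using ev_add[of f "- g" z] by (simp del: ev_add)

lemma ev_mult [simp]: "ev (f * g) z = ev f z * ev g z"
  by (induction f) (simp_all add: algebra_simps)

lemma ev_power [simp]: "ev (f ^ n) z = ev f z ^ n"
  by (induction n) simp_all

lemma ev_sum [simp]: "ev (\<Sum>i\<in>I. f i) z = (\<Sum>i\<in>I. ev (f i) z)"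
  by (induction I rule: infinite_finite_induct) simp_all

lemma ev_prod [simp]: "ev (\<Prod>i\<in>I. f i) z = (\<Prod>i\<in>I. ev (f i) z)"
  by (induction I rule: infinite_finite_induct) simp_all

lemma ev_monom [simp]: "ev (monom a n) z = of_int a * z ^ n"
  by (induction n) (simp_all add: monom_0 monom_Suc)

lemma ev_of_int [simp]: "ev (of_int a) z = of_int a"
  by (simp add: of_int_poly)

lemma ev_pcompose [simp]: "ev (pcompose f g) z = ev f (ev g z)"
  by (induction f) (simp_all add: pcompose_pCons)

lemma cnj_ev: "cnj (ev f z) = ev f (cnj z)"
  by (induction f) simp_all

lemma ev_altdef: "ev f z = (\<Sum>i\<le>degree f. of_int (coeff f i) * z ^ i)"
proof -
  have "ev f z = ev (\<Sum>i\<le>degree f. monom (coeff f i) i) z" by (simp only: poly_as_sum_of_monoms)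
  thus ?thesis by simp
qed

text \<open>Since g is monic, subtracting a monomial multiple of g cancels the leading term without
  a division, so quotient and remainder stay integral.\<close>

lemma monic_division:
  fixes f g :: "int poly"
  assumes "lead_coeff g = 1" "degree g > 0"
  shows "\<exists>q r. f = g * q + r \<and> degree r < degree g"
proof (induction "degree f" arbitrary: f rule: less_induct)
  case less
  show ?case
  proof (cases "degree f < degree g")
    case True
    thus ?thesis by (intro exI[of _ 0] exI[of _ f]) simp
  next
    case False
    define f' where "f' = f - g * monom (lead_coeff f) (degree f - degree g)"
    have "degree f' < degree f"
    proof (rule degree_lessI)
      have f0: "f \<noteq> 0" using False assms by auto
      thus "f' \<noteq> 0 \<or> degree f > 0" using False assms by auto
      have "degree (g * monom (lead_coeff f) (degree f - degree g)) = degree f"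
        using False assms f0 by (subst degree_mult_eq) (auto simp: degree_monom_eq)
      thus "\<forall>k\<ge>degree f. coeff f' k = 0"
        using False assms
        using assms(1) False by (auto simp: f'_def le_less coeff_eq_0 coeff_monom_mult mult.commute[of g] not_less diff_diff_cancel)
    qed
    from less[OF this] obtain q r where "f' = g * q + r" "degree r < degree g" by blast
    thus ?thesis
      by (intro exI[of _ "q + monom (lead_coeff f) (degree f - degree g)"] exI[of _ r])
         (auto simp: f'_def algebra_simps)
  qed
qed

locale prime_cyclotomic =
  fixes p :: nat and \<zeta> :: complex
  assumes p: "prime p" "p > 2" and prim: "primitive_root_of_unity p \<zeta>"
begin

lemma zeta_p [simp]: "\<zeta> ^ p = 1"
  using prim by (simp add: primitive_root_of_unity_def)

lemma zeta_nz [simp]: "\<zeta> \<noteq> 0"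
  using zeta_p p by (metis power_0_left not_less0 zero_neq_one)

lemma zeta_mod: "\<zeta> ^ (n mod p) = \<zeta> ^ n"
proof -
  have "\<zeta> ^ n = \<zeta> ^ (p * (n div p) + n mod p)" by simp
  also have "\<dots> = \<zeta> ^ (n mod p)" unfolding power_add power_mult by simp
  finally show ?thesis by simp
qed

lemma zeta_pow_eq_1_iff: "\<zeta> ^ n = 1 \<longleftrightarrow> p dvd n"
proof
  assume "\<zeta> ^ n = 1"
  hence "\<zeta> ^ (n mod p) = 1" by (simp add: zeta_mod)
  moreover have "n mod p < p" using p by simp
  ultimately have "n mod p = 0"
    using prim by (auto simp: primitive_root_of_unity_def)
  thus "p dvd n" by auto
qed (auto simp: power_mult)

lemma zeta_pow_eq_iff: "\<zeta> ^ m = \<zeta> ^ n \<longleftrightarrow> [m = n] (mod p)"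
proof (induction m n rule: linorder_wlog)
  case (le m n)
  have "\<zeta> ^ n = \<zeta> ^ m * \<zeta> ^ (n - m)" using le by (simp flip: power_add)
  hence "\<zeta> ^ m = \<zeta> ^ n \<longleftrightarrow> \<zeta> ^ (n - m) = 1" by simp
  also have "\<dots> \<longleftrightarrow> [m = n] (mod p)"
    using cong_altdef_nat[OF le, of p] by (auto simp: zeta_pow_eq_1_iff cong_sym_eq)
  finally show ?case .
qed (auto simp: cong_sym_eq)

lemma cnj_zeta: "cnj \<zeta> = \<zeta> ^ (p - 1)"
proof -
  have "norm \<zeta> ^ p = 1" by (metis norm_power norm_one zeta_p)
  hence "norm \<zeta> = 1" using p power_eq_imp_eq_base[of "norm \<zeta>" p 1] by simp
  hence "\<zeta> * cnj \<zeta> = 1" using complex_norm_square[of \<zeta>] by simp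
  moreover have "\<zeta> * \<zeta> ^ (p - 1) = 1" using p by (simp flip: power_Suc)
  ultimately show ?thesis by (metis mult_left_cancel zeta_nz)
qed

lemma sum_zeta: "(\<Sum>j<p. \<zeta> ^ (j * n)) = (if p dvd n then of_nat p else 0)"
proof (cases "p dvd n")
  case True
  hence "\<zeta> ^ (j * n) = 1" for j by (simp add: zeta_pow_eq_1_iff)
  thus ?thesis using True by simp
next
  case False
  hence ne: "\<zeta> ^ n \<noteq> 1" by (simp add: zeta_pow_eq_1_iff)
  have "(\<zeta> ^ n - 1) * (\<Sum>j<p. (\<zeta> ^ n) ^ j) = (\<zeta> ^ n) ^ p - 1"
    by (simp add: power_diff_1_eq)
  also have "(\<zeta> ^ n) ^ p = 1" by (simp flip: power_mult add: zeta_pow_eq_1_iff)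
  finally show ?thesis using ne False by (simp add: mult.commute flip: power_mult)
qed

section \<open>The p-th cyclotomic polynomial and its irreducibility\<close>

definition Cyc :: "int poly" where "Cyc = (\<Sum>i<p. monom 1 i)"

lemma coeff_Cyc: "coeff Cyc n = (if n < p then 1 else 0)"
  by (simp add: Cyc_def coeff_sum)

lemma degree_Cyc: "degree Cyc = p - 1"
  using p by (intro antisym degree_le le_degree) (auto simp: coeff_Cyc)

lemma lead_coeff_Cyc: "lead_coeff Cyc = 1"
  using p by (simp add: degree_Cyc coeff_Cyc)

lemma ev_Cyc: "\<not> p dvd k \<Longrightarrow> ev Cyc (\<zeta> ^ k) = 0"
  using sum_zeta[of k] by (simp add: Cyc_def mult.commute flip: power_mult)

lemma ev_Cyc_1: "ev Cyc \<zeta> = 0"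
  using ev_Cyc[of 1] p by simp

text \<open>Both sides are monic of degree p in z and agree at the p distinct powers of
  zeta.\<close>

lemma prod_zeta_all: "(\<Prod>k<p. z - \<zeta> ^ k) = z ^ p - 1"
proof -
  have inj: "inj_on (\<lambda>k. \<zeta> ^ k) {..<p}"
    by (auto simp: inj_on_def zeta_pow_eq_iff cong_def)
  have d1: "degree (\<Prod>k<p. [:- (\<zeta> ^ k), 1:]) = p" by (subst degree_prod_eq_sum_degree) auto
  have "degree (monom 1 p - 1 :: complex poly) = p" 
    using p by (intro antisym degree_le le_degree) (auto simp: coeff_eq_0)
  moreover have "coeff (monom 1 p - 1 :: complex poly) p = 1" using p by simp
  moreover have "lead_coeff (\<Prod>k<p. [:- (\<zeta> ^ k), 1:]) = 1" by (simp add: lead_coeff_prod)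
  moreover have "(\<Prod>i<p. \<zeta> ^ k - \<zeta> ^ i) = 0" if "k < p" for k
    using that by (auto simp: prod_zero_iff)
  moreover have "(\<zeta> ^ k) ^ p = 1" for k by (simp add: zeta_pow_eq_1_iff flip: power_mult)
  ultimately have "(\<Prod>k<p. [:- (\<zeta> ^ k), 1:]) = monom 1 p - 1"
    using d1
    by (intro poly_eqI_degree_lead_coeff[where A = "(\<lambda>k. \<zeta> ^ k) ` {..<p}" and n = p])
       (auto simp: card_image inj poly_prod poly_monom )
  hence "poly (\<Prod>k<p. [:- (\<zeta> ^ k), 1:]) z = poly (monom 1 p - 1) z" by simp
  thus ?thesis by (simp add: poly_prod poly_monom)
qed

text \<open>Cancelling X - 1 in the factorization of X^p - 1 leaves 1 + X + ... + X^(p-1), whose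
  value at 1 is p.\<close>

lemma prod_one_minus_zeta: "(\<Prod>k\<in>{1..<p}. 1 - \<zeta> ^ k) = of_nat p"
proof -
  have s: "{..<p} = insert 0 {1..<p}" using p by auto
  have "(z - 1) * poly (\<Prod>k\<in>{1..<p}. [:- (\<zeta> ^ k), 1:]) z = (z - 1) * poly (\<Sum>k<p. monom 1 k) z" for z
    using prod_zeta_all[of z] power_diff_1_eq[of z p] by (simp add: s poly_prod poly_sum poly_monom)
  hence "[:-1,1:] * (\<Prod>k\<in>{1..<p}. [:- (\<zeta> ^ k), 1:]) = [:-1,1:] * (\<Sum>k<p. monom 1 k)"
    by (intro poly_ext) (simp add: algebra_simps)
  hence "(\<Prod>k\<in>{1..<p}. [:- (\<zeta> ^ k), 1:]) = (\<Sum>k<p. monom 1 k)"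
    by (subst (asm) mult_cancel_left) simp
  hence "poly (\<Prod>k\<in>{1..<p}. [:- (\<zeta> ^ k), 1:]) 1 = poly (\<Sum>k<p. monom 1 k) 1" by simp
  thus ?thesis by (simp add: poly_prod poly_sum poly_monom)
qed

text \<open>The product of the polynomials f(X^k) vanishes at every nontrivial p-th root of unity, so
  its value at 1 is its trace over all p-th roots of unity, which is divisible by p.\<close>

lemma relation_dvd_at_1:
  assumes f: "ev f \<zeta> = 0"
  shows "int p dvd poly f 1"
proof -
  define H where "H = (\<Prod>k\<in>{1..<p}. pcompose f (monom 1 k))"
  have H0: "ev H (\<zeta> ^ j) = 0" if j: "j \<in> {1..<p}" for j
  proof -
    have "\<not> p dvd j" using j by (rule not_dvd_of_range)
    \<comment> \<open>For k inverse to j modulo p, the k-th factor of H takes the value f(zeta) = 0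
      at zeta^j.\<close>
    hence "1 \<in> (\<lambda>k. (j * k) mod p) ` {1..<p}"
      using bij_betw_mult_mod[OF p(1)] p by (auto simp: bij_betw_def)
    then obtain k where k: "k \<in> {1..<p}" "(j * k) mod p = 1" by auto
    have "\<zeta> ^ (j * k) = \<zeta>" using zeta_mod[of "j * k"] k by simp
    hence "ev (pcompose f (monom 1 k)) (\<zeta> ^ j) = 0" using f by (simp flip: power_mult)
    thus ?thesis using k by (auto simp: H_def)
  qed
  have H1: "ev H 1 = of_int (poly f 1 ^ (p - 1))"
  proof -
    have "ev f 1 = of_int (poly f 1)" by (induction f) auto
    thus ?thesis by (simp add: H_def)
  qed
  have s: "{..<p} = insert 0 {1..<p}" using p by auto
  have "of_int (poly f 1 ^ (p - 1)) = (\<Sum>j<p. ev H (\<zeta> ^ j))"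
    unfolding s using H0 H1 by simp
  also have "\<dots> = (\<Sum>i\<le>degree H. of_int (coeff H i) * (\<Sum>j<p. \<zeta> ^ (j * i)))"
    unfolding ev_altdef sum_distrib_left by (subst sum.swap) (simp flip: power_mult)
  also have "\<dots> = (\<Sum>i\<le>degree H. of_int (if p dvd i then int p * coeff H i else 0))"
    by (intro sum.cong) (auto simp: sum_zeta)
  finally have "poly f 1 ^ (p - 1) = (\<Sum>i\<le>degree H. if p dvd i then int p * coeff H i else 0)"
    unfolding of_int_sum[symmetric] of_int_eq_iff .
  also have "int p dvd \<dots>" by (intro dvd_sum) auto
  finally show ?thesis using p prime_dvd_power[of "int p"] by simp
qed

text \<open>p is the product of the p - 1 numbers 1 - zeta^k, each of which is a multiple of zeta -
  1.\<close>

lemma p_eq_lambda_power: "\<exists>f. of_nat p = (\<zeta> - 1) ^ (p - 1) * ev f \<zeta>"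
proof -
  have e: "1 - \<zeta> ^ k = (\<zeta> - 1) * ev (- (\<Sum>i<k. monom 1 i)) \<zeta>" for k
    using power_diff_1_eq[of \<zeta> k] by (simp add: algebra_simps)
  have "(\<Prod>k\<in>{1..<p}. 1 - \<zeta> ^ k) = (\<Prod>k\<in>{1..<p}. (\<zeta> - 1) * ev (- (\<Sum>i<k. monom 1 i)) \<zeta>)"
    by (simp only: e)
  also have "\<dots> = (\<zeta> - 1) ^ (p - 1) * ev (\<Prod>k\<in>{1..<p}. - (\<Sum>i<k. monom 1 i)) \<zeta>"
    unfolding ev_prod prod.distrib by simp
  finally show ?thesis unfolding prod_one_minus_zeta by blast
qed

text \<open>Eisenstein's argument at the prime above p: in a shortest relation between the powers of
  the uniformizer, the lowest coefficient prime to p would be a multiple of the uniformizer.\<close>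

lemma lambda_relation_dvd:
  assumes g: "ev g (\<zeta> - 1) = 0" and d: "degree g < p - 1"
  shows "int p dvd coeff g i"
proof (rule ccontr)
  assume "\<not> int p dvd coeff g i"
  define n where "n = (LEAST i. \<not> int p dvd coeff g i)"
  have n: "\<not> int p dvd coeff g n" unfolding n_def by (rule LeastI) fact
  have less: "int p dvd coeff g i" if "i < n" for i using that not_less_Least n_def by blast
  have "n \<le> degree g" using n by (metis dvd_0_right le_degree)
  hence n': "n < p - 1" using d by simp
  obtain w where w: "of_nat p = (\<zeta> - 1) ^ (p - 1) * ev w \<zeta>" using p_eq_lambda_power by blast
  define u where "u = (\<Sum>i<n. monom (coeff g i div int p) i)"
  define v where "v = (\<Sum>i\<in>{Suc n..degree g}. monom (coeff g i) (i - Suc n))"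
  have "0 = (\<Sum>i\<le>degree g. of_int (coeff g i) * (\<zeta> - 1) ^ i)" using g by (simp add: ev_altdef)
  also have "{..degree g} = {..<n} \<union> ({n} \<union> {Suc n..degree g})" using \<open>n \<le> degree g\<close> by auto
  also have "(\<Sum>i\<in>\<dots>. of_int (coeff g i) * (\<zeta> - 1) ^ i) = (\<Sum>i<n. of_int (coeff g i) * (\<zeta> - 1) ^ i) + 
    (of_int (coeff g n) * (\<zeta> - 1) ^ n + (\<Sum>i\<in>{Suc n..degree g}. of_int (coeff g i) * (\<zeta> - 1) ^ i))"
    by (subst sum.union_disjoint, simp, simp, force, subst sum.union_disjoint) auto
  also have "(\<Sum>i<n. of_int (coeff g i) * (\<zeta> - 1) ^ i) = of_nat p * ev u (\<zeta> - 1)"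
    unfolding u_def ev_sum ev_monom sum_distrib_left
  proof (intro sum.cong refl)
    fix i assume "i \<in> {..<n}"
    hence "coeff g i = int p * (coeff g i div int p)" using less by simp
    hence "of_int (coeff g i) = of_nat p * (of_int (coeff g i div int p) :: complex)"
      by (metis of_int_mult of_int_of_nat_eq)
    thus "of_int (coeff g i) * (\<zeta> - 1) ^ i = of_nat p * (of_int (coeff g i div int p) * (\<zeta> - 1) ^ i)" by simp
  qed
  also have "(\<Sum>i\<in>{Suc n..degree g}. of_int (coeff g i) * (\<zeta> - 1) ^ i) = (\<zeta> - 1) ^ Suc n * ev v (\<zeta> - 1)"
    unfolding v_def ev_sum ev_monom sum_distrib_left
  proof (intro sum.cong refl)
    fix i assume "i \<in> {Suc n..degree g}"
    hence "(\<zeta> - 1) ^ i = (\<zeta> - 1) ^ Suc n * (\<zeta> - 1) ^ (i - Suc n)" by (simp flip: power_add power_Suc)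
    thus "of_int (coeff g i) * (\<zeta> - 1) ^ i = (\<zeta> - 1) ^ Suc n * (of_int (coeff g i) * (\<zeta> - 1) ^ (i - Suc n))" 
      by (simp only: mult_ac)
  qed
  \<comment> \<open>Because n < p - 1, the number p contains at least one factor zeta - 1 beyond
    (zeta - 1)^n.\<close>
  also have "of_nat p * ev u (\<zeta> - 1) = (\<zeta> - 1) ^ n * ((\<zeta> - 1) * ((\<zeta> - 1) ^ (p - 2 - n) * ev w \<zeta> * ev u (\<zeta> - 1)))"
  proof -
    have "p - 1 = n + Suc (p - 2 - n)" using n' by simp
    hence "(\<zeta> - 1) ^ (p - 1) = (\<zeta> - 1) ^ n * ((\<zeta> - 1) * (\<zeta> - 1) ^ (p - 2 - n))"
      by (simp only: power_add power_Suc)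
    thus ?thesis by (simp add: w mult_ac)
  qed
  finally have "(\<zeta> - 1) ^ n * (of_int (coeff g n) + (\<zeta> - 1) * ((\<zeta> - 1) ^ (p - 2 - n) * ev w \<zeta> * ev u (\<zeta> - 1) + ev v (\<zeta> - 1))) = 0"
    by (simp add: algebra_simps)
  moreover have "\<zeta> \<noteq> 1" using zeta_pow_eq_1_iff[of 1] p by auto
  ultimately have "of_int (coeff g n) + (\<zeta> - 1) * ev ([:-1,1:] ^ (p - 2 - n) * w * pcompose u [:-1,1:] + pcompose v [:-1,1:]) \<zeta> = 0"
    by simp
  then obtain f where f: "of_int (coeff g n) + (\<zeta> - 1) * ev f \<zeta> = 0" by blast
  from f have "ev ([:coeff g n:] + [:-1,1:] * f) \<zeta> = 0" by (simp add: algebra_simps)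
  \<comment> \<open>At 1 the multiple of X - 1 drops out and the polynomial takes the value
    \<open>coeff g n\<close>.\<close>
  from relation_dvd_at_1[OF this] n show False by simp
qed

text \<open>Infinite descent: a relation of this degree is divisible by p and its quotient by p is
  again such a relation, so every coefficient is divisible by all powers of p.\<close>

lemma lambda_relation_0:
  assumes "ev g (\<zeta> - 1) = 0" "degree g < p - 1"
  shows "g = 0"
proof -
  have "int p ^ n dvd coeff g i" if "ev g (\<zeta> - 1) = 0" "degree g < p - 1" for n i g
    using that
  proof (induction n arbitrary: g)
    case (Suc n)
    have "[:int p:] dvd g" 
      using lambda_relation_dvd[OF Suc.prems] by (simp add: const_poly_dvd_iff)
    then obtain g' where g': "g = smult (int p) g'" by (auto elim!: dvdE)
    have "ev g' (\<zeta> - 1) = 0" "degree g' < p - 1" using Suc.prems g' p by auto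
    from Suc.IH[OF this] show ?case by (simp add: g' mult_dvd_mono)
  qed simp
  hence d: "int p ^ n dvd coeff g i" for n i using assms by blast
  have "coeff g i = 0" for i
  proof (rule ccontr)
    assume "coeff g i \<noteq> 0"
    hence "int p ^ n \<le> \<bar>coeff g i\<bar>" for n using dvd_imp_le_int[OF _ d[of n i]] by simp
    moreover have "int n < int p ^ n" for n
    proof -
      have "n < p ^ n" using less_exp[of n] power_mono[of 2 p n] p by linarith
      thus ?thesis by (simp flip: of_nat_power)
    qed
    ultimately show False by (metis abs_ge_zero int_nat_eq linorder_not_less)
  qed
  thus ?thesis by (simp add: poly_eq_iff)
qed

text \<open>This expresses the irreducibility of the cyclotomic polynomial. The remainder of f
  modulo \<open>Cyc\<close> has degree below p - 1, and the substitution of X + 1 for X makes it a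
  relation between powers of zeta - 1, which must be trivial.\<close>

theorem Cyc_dvd_iff: "ev f \<zeta> = 0 \<longleftrightarrow> Cyc dvd f"
proof
  assume f: "ev f \<zeta> = 0"
  have "degree Cyc > 0" using p by (simp add: degree_Cyc)
  from monic_division[OF lead_coeff_Cyc this] obtain q r where
    qr: "f = Cyc * q + r" "degree r < p - 1" unfolding degree_Cyc by blast
  have "ev r \<zeta> = 0" using f qr ev_Cyc_1 by simp
  hence "ev (pcompose r [:1,1:]) (\<zeta> - 1) = 0" by simp
  moreover have "degree (pcompose r [:1,1:]) < p - 1" using qr by (simp add: degree_pcompose)
  ultimately have "pcompose r [:1,1:] = 0" by (rule lambda_relation_0)
  hence "r = 0" by (simp add: pcompose_eq_0_iff)
  thus "Cyc dvd f" using qr by simp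
qed (auto simp: ev_Cyc_1)

text \<open>Relations at zeta are multiples of \<open>Cyc\<close>, which vanishes at zeta^k as well;
  this makes the conjugation zeta -> zeta^k well defined.\<close>

lemma ev_conj_0: "ev f \<zeta> = 0 \<Longrightarrow> \<not> p dvd k \<Longrightarrow> ev f (\<zeta> ^ k) = 0"
  by (auto simp: Cyc_dvd_iff ev_Cyc)

lemma ev_conj_eq: "ev f \<zeta> = ev g \<zeta> \<Longrightarrow> \<not> p dvd k \<Longrightarrow> ev f (\<zeta> ^ k) = ev g (\<zeta> ^ k)"
  using ev_conj_0[of "f - g" k] by simp


section \<open>Divisibility by a rational integer in Z[zeta]\<close>

definition dvdZ :: "int \<Rightarrow> complex \<Rightarrow> bool" where
  "dvdZ M z \<longleftrightarrow> (\<exists>g. z = of_int M * ev g \<zeta>)"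

lemma dvdZ_add: "dvdZ M x \<Longrightarrow> dvdZ M y \<Longrightarrow> dvdZ M (x + y)"
  unfolding dvdZ_def by (metis ev_add distrib_left)

lemma dvdZ_0: "dvdZ M 0"
  unfolding dvdZ_def by (metis ev_0 mult_zero_right)

lemma dvdZ_sum: "(\<And>i. i \<in> I \<Longrightarrow> dvdZ M (f i)) \<Longrightarrow> dvdZ M (\<Sum>i\<in>I. f i)"
  by (induction I rule: infinite_finite_induct) (auto simp: dvdZ_0 dvdZ_add)

lemma dvdZ_mult: "dvdZ M x \<Longrightarrow> dvdZ M (x * ev f \<zeta>)"
  unfolding dvdZ_def by (metis ev_mult mult.assoc)

lemma dvdZ_of_int_mult: 
  assumes "M dvd n" shows "dvdZ M (of_int n * ev f \<zeta>)"
proof -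
  obtain k where "n = M * k" using assms by auto
  hence "of_int n * ev f \<zeta> = of_int M * ev (smult k f) \<zeta>" by simp
  thus ?thesis unfolding dvdZ_def by blast
qed

text \<open>Fourier inversion modulo M: the element h plays the role of the p-th root of unity.\<close>

lemma dvdZ_of_evaluations:
  fixes h M :: int
  assumes h: "[h ^ p = 1] (mod M)" and unit: "\<And>n. \<not> p dvd n \<Longrightarrow> coprime (h ^ n - 1) M"
    and M: "coprime (int p) M"
    and F: "\<And>j. j \<in> {1..<p} \<Longrightarrow> M dvd poly F (h ^ j)"
  shows "dvdZ M (ev F \<zeta>)"
proof -
  \<comment> \<open>The trace of h^n over the powers of h: modulo M it is p if p divides n and 0
    otherwise.\<close>
  define S where "S n = (\<Sum>j<p. h ^ (j * n))" for n
  have hp: "[h ^ (p * k) = 1] (mod M)" for k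
    using cong_pow[OF h, of k] by (simp add: power_mult)
  have S1: "M dvd S n - int p" if "p dvd n" for n
  proof -
    have "[S n = (\<Sum>j<p. 1)] (mod M)"
      unfolding S_def
    proof (rule cong_sum)
      fix j from that obtain k where "n = p * k" by auto
      thus "[h ^ (j * n) = 1] (mod M)" using hp[of "j * k"] by (simp add: mult_ac)
    qed
    thus ?thesis by (simp add: cong_iff_dvd_diff)
  qed
  have S0: "M dvd S n" if "\<not> p dvd n" for n
  proof -
    have "(h ^ n - 1) * S n = h ^ (p * n) - 1"
      using power_diff_1_eq[of "h ^ n" p] by (simp add: S_def mult.commute flip: power_mult)
    hence "M dvd (h ^ n - 1) * S n" using hp[of n] by (simp add: cong_iff_dvd_diff)
    thus ?thesis using unit[OF that] by (simp add: coprime_commute coprime_dvd_mult_right_iff)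
  qed
  have inner: "dvdZ M ((\<Sum>e<p. of_int (S (i + p - e)) * \<zeta> ^ e) - of_nat p * \<zeta> ^ i)" for i
  proof -
    have "of_nat p * \<zeta> ^ i = (\<Sum>e<p. of_int (if e = i mod p then int p else 0) * \<zeta> ^ e)"
      using p by (subst sum.mono_neutral_right[of "{..<p}" "{i mod p}"]) (auto simp: zeta_mod)
    hence "(\<Sum>e<p. of_int (S (i + p - e)) * \<zeta> ^ e) - of_nat p * \<zeta> ^ i = 
       (\<Sum>e<p. of_int (S (i + p - e) - (if e = i mod p then int p else 0)) * ev (monom 1 e) \<zeta>)"
      by (simp add: algebra_simps flip: sum_subtractf)
    also have "dvdZ M \<dots>"
    proof (intro dvdZ_sum dvdZ_of_int_mult)
      fix e assume e: "e \<in> {..<p}"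
      have "p dvd i + p - e \<longleftrightarrow> [e = i] (mod p)"
      proof -
        have "p dvd i + p - e \<longleftrightarrow> [i + p = e] (mod p)"
          using e by (subst cong_altdef_nat) auto
        thus ?thesis by (auto simp: cong_def)
      qed
      also have "\<dots> \<longleftrightarrow> e = i mod p" using e by (simp add: cong_def)
      finally show "M dvd S (i + p - e) - (if e = i mod p then int p else 0)"
        using S0 S1 by auto
    qed
    finally show ?thesis .
  qed
  \<comment> \<open>Inverse Fourier transform of the values F(h^j); it equals p F(zeta) modulo M.
    The exponent p - e replaces -e so as to stay in the natural numbers.\<close>
  define T where "T = (\<Sum>j<p. of_int (poly F (h ^ j)) * (\<Sum>e<p. of_int (h ^ (j * (p - e))) * \<zeta> ^ e))"
  have "dvdZ M T" unfolding T_def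
  proof (rule dvdZ_sum)
    fix j assume j: "j \<in> {..<p}"
    show "dvdZ M (of_int (poly F (h ^ j)) * (\<Sum>e<p. of_int (h ^ (j * (p - e))) * \<zeta> ^ e))"
    proof (cases "j = 0")
      case True
      \<comment> \<open>Nothing is assumed about F(1), but its contribution is a multiple of 1 +
        zeta + ... + zeta^(p-1) = 0.\<close>
      have "(\<Sum>e<p. \<zeta> ^ e) = 0" using sum_zeta[of 1] p by auto
      thus ?thesis using True dvdZ_0 by simp
    next
      case False
      hence "dvdZ M (of_int (poly F (h ^ j)) * ev (\<Sum>e<p. monom (h ^ (j * (p - e))) e) \<zeta>)"
        using j by (intro dvdZ_of_int_mult F) auto
      thus ?thesis by simp
    qed
  qed
  have T: "T = (\<Sum>i\<le>degree F. of_int (coeff F i) * (\<Sum>e<p. of_int (S (i + p - e)) * \<zeta> ^ e))"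
  proof -
    have "T = (\<Sum>j<p. \<Sum>i\<le>degree F. \<Sum>e<p. of_int (coeff F i) * of_int (h ^ (j * (i + p - e))) * \<zeta> ^ e)"
      unfolding T_def poly_altdef of_int_sum sum_distrib_left sum_distrib_right
    proof (subst sum.swap, intro sum.cong refl)
      fix j e i assume "e \<in> {..<p}"
      hence "j * (i + p - e) = j * i + j * (p - e)" by (simp flip: distrib_left)
      hence "h ^ (j * (i + p - e)) = (h ^ j) ^ i * h ^ (j * (p - e))" by (simp only: power_add power_mult)
      thus "of_int (coeff F i * (h ^ j) ^ i) * (of_int (h ^ (j * (p - e))) * \<zeta> ^ e) = of_int (coeff F i) * of_int (h ^ (j * (i + p - e))) * \<zeta> ^ e"
        by (simp only: of_int_mult mult_ac)
    qed
    also have "\<dots> = (\<Sum>i\<le>degree F. \<Sum>j<p. \<Sum>e<p. of_int (coeff F i) * of_int (h ^ (j * (i + p - e))) * \<zeta> ^ e)"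
      by (rule sum.swap)
    also have "\<dots> = (\<Sum>i\<le>degree F. \<Sum>e<p. \<Sum>j<p. of_int (coeff F i) * of_int (h ^ (j * (i + p - e))) * \<zeta> ^ e)"
      by (intro sum.cong refl sum.swap)
    finally show ?thesis by (simp only: S_def of_int_sum sum_distrib_left sum_distrib_right mult.assoc)
  qed
  have "dvdZ M (\<Sum>i\<le>degree F. ((\<Sum>e<p. of_int (S (i + p - e)) * \<zeta> ^ e) - of_nat p * \<zeta> ^ i) * ev (of_int (coeff F i)) \<zeta>)"
    by (intro dvdZ_sum dvdZ_mult inner)
  also have "(\<Sum>i\<le>degree F. ((\<Sum>e<p. of_int (S (i + p - e)) * \<zeta> ^ e) - of_nat p * \<zeta> ^ i) * ev (of_int (coeff F i)) \<zeta>) = T - of_nat p * ev F \<zeta>"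
    unfolding T ev_altdef[of F] sum_distrib_left[of "of_nat p"] sum_subtractf[symmetric]
    by (intro sum.cong refl) (simp only: ev_of_int left_diff_distrib right_diff_distrib mult_ac)
  finally have d: "dvdZ M (T - of_nat p * ev F \<zeta>)" .
  have "dvdZ M (T + (T - of_nat p * ev F \<zeta>) * ev (-1) \<zeta>)"
    by (intro dvdZ_add dvdZ_mult d) fact
  hence "dvdZ M (of_nat p * ev F \<zeta>)" by simp
  then obtain g where g: "of_nat p * ev F \<zeta> = of_int M * ev g \<zeta>" by (auto simp: dvdZ_def)
  obtain a b where "a * int p + b * M = 1" using M by (metis coprime_iff_gcd_eq_1 bezout_int)
  hence "of_int a * of_nat p + of_int b * of_int M = (1::complex)"
    by (metis of_int_1 of_int_add of_int_mult of_int_of_nat_eq)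
  hence "ev F \<zeta> = of_int a * (of_nat p * ev F \<zeta>) + of_int M * (of_int b * ev F \<zeta>)"
    by (metis (no_types, opaque_lifting) mult.assoc mult.commute distrib_right mult_1)
  also have "\<dots> = of_int M * ev (smult a g + smult b F) \<zeta>" unfolding g by (simp add: algebra_simps)
  finally show ?thesis unfolding dvdZ_def by blast
qed

text \<open>An element of Z[zeta] all of whose conjugates have absolute value 1: the trace form turns
  this into p Q = p - 1 + S^2, where S and Q are the sum and the sum of squares of the coefficients
  and S can be normalised to |S| < p/2. This leaves only one nonzero coefficient.\<close>

lemma unit_circle_imp_root_of_unity:
  assumes g: "ev g \<zeta> * cnj (ev g \<zeta>) = 1"
  shows "\<exists>r<p. \<exists>u\<in>{1,-1::int}. ev g \<zeta> = of_int u * \<zeta> ^ r"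
proof -
  define G where "G = pcompose g (monom 1 (p - 1))"
  have "ev (g * G) \<zeta> = ev 1 \<zeta>" using g by (simp add: G_def cnj_ev cnj_zeta)
  hence conj: "ev g (\<zeta> ^ k) * ev g (\<zeta> ^ ((p - 1) * k)) = 1" if "\<not> p dvd k" for k
    using ev_conj_eq[of "g * G" 1 k] that by (simp add: G_def mult.commute flip: power_mult)
  define c where "c e = (\<Sum>i\<in>{i. i \<le> degree g \<and> i mod p = e}. coeff g i)" for e
  have evc: "ev g (\<zeta> ^ k) = (\<Sum>e<p. of_int (c e) * \<zeta> ^ (k * e))" for k
  proof -
    have "ev g (\<zeta> ^ k) = (\<Sum>i\<le>degree g. of_int (coeff g i) * \<zeta> ^ (k * i))"
      by (simp add: ev_altdef flip: power_mult)
    also have "\<dots> = (\<Sum>e<p. \<Sum>i\<in>{i\<in>{..degree g}. i mod p = e}. of_int (coeff g i) * \<zeta> ^ (k * i))"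
      using p by (intro sum.group[symmetric]) auto
    also have "\<dots> = (\<Sum>e<p. of_int (c e) * \<zeta> ^ (k * e))"
      unfolding c_def of_int_sum sum_distrib_right
    proof (intro sum.cong)
      fix e i assume "i \<in> {i. i \<le> degree g \<and> i mod p = e}"
      hence "[k * i = k * e] (mod p)" by (auto simp: cong_def mod_mult_right_eq)
      hence "\<zeta> ^ (k * i) = \<zeta> ^ (k * e)" by (simp add: zeta_pow_eq_iff)
      thus "of_int (coeff g i) * \<zeta> ^ (k * i) = of_int (coeff g i) * \<zeta> ^ (k * e)" by simp
    qed auto
    finally show ?thesis .
  qed
  \<comment> \<open>The powers of zeta sum to 0, so a constant may be subtracted from all
    coefficients. With d the quotient of their sum by p, rounded to the nearest integer, the new sum
    S satisfies |S| < p/2.\<close>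
  define d where "d = ((\<Sum>e<p. c e) + int p div 2) div int p"
  define b where "b e = c e - d" for e
  define S where "S = (\<Sum>e<p. b e)"
  define Q where "Q = (\<Sum>e<p. b e ^ 2)"
  have S: "\<bar>2 * S\<bar> < int p"
  proof -
    have "S = (\<Sum>e<p. c e) - int p * d" by (simp add: S_def b_def sum_subtractf)
    also have "\<dots> = ((\<Sum>e<p. c e) + int p div 2) mod int p - int p div 2"
      by (simp add: d_def minus_mult_div_eq_mod [symmetric])
    finally have e: "S = \<dots>" .
    have "odd (int p)" using p prime_odd_nat by simp
    moreover have "0 \<le> ((\<Sum>e<p. c e) + int p div 2) mod int p" "((\<Sum>e<p. c e) + int p div 2) mod int p < int p"
      using p by auto
    moreover have "\<bar>2 * (x - q div 2)\<bar> < q" if "odd q" "0 \<le> x" "x < q" for x q :: int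
      using that by (elim oddE) (simp add: abs_le_iff abs_less_iff)
    ultimately show ?thesis unfolding e by blast
  qed
  have evb: "ev g (\<zeta> ^ k) = (\<Sum>e<p. of_int (b e) * \<zeta> ^ (k * e))" if "\<not> p dvd k" for k
  proof -
    have "(\<Sum>e<p. \<zeta> ^ (k * e)) = 0" using sum_zeta[of k] that by (simp add: mult.commute)
    thus ?thesis unfolding evc b_def by (simp add: algebra_simps sum_subtractf flip: sum_distrib_left)
  qed
  define f where "f k = (\<Sum>e<p. of_int (b e) * \<zeta> ^ (k * e))" for k
  \<comment> \<open>The product of values at zeta^k and zeta^(-k), the latter written with (p - 1)
    k, is summed over all k modulo p. The term k = 0 is S^2 and each other term is 1, while
    orthogonality evaluates the sum as p Q.\<close>
  have Qeq: "int p * Q = int p - 1 + S\<^sup>2"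
  proof -
    have s: "{..<p} = insert 0 {1..<p}" using p by auto
    have "(\<Sum>k<p. f k * f ((p - 1) * k)) = of_int S * of_int S + (\<Sum>k\<in>{1..<p}. f k * f ((p - 1) * k))"
      unfolding s by (simp add: f_def S_def s)
    also have "(\<Sum>k\<in>{1..<p}. f k * f ((p - 1) * k)) = (\<Sum>k\<in>{1..<p}. 1)"
    proof (intro sum.cong refl)
      fix k assume k: "k \<in> {1..<p}"
      have "\<not> p dvd k" "\<not> p dvd p - 1" using k p by (auto dest!: dvd_imp_le)
      moreover from this have "\<not> p dvd (p - 1) * k" using p prime_dvd_mult_iff by blast
      ultimately show "f k * f ((p - 1) * k) = 1" using conj[of k] evb by (simp add: f_def)
    qed
    also have "\<dots> = of_int (int p - 1)" using p by (simp add: of_nat_diff)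
    finally have 1: "(\<Sum>k<p. f k * f ((p - 1) * k)) = of_int (int p - 1 + S\<^sup>2)" by (simp add: power2_eq_square)
    have "(\<Sum>k<p. f k * f ((p - 1) * k)) = (\<Sum>k<p. \<Sum>e<p. \<Sum>e'<p. of_int (b e) * of_int (b e') * \<zeta> ^ (k * (e + (p - 1) * e')))"
      unfolding f_def sum_product by (intro sum.cong refl) (simp only: power_add distrib_left mult_ac)
    also have "\<dots> = (\<Sum>e<p. \<Sum>e'<p. \<Sum>k<p. of_int (b e) * of_int (b e') * \<zeta> ^ (k * (e + (p - 1) * e')))"
      by (rule trans[OF sum.swap], rule sum.cong[OF refl], rule sum.swap)
    also have "\<dots> = (\<Sum>e<p. \<Sum>e'<p. if e' = e then of_nat p * of_int (b e ^ 2) else 0)"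
    proof (intro sum.cong refl)
      fix e e' assume e: "e \<in> {..<p}" "e' \<in> {..<p}"
      have "p dvd e + (p - 1) * e' \<longleftrightarrow> int p dvd int (e + (p - 1) * e')" by (rule int_dvd_int_iff [symmetric])
      also have "int (e + (p - 1) * e') = int p * int e' + (int e - int e')" 
      proof -
        have "int ((p - 1) * e') = (int p - 1) * int e'" using p by (simp add: of_nat_diff)
        thus ?thesis by (simp only: of_nat_add) (simp add: algebra_simps)
      qed
      also have "int p dvd \<dots> \<longleftrightarrow> [int e = int e'] (mod int p)" by (simp add: cong_iff_dvd_diff dvd_add_right_iff)
      also have "\<dots> \<longleftrightarrow> e' = e" using e by (auto simp: cong_int_iff cong_def)
      finally show "(\<Sum>k<p. of_int (b e) * of_int (b e') * \<zeta> ^ (k * (e + (p - 1) * e'))) = 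
          (if e' = e then of_nat p * of_int (b e ^ 2) else 0)"
        by (simp add: sum_zeta power2_eq_square flip: sum_distrib_left)
    qed
    also have "\<dots> = of_int (int p * Q)" by (simp add: Q_def sum_distrib_left)
    finally show ?thesis using 1 by (simp only: of_int_eq_iff)
  qed
  have SQ: "\<bar>S\<bar> \<le> Q"
  proof -
    have "\<bar>S\<bar> \<le> (\<Sum>e<p. \<bar>b e\<bar>)" unfolding S_def by (rule sum_abs)
    also have "\<dots> \<le> Q" unfolding Q_def
    proof (rule sum_mono)
      fix e show "\<bar>b e\<bar> \<le> b e ^ 2" 
        using self_le_power[of "\<bar>b e\<bar>" 2] by (cases "b e = 0") auto
    qed
    finally show ?thesis .
  qed
  have "Q = 1"
  proof -
    define s where "s = \<bar>S\<bar>"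
    have s: "int p * Q = int p - 1 + s * s" "0 \<le> s" "2 * s < int p" "s \<le> Q"
      using Qeq S SQ by (auto simp: s_def power2_eq_square abs_mult)
    \<comment> \<open>This is |S| \<le> Q inserted into the trace identity. Since s < p/2 makes the
      second factor positive, s can only be 0 or 1.\<close>
    have "(s - 1) * (int p - 1 - s) \<le> 0"
    proof -
      have "int p * s \<le> int p - 1 + s * s" using mult_left_mono[OF s(4), of "int p"] s(1) by simp
      thus ?thesis by (simp add: algebra_simps)
    qed
    moreover have "int p - 1 - s > 0" using s p by simp
    ultimately have "s \<le> 1" by (simp add: mult_le_0_iff)
    hence "s = 0 \<or> s = 1" using s(2) by auto
    moreover have "s \<noteq> 0"
    proof
      assume "s = 0"
      hence "int p * (1 - Q) = 1" using s(1) by (simp add: algebra_simps)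
      hence "int p dvd 1" by (metis dvd_triv_left)
      thus False using p by simp
    qed
    ultimately show ?thesis using s(1) p by auto
  qed
  have "\<exists>e<p. b e \<noteq> 0"
    using \<open>Q = 1\<close> unfolding Q_def by (metis (no_types, lifting) lessThan_iff sum.neutral zero_neq_one zero_power2)
  then obtain r where r: "r < p" "b r \<noteq> 0" by blast
  have split: "Q = b r ^ 2 + (\<Sum>e\<in>{..<p} - {r}. b e ^ 2)"
    unfolding Q_def using r by (subst sum.remove[of _ r]) auto
  have "b r ^ 2 \<ge> 1" using r(2) by (simp add: int_one_le_iff_zero_less)
  moreover have nn: "(\<Sum>e\<in>{..<p} - {r}. b e ^ 2) \<ge> 0" by (intro sum_nonneg) auto
  ultimately have br: "b r ^ 2 = 1" and z: "(\<Sum>e\<in>{..<p} - {r}. b e ^ 2) = 0"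
    using split \<open>Q = 1\<close> by linarith+
  from z have "b e = 0" if "e \<in> {..<p} - {r}" for e
    using that by (subst (asm) sum_nonneg_eq_0_iff) auto
  hence "(\<Sum>e<p. of_int (b e) * \<zeta> ^ (1 * e)) = of_int (b r) * \<zeta> ^ r"
    using r by (subst sum.remove[of _ r]) auto
  hence "ev g \<zeta> = of_int (b r) * \<zeta> ^ r" using evb[of 1] p by simp
  moreover have "b r \<in> {1,-1}" using br by (simp add: power2_eq_1_iff)
  ultimately show ?thesis using r(1) by blast
qed


section \<open>Jacobi sums\<close>

lemma cnj_zeta_power: "\<zeta> ^ n * cnj (\<zeta> ^ n) = 1"
proof -
  have "\<zeta> * cnj \<zeta> = 1" unfolding cnj_zeta using p by (simp flip: power_Suc)
  thus ?thesis by (simp flip: power_mult_distrib)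
qed

text \<open>Let h be a nontrivial p-th root of unity modulo a prime q. The p-th power residue character
  of q sends u to the power of zeta corresponding to u^((q-1)/p) modulo q; the Jacobi sum has
  absolute value sqrt q, and it vanishes modulo the primes above q prescribed by Stickelberger's
  theorem, since there it becomes a sum over Z/q of a polynomial of degree less than q - 1.\<close>

lemma jacobi_sum:
  fixes q :: nat and h :: int
  assumes q: "prime q" and h: "[h ^ p = 1] (mod int q)" "\<not> [h = 1] (mod int q)"
    and s: "s \<in> {1..p-2}"
  shows "\<exists>G. ev G \<zeta> * cnj (ev G \<zeta>) = of_nat q \<and>
           (\<forall>j\<in>{1..<p} - carry p s. int q dvd poly G (h ^ j))"
proof -
  have q1: "q > 1" using q prime_gt_1_nat by blast
  have ndh: "\<not> int q dvd h"
  proof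
    assume "int q dvd h"
    hence "[h ^ p = 0] (mod int q)" using p by (simp add: cong_0_iff dvd_power_iff dvd_trans[OF _ dvd_power])
    hence "[1 = 0] (mod int q)" using h(1) cong_sym cong_trans by blast
    thus False using q1 by (simp add: cong_0_iff)
  qed
  \<comment> \<open>That is, h has order exactly p modulo q.\<close>
  have hpow: "[h ^ m = h ^ n] (mod int q) \<longleftrightarrow> [m = n] (mod p)" for m n
  proof (induction m n rule: linorder_wlog)
    case (le m n)
    have cop: "coprime (h ^ k) (int q)" for k
      using ndh q prime_imp_coprime[of "int q" h] by (simp add: coprime_commute)
    have "h ^ n = h ^ m * h ^ (n - m)" using le by (simp flip: power_add)
    hence "[h ^ m = h ^ n] (mod int q) \<longleftrightarrow> [h ^ m * 1 = h ^ m * h ^ (n - m)] (mod int q)" by simp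
    also have "\<dots> \<longleftrightarrow> [h ^ (n - m) = 1] (mod int q)"
      by (subst cong_mult_lcancel[OF cop]) (rule cong_sym_eq)
    also have "\<dots> \<longleftrightarrow> p dvd n - m"
    proof
      assume a: "[h ^ (n - m) = 1] (mod int q)"
      show "p dvd n - m"
      proof (rule ccontr)
        assume "\<not> p dvd n - m"
        hence "coprime (n - m) p" using p prime_imp_coprime[of p "n - m"] by (simp add: coprime_commute)
        hence "[h = 1] (mod int q)" by (rule cong_1_of_coprime_powers[OF _ a h(1)])
        thus False using h(2) by blast
      qed
    next
      assume "p dvd n - m"
      then obtain k where "n - m = p * k" by auto
      thus "[h ^ (n - m) = 1] (mod int q)" using cong_pow[OF h(1), of k] by (simp add: power_mult)
    qed
    also have "\<dots> \<longleftrightarrow> [m = n] (mod p)"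
      using cong_altdef_nat[OF le, of p] by (auto simp: cong_sym_eq)
    finally show ?case .
  qed (auto simp: cong_sym_eq)
  define H where "H = nat (h mod int q)"
  have H: "int H = h mod int q" using q1 by (simp add: H_def)
  have Hc: "[int H ^ k = h ^ k] (mod int q)" for k by (rule cong_pow) (simp add: H cong_def)
  have pq: "p dvd q - 1"
    using fermat_int[OF q ndh] hpow[of "q - 1" 0] by (simp add: cong_0_iff)
  define f where "f = (q - 1) div p"
  have fp: "f * p = q - 1" using pq by (simp add: f_def)
  have f0: "f > 0" using fp q1 by (cases f) auto
  \<comment> \<open>The powers of h are p distinct roots of X^p = 1 modulo q, and there cannot be
    more than p of them.\<close>
  have roots: "{x \<in> {1..<q}. [x ^ p = 1] (mod q)} = (\<lambda>i. H ^ i mod q) ` {..<p}"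
  proof (rule card_subset_eq[symmetric])
    have inj: "inj_on (\<lambda>i. H ^ i mod q) {..<p}"
    proof (rule inj_onI)
      fix i j assume ij: "i \<in> {..<p}" "j \<in> {..<p}" "H ^ i mod q = H ^ j mod q"
      hence "[int H ^ i = int H ^ j] (mod int q)" 
        by (metis cong_def cong_int_iff of_nat_power)
      hence "[h ^ i = h ^ j] (mod int q)" using Hc cong_sym cong_trans by blast
      thus "i = j" using ij hpow by (simp add: cong_def)
    qed
    show sub: "(\<lambda>i. H ^ i mod q) ` {..<p} \<subseteq> {x \<in> {1..<q}. [x ^ p = 1] (mod q)}"
    proof (intro image_subsetI CollectI conjI)
      fix i
      have "[(int H ^ i) ^ p = (h ^ i) ^ p] (mod int q)" by (intro cong_pow Hc)
      also have "(h ^ i) ^ p = (h ^ p) ^ i" by (simp add: mult.commute flip: power_mult)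
      also have "[(h ^ p) ^ i = 1 ^ i] (mod int q)" by (intro cong_pow h)
      finally have "[(H ^ i) ^ p = 1] (mod q)" by (metis cong_int_iff of_nat_1 of_nat_power power_one)
      thus 1: "[(H ^ i mod q) ^ p = 1] (mod q)" by (simp add: cong_def power_mod)
      have "H ^ i mod q \<noteq> 0"
      proof
        assume "H ^ i mod q = 0"
        with 1 p q1 show False by (simp add: cong_def power_0_left)
      qed
      thus "H ^ i mod q \<in> {1..<q}" using q1 by simp
    qed
    have "card {x \<in> {1..<q}. [x ^ p = 1] (mod q)} \<le> card {x \<in> {..<q}. [x ^ p = 1] (mod q)}"
      by (intro card_mono) auto
    also have "\<dots> \<le> p" using roots_mod_prime_bound[of q p 1] q p by simp
    finally have "card {x \<in> {1..<q}. [x ^ p = 1] (mod q)} \<le> card ((\<lambda>i. H ^ i mod q) ` {..<p})"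
      using inj by (simp add: card_image)
    with card_mono[OF _ sub] show "card ((\<lambda>i. H ^ i mod q) ` {..<p}) = card {x \<in> {1..<q}. [x ^ p = 1] (mod q)}"
      by simp
  qed simp
  have ex: "\<exists>i. [u ^ f = h ^ i] (mod int q)" if u: "\<not> int q dvd u" for u
  proof -
    define x where "x = nat (u ^ f mod int q)"
    have x: "int x = u ^ f mod int q" using q1 by (simp add: x_def)
    have "u ^ f mod int q \<noteq> 0" using u q prime_dvd_power[of "int q" u f] by auto
    hence "int x \<noteq> 0" "int x < int q" unfolding x using q1 by auto
    hence xr: "x \<in> {1..<q}" by auto
    have xu: "[int x = u ^ f] (mod int q)" by (simp add: x cong_def)
    have "[int x ^ p = (u ^ f) ^ p] (mod int q)" by (intro cong_pow xu)
    also have "(u ^ f) ^ p = u ^ (q - 1)" by (simp add: fp flip: power_mult)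
    also have "[u ^ (q - 1) = 1] (mod int q)" by (rule fermat_int[OF q u])
    finally have "[x ^ p = 1] (mod q)" by (metis cong_int_iff of_nat_1 of_nat_power)
    with xr roots have "x \<in> (\<lambda>i. H ^ i mod q) ` {..<p}" by blast
    then obtain i where "x = H ^ i mod q" by blast
    hence "[int x = int H ^ i] (mod int q)" using cong_int_mod[of "H ^ i" q] by simp
    hence "[u ^ f = h ^ i] (mod int q)" using xu Hc cong_sym cong_trans by meson
    thus ?thesis ..
  qed
  \<comment> \<open>Only the class of the index modulo p is determined; any choice will do, since it
    is used only in exponents of zeta and of h.\<close>
  define ind where "ind u = (SOME i. [u ^ f = h ^ i] (mod int q))" for u
  have ind: "[u ^ f = h ^ ind u] (mod int q)" if "\<not> int q dvd u" for u
    unfolding ind_def using ex[OF that] by (rule someI_ex)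
  define \<psi> where "\<psi> u = \<zeta> ^ ind u" for u
  have psi_eqI: "\<psi> u = \<zeta> ^ i" if "\<not> int q dvd u" "[u ^ f = h ^ i] (mod int q)" for u i
  proof -
    have "[h ^ ind u = h ^ i] (mod int q)" using ind[OF that(1)] that(2) cong_sym cong_trans by blast
    thus ?thesis by (simp add: \<psi>_def zeta_pow_eq_iff hpow)
  qed
  have psi_mult: "\<psi> w = \<psi> u * \<psi> v" if "[w = u * v] (mod int q)" "\<not> int q dvd u" "\<not> int q dvd v" for u v w
  proof -
    have "\<not> int q dvd u * v" using that q by (simp add: prime_dvd_mult_iff)
    hence nw: "\<not> int q dvd w" using that(1) by (metis cong_dvd_iff)
    have "[w ^ f = (u * v) ^ f] (mod int q)" by (intro cong_pow that)
    also have "(u * v) ^ f = u ^ f * v ^ f" by (rule power_mult_distrib)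
    also have "[u ^ f * v ^ f = h ^ ind u * h ^ ind v] (mod int q)" by (intro cong_mult ind that)
    finally have "[w ^ f = h ^ (ind u + ind v)] (mod int q)" by (simp add: power_add)
    from psi_eqI[OF nw this] show ?thesis by (simp add: \<psi>_def power_add)
  qed
  have psi_cnj: "\<psi> u * cnj (\<psi> u) = 1" "\<psi> u ^ k * cnj (\<psi> u ^ k) = 1" for u k
    unfolding \<psi>_def power_mult[symmetric] by (rule cnj_zeta_power)+
  have psi_1: "\<psi> 1 = 1"
    using psi_eqI[of 1 0] q1 by simp
  \<comment> \<open>If the character were trivial, all q - 1 = f p nonzero residues would be roots
    of X^f = 1, which has at most f roots.\<close>
  have psi_nontriv: "\<exists>v\<in>{1..<q}. \<psi> (int v) \<noteq> 1"
  proof (rule ccontr)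
    assume "\<not> ?thesis"
    hence a: "\<psi> (int v) = 1" if "v \<in> {1..<q}" for v using that by auto
    have b: "[v ^ f = 1] (mod q)" if v: "v \<in> {1..<q}" for v
    proof -
      have nd: "\<not> int q dvd int v" using not_dvd_of_range[OF v] by simp
      have "p dvd ind (int v)" using a[OF v] by (simp add: \<psi>_def zeta_pow_eq_1_iff)
      hence "[h ^ ind (int v) = h ^ 0] (mod int q)" unfolding hpow by (simp add: cong_0_iff)
      hence "[int v ^ f = 1] (mod int q)" using ind[OF nd] cong_trans by fastforce
      thus ?thesis by (metis cong_int_iff of_nat_1 of_nat_power)
    qed
    have "card {1..<q} \<le> card {x \<in> {..<q}. [x ^ f = 1] (mod q)}"
      using b by (intro card_mono) auto
    also have "\<dots> \<le> f" using roots_mod_prime_bound[of q f 1] q f0 by simp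
    finally have "f * p \<le> f" unfolding fp by simp
    thus False using f0 p by simp
  qed
  have psi_sum: "(\<Sum>u\<in>{1..<q}. \<psi> (int u) ^ k) = 0" if k: "\<not> p dvd k" for k
  proof -
    obtain v where v: "v \<in> {1..<q}" "\<psi> (int v) \<noteq> 1" using psi_nontriv by blast
    have ne: "\<psi> (int v) ^ k \<noteq> 1"
      using v(2) k p unfolding \<psi>_def power_mult[symmetric] zeta_pow_eq_1_iff by (simp add: prime_dvd_mult_iff)
    have nv: "\<not> q dvd v" by (rule not_dvd_of_range[OF v(1)])
    have "(\<Sum>u\<in>{1..<q}. \<psi> (int u) ^ k) = (\<Sum>u\<in>{1..<q}. \<psi> (int ((v * u) mod q)) ^ k)"
      by (rule sum.reindex_bij_betw[OF bij_betw_mult_mod[OF q nv], symmetric])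
    also have "\<dots> = (\<Sum>u\<in>{1..<q}. \<psi> (int v) ^ k * \<psi> (int u) ^ k)"
    proof (intro sum.cong refl)
      fix u assume u: "u \<in> {1..<q}"
      have "\<psi> (int ((v * u) mod q)) = \<psi> (int v) * \<psi> (int u)"
        using cong_int_mod[of "v * u" q] nv not_dvd_of_range[OF u] by (intro psi_mult) auto
      thus "\<psi> (int ((v * u) mod q)) ^ k = \<psi> (int v) ^ k * \<psi> (int u) ^ k" by (simp add: power_mult_distrib)
    qed
    also have "\<dots> = \<psi> (int v) ^ k * (\<Sum>u\<in>{1..<q}. \<psi> (int u) ^ k)" by (simp add: sum_distrib_left)
    finally have "(1 - \<psi> (int v) ^ k) * (\<Sum>u\<in>{1..<q}. \<psi> (int u) ^ k) = 0" by (simp add: algebra_simps)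
    thus ?thesis using ne by simp
  qed
  have ins: "{1..<q} = insert 1 {2..<q}" using q1 by auto
  have psi_sum': "(\<Sum>u\<in>{2..<q}. \<psi> (int u) ^ k) = - 1" if k: "\<not> p dvd k" for k
    using psi_sum[OF k] psi_1 unfolding ins by (simp add: add_eq_0_iff)
  have nd: "\<not> int q dvd int u" "\<not> int q dvd 1 - int u" if "u \<in> {2..<q}" for u
  proof -
    show "\<not> int q dvd int u" using that not_dvd_of_range[of u q] by auto
    have "\<not> q dvd u - 1" using that by (auto dest!: dvd_imp_le)
    hence "\<not> int q dvd int (u - 1)" by simp
    moreover have "int (u - 1) = - (1 - int u)" using that by (simp add: of_nat_diff)
    ultimately show "\<not> int q dvd 1 - int u" by (metis dvd_minus_iff)
  qed
  \<comment> \<open>Its value at zeta is the Jacobi sum of \<psi>(u) \<psi>(1 - u)^s; u = 0 and u =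
    1 are left out because there one of the characters would be taken at 0.\<close>
  define G :: "int poly" where "G = (\<Sum>u\<in>{2..<q}. monom 1 (ind (int u) + s * ind (1 - int u)))"
  have evG: "ev G \<zeta> = (\<Sum>u\<in>{2..<q}. \<psi> (int u) * \<psi> (1 - int u) ^ s)"
    by (simp add: G_def \<psi>_def power_add mult.commute[of s] power_mult)
  have ns: "\<not> p dvd s" "\<not> p dvd s + 1" using s p by (auto dest!: dvd_imp_le)
  have norm: "ev G \<zeta> * cnj (ev G \<zeta>) = of_nat q"
  proof -
    define T where "T = {(u, v). u \<in> {2..<q} \<and> v \<in> {2..<q} \<and> u \<noteq> v}"
    have finT: "finite T" unfolding T_def by (rule finite_subset[of _ "{2..<q} \<times> {2..<q}"]) auto
    define quo where "quo x y = nat ((x * y ^ (q - 2)) mod int q)" for x y :: int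
    have quo: "int (quo x y) * y mod int q = x mod int q" if "\<not> int q dvd y" for x y
    proof -
      have "int (quo x y) = (x * y ^ (q - 2)) mod int q" using q1 by (simp add: quo_def)
      hence "int (quo x y) * y mod int q = x * (y ^ (q - 2) * y) mod int q"
        by (simp add: mod_mult_left_eq mult.assoc)
      also have "y ^ (q - 2) * y = y ^ (q - 1)"
      proof -
        have "q - 1 = Suc (q - 2)" using q1 by simp
        thus ?thesis by simp
      qed
      also have "x * y ^ (q - 1) mod int q = x * 1 mod int q"
        using cong_mult[OF cong_refl[of x] fermat_int[OF q that]] by (simp add: cong_def)
      finally show ?thesis by simp
    qed
    have quoc: "[x = int (quo x y) * y] (mod int q)" if "\<not> int q dvd y" for x y
      using quo[OF that, of x] by (simp add: cong_def)
    have quo_lt: "quo x y < q" for x y using q1 by (simp add: quo_def nat_less_iff)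
    \<comment> \<open>The map (u, v) -> (u/v, (1-u)/(1-v)) permutes the pairs of distinct residues
      other than 0 and 1. So the off-diagonal part of the squared absolute value becomes a product
      of two character sums minus a diagonal, 1 - (-1) = 2, which with the diagonal part q - 2 makes
      q.\<close>
    define F where "F = (\<lambda>(u, v). (quo (int u) (int v), quo (1 - int u) (1 - int v)))"
    have cong_eq: "u = v" if "[int u = int v] (mod int q)" "u < q" "v < q" for u v
      using that by (simp add: cong_int_iff cong_def)
    have FT: "F x \<in> T" if "x \<in> T" for x
    proof -
      obtain u v where x: "x = (u, v)" "u \<in> {2..<q}" "v \<in> {2..<q}" "u \<noteq> v"
        using \<open>x \<in> T\<close> by (auto simp: T_def)
      define a b where "a = quo (int u) (int v)" and "b = quo (1 - int u) (1 - int v)"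
      have a: "[int u = int a * int v] (mod int q)" and b: "[1 - int u = int b * (1 - int v)] (mod int q)"
        unfolding a_def b_def by (intro quoc nd x)+
      have lt: "a < q" "b < q" unfolding a_def b_def by (rule quo_lt)+
      have uv: "\<not> [int u = int v] (mod int q)" using cong_eq[of u v] x by auto
      have "a \<noteq> 0"
      proof
        assume "a = 0" hence "int q dvd int u" using a by (simp add: cong_0_iff)
        thus False using nd x by blast
      qed
      moreover have "a \<noteq> 1" using a uv by auto
      moreover have "b \<noteq> 0"
      proof
        assume "b = 0" hence "int q dvd 1 - int u" using b by (simp add: cong_0_iff)
        thus False using nd x by blast
      qed
      moreover have "b \<noteq> 1"
      proof
        assume "b = 1" hence "[1 - int u = 1 - int v] (mod int q)" using b by simp
        hence "[int u = int v] (mod int q)" by (simp add: cong_iff_dvd_diff dvd_diff_commute)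
        thus False using uv by blast
      qed
      moreover have "a \<noteq> b"
      proof
        assume "a = b"
        have "[int u + (1 - int u) = int a * int v + int b * (1 - int v)] (mod int q)"
          by (intro cong_add a b)
        hence "[int 1 = int a] (mod int q)" using \<open>a = b\<close> by (simp add: algebra_simps)
        hence "1 = a" using lt q1 by (intro cong_eq) auto
        thus False using \<open>a \<noteq> 1\<close> by simp
      qed
      ultimately show ?thesis using lt by (simp add: F_def x T_def flip: a_def b_def)
    qed
    have injF: "inj_on F T"
    proof (rule inj_onI)
      fix x x' assume xx: "x \<in> T" "x' \<in> T" "F x = F x'"
      obtain u v where x: "x = (u, v)" "u \<in> {2..<q}" "v \<in> {2..<q}" "u \<noteq> v"
        using xx(1) by (auto simp: T_def)
      obtain u' v' where x': "x' = (u', v')" "u' \<in> {2..<q}" "v' \<in> {2..<q}" "u' \<noteq> v'"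
        using xx(2) by (auto simp: T_def)
      obtain a b where ab: "F x = (a, b)" by (cases "F x")
      hence ab': "a = quo (int u) (int v)" "b = quo (1 - int u) (1 - int v)" 
        "a = quo (int u') (int v')" "b = quo (1 - int u') (1 - int v')" 
        using xx(3) by (auto simp: F_def x x')
      have a: "[int u = int a * int v] (mod int q)" and b: "[1 - int u = int b * (1 - int v)] (mod int q)"
        unfolding ab'(1,2) by (intro quoc nd x)+
      have a': "[int u' = int a * int v'] (mod int q)" and b': "[1 - int u' = int b * (1 - int v')] (mod int q)"
        unfolding ab'(3,4) by (intro quoc nd x')+
      have "(a, b) \<in> T" using FT[OF xx(1)] ab by simp
      hence ab_ne: "\<not> int q dvd int a - int b"
        using cong_eq[of a b] by (auto simp: T_def cong_iff_dvd_diff)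
      have "[int u + (1 - int u) = int a * int v + int b * (1 - int v)] (mod int q)"
        "[int u' + (1 - int u') = int a * int v' + int b * (1 - int v')] (mod int q)"
        by (intro cong_add a b a' b')+
      hence "[int a * int v + int b * (1 - int v) = int a * int v' + int b * (1 - int v')] (mod int q)"
        by (metis cong_sym cong_trans diff_add_cancel add.commute)
      hence "int q dvd (int a - int b) * (int v - int v')" by (simp add: cong_iff_dvd_diff algebra_simps)
      hence "int q dvd int v - int v'" using ab_ne q by (simp add: prime_dvd_mult_iff)
      hence vv: "v = v'" using cong_eq[of v v'] x x' by (simp add: cong_iff_dvd_diff)
      hence "[int u = int u'] (mod int q)" using a a' cong_sym cong_trans by blast
      hence "u = u'" using cong_eq x x' by auto
      thus "x = x'" using vv x x' by simp
    qed
    have bij: "bij_betw F T T"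
      using injF endo_inj_surj[OF finT _ injF] FT by (simp add: bij_betw_def image_subset_iff)
    define J where "J u = \<psi> (int u) * \<psi> (1 - int u) ^ s" for u
    have diag: "(\<Sum>u\<in>{2..<q}. \<Sum>v\<in>{2..<q}. c u v) = (\<Sum>u\<in>{2..<q}. c u u) + (\<Sum>(u,v)\<in>T. c u v)" for c :: "nat \<Rightarrow> nat \<Rightarrow> complex"
    proof -
      have "(\<Sum>u\<in>{2..<q}. \<Sum>v\<in>{2..<q}. c u v) = (\<Sum>(u,v)\<in>{2..<q} \<times> {2..<q}. c u v)"
        by (rule sum.cartesian_product)
      also have "{2..<q} \<times> {2..<q} = (\<lambda>u. (u,u)) ` {2..<q} \<union> T" by (auto simp: T_def)
      also have "(\<Sum>(u,v)\<in>\<dots>. c u v) = (\<Sum>(u,v)\<in>(\<lambda>u. (u,u)) ` {2..<q}. c u v) + (\<Sum>(u,v)\<in>T. c u v)"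
        by (rule sum.union_disjoint) (use finT in \<open>auto simp: T_def\<close>)
      also have "(\<Sum>(u,v)\<in>(\<lambda>u. (u,u)) ` {2..<q}. c u v) = (\<Sum>u\<in>{2..<q}. c u u)"
        by (subst sum.reindex) (auto simp: inj_on_def)
      finally show ?thesis .
    qed
    have "ev G \<zeta> * cnj (ev G \<zeta>) = (\<Sum>u\<in>{2..<q}. \<Sum>v\<in>{2..<q}. J u * cnj (J v))"
      unfolding evG J_def cnj_sum sum_product ..
    also have "\<dots> = (\<Sum>u\<in>{2..<q}. J u * cnj (J u)) + (\<Sum>(u,v)\<in>T. J u * cnj (J v))" by (rule diag)
    also have "(\<Sum>u\<in>{2..<q}. J u * cnj (J u)) = (\<Sum>u\<in>{2..<q}. 1)"
    proof (intro sum.cong refl)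
      fix u
      have "J u * cnj (J u) = (\<psi> (int u) * cnj (\<psi> (int u))) * (\<psi> (1 - int u) ^ s * cnj (\<psi> (1 - int u) ^ s))"
        by (simp add: J_def)
      thus "J u * cnj (J u) = 1" by (simp only: psi_cnj mult_1)
    qed
    also have "\<dots> = of_nat q - 2" using q1 by (simp add: of_nat_diff)
    also have "(\<Sum>(u,v)\<in>T. J u * cnj (J v)) = (\<Sum>x\<in>T. case F x of (a,b) \<Rightarrow> \<psi> (int a) * \<psi> (int b) ^ s)"
    proof (intro sum.cong refl)
      fix x assume "x \<in> T"
      then obtain u v where x: "x = (u, v)" "u \<in> {2..<q}" "v \<in> {2..<q}" "u \<noteq> v"
        by (auto simp: T_def)
      define a b where "a = quo (int u) (int v)" and "b = quo (1 - int u) (1 - int v)"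
      have a: "[int u = int a * int v] (mod int q)" and b: "[1 - int u = int b * (1 - int v)] (mod int q)"
        unfolding a_def b_def by (intro quoc nd x)+
      have Fx: "F x = (a, b)" by (simp add: F_def x a_def b_def)
      hence "(a, b) \<in> T" using FT[OF \<open>x \<in> T\<close>] by simp
      hence nab: "\<not> int q dvd int a" "\<not> int q dvd int b" using nd by (auto simp: T_def)
      have 1: "\<psi> (int u) = \<psi> (int a) * \<psi> (int v)" by (rule psi_mult[OF a nab(1) nd(1)[OF x(3)]])
      have 2: "\<psi> (1 - int u) = \<psi> (int b) * \<psi> (1 - int v)" by (rule psi_mult[OF b nab(2) nd(2)[OF x(3)]])
      have "J u * cnj (J v) = \<psi> (int a) * \<psi> (int b) ^ s * (\<psi> (int v) * cnj (\<psi> (int v))) * (\<psi> (1 - int v) ^ s * cnj (\<psi> (1 - int v) ^ s))"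
        unfolding J_def 1 2 complex_cnj_mult power_mult_distrib by (simp only: mult_ac)
      hence "J u * cnj (J v) = \<psi> (int a) * \<psi> (int b) ^ s" by (simp only: psi_cnj mult_1_right)
      thus "(case x of (u, v) \<Rightarrow> J u * cnj (J v)) = (case F x of (a,b) \<Rightarrow> \<psi> (int a) * \<psi> (int b) ^ s)"
        using Fx by (simp add: x(1))
    qed
    also have "\<dots> = (\<Sum>(a,b)\<in>T. \<psi> (int a) * \<psi> (int b) ^ s)"
      by (rule sum.reindex_bij_betw[OF bij])
    also have "\<dots> = (\<Sum>a\<in>{2..<q}. \<Sum>b\<in>{2..<q}. \<psi> (int a) * \<psi> (int b) ^ s) - (\<Sum>a\<in>{2..<q}. \<psi> (int a) * \<psi> (int a) ^ s)"
      unfolding diag by simp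
    also have "(\<Sum>a\<in>{2..<q}. \<Sum>b\<in>{2..<q}. \<psi> (int a) * \<psi> (int b) ^ s) = (\<Sum>a\<in>{2..<q}. \<psi> (int a) ^ 1) * (\<Sum>b\<in>{2..<q}. \<psi> (int b) ^ s)"
      by (simp add: sum_product)
    also have "\<dots> = 1"
      using psi_sum'[of 1] psi_sum'[OF ns(1)] p by simp
    also have "(\<Sum>a\<in>{2..<q}. \<psi> (int a) * \<psi> (int a) ^ s) = -1"
      using psi_sum'[OF ns(2)] by simp
    finally show ?thesis by simp
  qed
  have van: "int q dvd poly G (h ^ j)" if j: "j \<in> {1..<p} - carry p s" for j
  proof -
    define r where "r = (s * j) mod p"
    have jr: "j + r < p"
    proof -
      have "j + r \<noteq> p"
      proof
        assume "j + r = p"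
        hence "(j + s * j) mod p = 0" by (metis r_def mod_add_right_eq mod_self)
        hence "p dvd (s + 1) * j" by (simp add: algebra_simps dvd_eq_mod_eq_0)
        thus False using p ns j not_dvd_of_range[of j p] prime_dvd_mult_iff by blast
      qed
      thus ?thesis using j by (auto simp: carry_def r_def)
    qed
    have "\<not> p dvd s * j" using p ns j not_dvd_of_range[of j p] prime_dvd_mult_iff by blast
    hence r0: "r > 0" by (simp add: r_def mod_greater_zero_iff_not_dvd)
    have "poly G (h ^ j) = (\<Sum>u\<in>{2..<q}. (h ^ ind (int u)) ^ j * (h ^ ind (1 - int u)) ^ (s * j))"
      unfolding G_def poly_sum by (intro sum.cong refl)
        (simp add: poly_monom power_add mult_ac flip: power_mult)
    also have "[\<dots> = (\<Sum>u\<in>{2..<q}. int u ^ (f * j) * (1 - int u) ^ (f * r))] (mod int q)"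
    proof (rule cong_sum, rule cong_mult)
      fix u assume u: "u \<in> {2..<q}"
      have "[(h ^ ind (int u)) ^ j = (int u ^ f) ^ j] (mod int q)" by (intro cong_pow cong_sym[OF ind] nd u)
      thus "[(h ^ ind (int u)) ^ j = int u ^ (f * j)] (mod int q)" by (simp add: power_mult)
      have "[(h ^ ind (1 - int u)) ^ (s * j) = ((1 - int u) ^ f) ^ (s * j)] (mod int q)" 
        by (intro cong_pow cong_sym[OF ind] nd u)
      \<comment> \<open>Since f p = q - 1, Fermat's theorem allows s j to be replaced by its residue
        r modulo p.\<close>
      also have "((1 - int u) ^ f) ^ (s * j) = ((1 - int u) ^ (q - 1)) ^ (s * j div p) * (1 - int u) ^ (f * r)"
      proof -
        have "f * (s * j) = f * p * (s * j div p) + f * r" unfolding r_def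
          by (metis distrib_left mult.assoc mult_div_mod_eq)
        thus ?thesis unfolding fp by (simp only: power_mult[symmetric] power_add)
      qed
      also have "[\<dots> = 1 ^ (s * j div p) * (1 - int u) ^ (f * r)] (mod int q)"
        by (intro cong_mult cong_pow fermat_int q nd u cong_refl)
      finally show "[(h ^ ind (1 - int u)) ^ (s * j) = (1 - int u) ^ (f * r)] (mod int q)" by simp
    qed
    \<comment> \<open>The terms u = 0 and u = 1 may be added because both exponents are
      positive.\<close>
    also have "(\<Sum>u\<in>{2..<q}. int u ^ (f * j) * (1 - int u) ^ (f * r)) = (\<Sum>u<q. int u ^ (f * j) * (1 - int u) ^ (f * r))"
    proof -
      have "{..<q} = insert 0 (insert 1 {2..<q})" using q1 by auto
      moreover have "f * j > 0" "f * r > 0" using f0 j r0 by auto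
      ultimately show ?thesis by (simp add: power_0_left)
    qed
    also have "\<dots> = (\<Sum>u<q. poly ([:0,1:] ^ (f * j) * [:1,-1:] ^ (f * r)) (int u))"
      by (simp add: algebra_simps)
    also have "[\<dots> = 0] (mod int q)"
    proof (rule sum_poly_cong_0[OF q])
      have "degree ([:0,1:] ^ (f * j) * [:1,-1:] ^ (f * r) :: int poly) \<le> f * j + f * r"
        by (intro order.trans[OF degree_mult_le] add_mono order.trans[OF degree_power_le]) auto
      \<comment> \<open>This is where j lies outside the carry set: j + r < p.\<close>
      also have "\<dots> < f * p" using jr f0 by (simp flip: distrib_left)
      finally show "degree ([:0,1:] ^ (f * j) * [:1,-1:] ^ (f * r) :: int poly) < q - 1" by (simp add: fp)
    qed
    finally show ?thesis by (simp add: cong_0_iff)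
  qed
  from norm van show ?thesis by blast
qed

end

section \<open>Kummer's congruences\<close>

definition euler_op :: "int poly \<Rightarrow> int poly" where "euler_op f = [:0,1:] * pderiv f"

text \<open>For a polynomial with coefficients a_i this is the sum of a_i i^m. With X = e^v it is
  the m-th derivative at v = 0, so these are the derivatives in Kummer's logarithmic method.\<close>

definition euler_moment :: "nat \<Rightarrow> int poly \<Rightarrow> int" where "euler_moment m f = poly ((euler_op ^^ m) f) 1"

lemma euler_op_add: "euler_op (f + g) = euler_op f + euler_op g" and euler_op_mult: "euler_op (f * g) = euler_op f * g + f * euler_op g"
  and euler_op_smult: "euler_op (smult c f) = smult c (euler_op f)" and euler_op_0: "euler_op 0 = 0" and euler_op_1: "euler_op 1 = 0"
  by (simp_all add: euler_op_def pderiv_add pderiv_mult pderiv_smult algebra_simps)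

lemma euler_op_diff: "euler_op (f - g) = euler_op f - euler_op g"
  by (simp add: euler_op_def pderiv_diff algebra_simps)

lemma euler_op_monom: "euler_op (monom a n) = monom (a * int n) n"
proof (cases n)
  case (Suc k)
  have "euler_op (monom a n) = pCons 0 (pderiv (monom a n))" by (simp add: euler_op_def)
  also have "\<dots> = pCons 0 (monom (int n * a) k)" by (simp only: pderiv_monom Suc diff_Suc_1 of_nat_id)
  finally show ?thesis by (simp only: Suc monom_Suc mult.commute)
qed (simp add: euler_op_def monom_0)

lemma euler_op_const: "euler_op [:c:] = 0"
  using euler_op_monom[of c 0] by (simp add: monom_0)

lemma smult_as_mult: "smult c f = [:c:] * f"
  by simp

lemma euler_op_power: "euler_op (f ^ n) = smult (int n) (f ^ (n - 1) * euler_op f)"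
  by (simp add: euler_op_def pderiv_power algebra_simps)

lemma funpow_euler_op_add: "(euler_op ^^ m) (f + g) = (euler_op ^^ m) f + (euler_op ^^ m) g"
  by (induction m) (simp_all add: euler_op_add)

lemma funpow_euler_op_smult: "(euler_op ^^ m) (smult c f) = smult c ((euler_op ^^ m) f)"
  by (induction m) (simp_all add: euler_op_smult)

lemma funpow_euler_op_monom: "(euler_op ^^ m) (monom a n) = monom (a * int n ^ m) n"
  by (induction m) (simp_all add: euler_op_monom mult_ac)

lemma euler_moment_add: "euler_moment m (f + g) = euler_moment m f + euler_moment m g"
  and euler_moment_smult: "euler_moment m (smult c f) = c * euler_moment m f"
  and euler_moment_monom: "euler_moment m (monom a n) = a * int n ^ m"
  and euler_moment_euler_op: "euler_moment m (euler_op f) = euler_moment (Suc m) f"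
  by (simp_all add: euler_moment_def funpow_euler_op_add funpow_euler_op_smult funpow_euler_op_monom poly_monom funpow_swap1)

lemma euler_moment_0: "euler_moment m 0 = 0"
  using euler_moment_smult[of m 0 0] by simp

lemma euler_moment_sum: "euler_moment m (\<Sum>i\<in>I. f i) = (\<Sum>i\<in>I. euler_moment m (f i))"
  by (induction I rule: infinite_finite_induct) (simp_all add: euler_moment_0 euler_moment_add)

lemma euler_moment_const: "m > 0 \<Longrightarrow> euler_moment m [:c:] = 0"
  using euler_moment_monom[of m c 0] by (simp add: monom_0)

lemma not_coprime_prime_factor:
  fixes a b :: int
  assumes "\<not> coprime a b"
  obtains q where "prime q" "int q dvd a" "int q dvd b"
proof -
  have "nat (gcd a b) \<noteq> 1" using assms by (auto simp: coprime_iff_gcd_eq_1)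
  then obtain q where q: "prime q" "q dvd nat (gcd a b)" using prime_factor_nat by blast
  have "int q dvd gcd a b" using q(2) by (metis gcd_ge_0_int int_dvd_int_iff int_nat_eq)
  thus ?thesis using q(1) that by simp
qed

text \<open>The ideal (p, X^p - 1) is preferred to (p, \<open>Cyc\<close>) because X d/dX maps it
  into itself, so that all moments of its elements are divisible by p.\<close>

definition cyc_ideal :: "nat \<Rightarrow> int poly set" where
  "cyc_ideal p = {f. \<exists>u v. f = smult (int p) u + (monom 1 p - 1) * v}"

lemma cyc_ideal_smult_p: "smult (int p) u \<in> cyc_ideal p"
  unfolding cyc_ideal_def by (intro CollectI exI[of _ u] exI[of _ 0]) simp

lemma cyc_ideal_unity: "(monom 1 p - 1) * v \<in> cyc_ideal p"
  unfolding cyc_ideal_def by (intro CollectI exI[of _ 0] exI[of _ v]) simp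

lemma cyc_ideal_add:
  assumes "f \<in> cyc_ideal p" "g \<in> cyc_ideal p" shows "f + g \<in> cyc_ideal p"
proof -
  from assms obtain u v u' v' where
    "f = smult (int p) u + (monom 1 p - 1) * v" "g = smult (int p) u' + (monom 1 p - 1) * v'"
    by (auto simp: cyc_ideal_def)
  hence "f + g = smult (int p) (u + u') + (monom 1 p - 1) * (v + v')"
    by (simp only: smult_add_right distrib_left add_ac)
  thus ?thesis unfolding cyc_ideal_def by blast
qed

lemma cyc_ideal_mult:
  assumes "f \<in> cyc_ideal p" shows "g * f \<in> cyc_ideal p"
proof -
  from assms obtain u v where "f = smult (int p) u + (monom 1 p - 1) * v"
    by (auto simp: cyc_ideal_def)
  hence "g * f = smult (int p) (g * u) + (monom 1 p - 1) * (g * v)"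
    by (simp only: mult_smult_right distrib_left mult.left_commute)
  thus ?thesis unfolding cyc_ideal_def by blast
qed

text \<open>X d/dX maps X^p - 1 to p X^p, so by the product rule each application reproduces a
  multiple of X^p - 1 up to a multiple of p.\<close>

lemma euler_moment_unity:
  assumes "p > 0"
  shows "int p dvd euler_moment m ((monom 1 p - 1) * v)"
proof (induction m arbitrary: v)
  case 0
  show ?case by (simp add: euler_moment_def poly_monom)
next
  case (Suc m)
  have "euler_op (monom 1 p - 1) = smult (int p) (monom 1 p)"
    by (simp add: euler_op_diff euler_op_monom euler_op_1 smult_monom)
  hence "euler_op ((monom 1 p - 1) * v) = smult (int p) (monom 1 p * v) + (monom 1 p - 1) * euler_op v"
    by (simp add: euler_op_mult)
  hence "euler_moment (Suc m) ((monom 1 p - 1) * v) = int p * euler_moment m (monom 1 p * v) + euler_moment m ((monom 1 p - 1) * euler_op v)"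
    by (simp add: euler_moment_euler_op[symmetric] euler_moment_add euler_moment_smult)
  thus ?case using Suc by simp
qed

lemma euler_moment_cyc_ideal: "p > 0 \<Longrightarrow> f \<in> cyc_ideal p \<Longrightarrow> int p dvd euler_moment m f"
  using euler_moment_unity by (auto simp: cyc_ideal_def euler_moment_add euler_moment_smult)

context prime_cyclotomic
begin

text \<open>Modulo X - 1 the cofactor B is the constant B(1), and (X - 1) \<open>Cyc\<close> is X^p
  - 1. The moment of \<open>Cyc\<close> itself is a power sum over Z/p, which vanishes as long as m
  \<le> p - 2.\<close>

lemma euler_moment_Cyc_mult:
  assumes m: "m \<le> p - 2"
  shows "int p dvd euler_moment m (Cyc * B)"
proof -
  have "poly (B - [:poly B 1:]) 1 = 0" by simp
  then obtain B' where B': "B - [:poly B 1:] = [:-1,1:] * B'"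
    by (metis dvdE poly_eq_0_iff_dvd)
  have c: "Cyc * [:-1,1:] = monom 1 p - 1"
  proof (rule poly_ext)
    fix z show "poly (Cyc * [:-1,1:]) z = poly (monom 1 p - 1) z"
      using power_diff_1_eq[of z p] by (simp add: Cyc_def poly_sum poly_monom algebra_simps)
  qed
  have "Cyc * B = Cyc * ([:poly B 1:] + [:-1,1:] * B')" unfolding B'[symmetric] by simp
  also have "\<dots> = smult (poly B 1) Cyc + (monom 1 p - 1) * B'"
    unfolding distrib_left mult.assoc[symmetric] c by simp
  finally have "euler_moment m (Cyc * B) = poly B 1 * euler_moment m Cyc + euler_moment m ((monom 1 p - 1) * B')"
    by (simp add: euler_moment_add euler_moment_smult)
  moreover have "euler_moment m Cyc = (\<Sum>i<p. poly (monom 1 m) (int i))"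
    by (simp add: Cyc_def euler_moment_sum euler_moment_monom poly_monom)
  hence "int p dvd euler_moment m Cyc"
    using sum_poly_cong_0[OF p(1), of "monom 1 m"] m p by (simp add: degree_monom_eq cong_0_iff)
  ultimately show ?thesis using euler_moment_unity[of p m B'] p by simp
qed

text \<open>The squared absolute value and the divisibility at h^j are both multiplicative, so the
  Jacobi sums of the prime factors of w are multiplied, with multiplicity.\<close>

lemma jacobi_product:
  fixes w :: nat and h :: int
  assumes "w > 0" "[h ^ p = 1] (mod int w)" "\<And>q. prime q \<Longrightarrow> q dvd w \<Longrightarrow> \<not> [h = 1] (mod int q)"
    and s: "s \<in> {1..p-2}"
  shows "\<exists>G. ev G \<zeta> * cnj (ev G \<zeta>) = of_nat w \<and>
           (\<forall>j\<in>{1..<p} - carry p s. int w dvd poly G (h ^ j))"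
  using assms(1-3)
proof (induction w rule: prime_divisors_induct)
  case (unit w)
  thus ?case by (intro exI[of _ 1]) simp
next
  case (factor q w)
  have 1: "[h ^ p = 1] (mod int q)" "[h ^ p = 1] (mod int w)"
    using factor.prems(2) by (auto intro: cong_dvd_modulus)
  from factor.IH[OF _ 1(2)] factor.prems obtain G where G: "ev G \<zeta> * cnj (ev G \<zeta>) = of_nat w"
    "\<And>j. j\<in>{1..<p} - carry p s \<Longrightarrow> int w dvd poly G (h ^ j)" by auto
  from jacobi_sum[OF factor.hyps(1) 1(1) _ s] factor.prems(3)[of q] factor.hyps(1) 
  obtain G' where G': "ev G' \<zeta> * cnj (ev G' \<zeta>) = of_nat q"
    "\<And>j. j\<in>{1..<p} - carry p s \<Longrightarrow> int q dvd poly G' (h ^ j)" by auto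
  have "ev (G' * G) \<zeta> * cnj (ev (G' * G) \<zeta>) = (ev G' \<zeta> * cnj (ev G' \<zeta>)) * (ev G \<zeta> * cnj (ev G \<zeta>))"
    by simp
  also have "\<dots> = of_nat (q * w)" unfolding G G' by simp
  finally show ?case using G(2) G'(2) by (intro exI[of _ "G' * G"]) (auto intro!: mult_dvd_mono)
qed simp

text \<open>Here \<open>j ^ (p - 2)\<close> stands for the inverse of j modulo p.\<close>

definition stickelberger_prod :: "int \<Rightarrow> int \<Rightarrow> nat \<Rightarrow> int poly" where
  "stickelberger_prod x y s = (\<Prod>j\<in>carry p s. [:x:] + monom y (j ^ (p - 2)))"

lemma ev_linear: "ev ([:x:] + monom y i) z = of_int x + of_int y * z ^ i"
  by simp

text \<open>Complex conjugation sends the factor of j to that of p - j, hence the carry set to its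
  complement; together they run through all nontrivial conjugates, because inversion permutes the
  nonzero residues.\<close>

lemma norm_stickelberger_prod:
  assumes s: "s \<in> {1..p-2}"
  shows "ev (stickelberger_prod x y s) \<zeta> * cnj (ev (stickelberger_prod x y s) \<zeta>) = (\<Prod>k\<in>{1..<p}. of_int x + of_int y * \<zeta> ^ k)"
proof -
  define g where "g j = of_int x + of_int y * \<zeta> ^ (j ^ (p - 2))" for j
  have cnjg: "cnj (g j) = g (p - j)" if j: "j \<in> carry p s" for j
  proof -
    have "odd p" using p prime_odd_nat by blast
    hence "odd (p - 2)" using p by simp
    have jp: "j \<le> p" using j by (simp add: carry_def)
    \<comment> \<open>As p - 2 is odd, the inverses of p - j and of j are negatives of each other
      modulo p.\<close>
    have "int (p - j) ^ (p - 2) + int j ^ (p - 2) = (int p - int j) ^ (p - 2) - (- int j) ^ (p - 2)"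
      using \<open>odd (p - 2)\<close> jp by (simp add: of_nat_diff)
    moreover have "[(int p - int j) ^ (p - 2) = (- int j) ^ (p - 2)] (mod int p)"
      by (intro cong_pow) (simp add: cong_iff_dvd_diff)
    ultimately have "int p dvd int ((p - j) ^ (p - 2) + j ^ (p - 2))"
      by (simp add: cong_iff_dvd_diff)
    hence "p dvd (p - j) ^ (p - 2) + j ^ (p - 2)" by (simp only: int_dvd_int_iff)
    hence "\<zeta> ^ ((p - j) ^ (p - 2)) * \<zeta> ^ (j ^ (p - 2)) = 1"
      by (simp add: zeta_pow_eq_1_iff flip: power_add)
    hence "cnj (\<zeta> ^ (j ^ (p - 2))) = \<zeta> ^ ((p - j) ^ (p - 2))"
      using cnj_zeta_power[of "j ^ (p - 2)"] by (metis mult.commute mult_left_cancel power_not_zero zeta_nz)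
    thus ?thesis by (simp add: g_def)
  qed
  have "ev (stickelberger_prod x y s) \<zeta> = (\<Prod>j\<in>carry p s. g j)" unfolding stickelberger_prod_def ev_prod ev_linear g_def ..
  moreover have "cnj (\<Prod>j\<in>carry p s. g j) = (\<Prod>j\<in>{1..<p} - carry p s. g j)"
    unfolding cnj_prod using prod.reindex_bij_betw[OF carry_reflection[OF p s], of g] cnjg by simp
  ultimately have "ev (stickelberger_prod x y s) \<zeta> * cnj (ev (stickelberger_prod x y s) \<zeta>) = (\<Prod>j\<in>{1..<p}. g j)"
    using prod.subset_diff[of "carry p s" "{1..<p}" g] by (simp add: carry_def subset_iff mult.commute)
  also have "\<dots> = (\<Prod>j\<in>{1..<p}. of_int x + of_int y * \<zeta> ^ ((j ^ (p - 2)) mod p))"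
    by (simp add: g_def zeta_mod)
  also have "\<dots> = (\<Prod>k\<in>{1..<p}. of_int x + of_int y * \<zeta> ^ k)"
  proof (rule prod.reindex_bij_betw)
    have nd: "\<not> p dvd j" if "j \<in> {1..<p}" for j using that by (rule not_dvd_of_range)
    have "inj_on (\<lambda>j. j ^ (p - 2) mod p) {1..<p}"
    proof (rule inj_onI)
      fix j k assume jk: "j \<in> {1..<p}" "k \<in> {1..<p}" "j ^ (p - 2) mod p = k ^ (p - 2) mod p"
      have pe: "p - 1 = Suc (p - 2)" using p by simp
      have "[j ^ (p - 2) * (j * k) = k ^ (p - 2) * (j * k)] (mod p)"
        using jk(3) by (intro cong_mult cong_refl) (simp add: cong_def)
      hence "[j ^ (p - 1) * k = k ^ (p - 1) * j] (mod p)" unfolding pe by (simp add: mult_ac)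
      moreover have "[j ^ (p - 1) * k = 1 * k] (mod p)" "[k ^ (p - 1) * j = 1 * j] (mod p)"
        by (intro cong_mult cong_refl fermat_theorem p nd jk)+
      ultimately have "[k = j] (mod p)" by (metis cong_sym cong_trans mult_1)
      thus "j = k" using jk by (simp add: cong_def)
    qed
    moreover have "(\<lambda>j. j ^ (p - 2) mod p) ` {1..<p} \<subseteq> {1..<p}"
    proof (intro image_subsetI)
      fix j assume "j \<in> {1..<p}"
      hence "\<not> p dvd j ^ (p - 2)" using nd p prime_dvd_power by blast
      thus "j ^ (p - 2) mod p \<in> {1..<p}" using p by (simp add: Suc_le_eq mod_greater_zero_iff_not_dvd)
    qed
    ultimately show "bij_betw (\<lambda>j. j ^ (p - 2) mod p) {1..<p} {1..<p}"
      by (simp add: bij_betw_def endo_inj_surj)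
  qed
  finally show ?thesis .
qed

text \<open>At h^j with j in the carry set the j-th factor of the Stickelberger product becomes x +
  y h, a multiple of w^p; at the other j the factor G is a multiple of w and its p-th power
  suffices. So w^p divides the product in Z[zeta], and the absolute values leave a quotient of
  absolute value 1.\<close>

lemma stickelberger_relation:
  fixes x y h :: int and w :: nat
  assumes w: "w > 0" "\<not> p dvd w"
    and N: "(\<Prod>k\<in>{1..<p}. of_int x + of_int y * \<zeta> ^ k) = of_nat w ^ p"
    and h: "int w ^ p dvd x + h * y" "[h ^ p = 1] (mod int w ^ p)"
    and h1: "\<And>q. prime q \<Longrightarrow> q dvd w \<Longrightarrow> \<not> [h = 1] (mod int q)"
    and s: "s \<in> {1..p-2}"
  shows "\<exists>G r u. r < p \<and> u \<in> {1,-1} \<and> ev (stickelberger_prod x y s * G ^ p) \<zeta> = of_int (u * int w ^ p) * \<zeta> ^ r"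
proof -
  have hw: "[h ^ p = 1] (mod int w)" using h(2) p by (auto intro: cong_dvd_modulus)
  obtain G where G: "ev G \<zeta> * cnj (ev G \<zeta>) = of_nat w"
    "\<And>j. j\<in>{1..<p} - carry p s \<Longrightarrow> int w dvd poly G (h ^ j)"
    using jacobi_product[OF w(1) hw h1 s] by blast
  define F where "F = stickelberger_prod x y s * G ^ p"
  have "dvdZ (int w ^ p) (ev F \<zeta>)"
  proof (rule dvdZ_of_evaluations[OF h(2)])
    fix n assume n: "\<not> p dvd n"
    show "coprime (h ^ n - 1) (int w ^ p)"
    proof (rule ccontr)
      assume "\<not> coprime (h ^ n - 1) (int w ^ p)"
      hence "\<not> coprime (h ^ n - 1) (int w)" by auto
      then obtain q where q: "prime q" "int q dvd h ^ n - 1" "int q dvd int w"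
        using not_coprime_prime_factor by blast
      have "[h ^ n = 1] (mod int q)" using q by (simp add: cong_iff_dvd_diff)
      moreover have "[h ^ p = 1] (mod int q)" using hw q(3) by (rule cong_dvd_modulus)
      moreover have "coprime n p" using n p prime_imp_coprime[of p n] by (simp add: coprime_commute)
      ultimately have "[h = 1] (mod int q)" by (metis cong_1_of_coprime_powers)
      thus False using h1[of q] q by simp
    qed
  next
    show "coprime (int p) (int w ^ p)" using w p prime_imp_coprime[of p w] by simp
  next
    fix j assume j: "j \<in> {1..<p}"
    show "int w ^ p dvd poly F (h ^ j)"
    proof (cases "j \<in> carry p s")
      case True
      have "[j ^ (p - 1) = 1] (mod p)" using fermat_theorem[OF p(1) not_dvd_of_range[OF j]] .
      hence "j ^ (p - 1) mod p = 1" using p by (simp add: cong_def)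
      hence "j ^ (p - 1) = p * (j ^ (p - 1) div p) + 1" by (metis mult_div_mod_eq)
      then obtain k where k: "j ^ (p - 1) = p * k + 1" by blast
      have "(h ^ j) ^ (j ^ (p - 2)) = h ^ (j ^ Suc (p - 2))" by (simp flip: power_mult)
      also have "Suc (p - 2) = p - 1" using p by simp
      also have "h ^ (j ^ (p - 1)) = (h ^ p) ^ k * h" unfolding k by (simp add: power_add power_mult)
      also have "[(h ^ p) ^ k * h = 1 ^ k * h] (mod int w ^ p)" by (intro cong_mult cong_pow h cong_refl)
      finally have e: "[(h ^ j) ^ (j ^ (p - 2)) = h] (mod int w ^ p)" by simp
      have "[x + y * (h ^ j) ^ (j ^ (p - 2)) = x + y * h] (mod int w ^ p)"
        by (intro cong_add cong_mult cong_refl e)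
      hence "int w ^ p dvd poly ([:x:] + monom y (j ^ (p - 2))) (h ^ j)"
        using h(1) by (simp add: poly_monom mult.commute cong_dvd_iff)
      also have "\<dots> dvd poly F (h ^ j)"
        unfolding F_def stickelberger_prod_def poly_mult poly_prod 
        by (intro dvd_mult2 dvd_prodI) (use True in \<open>auto simp: carry_def\<close>)
      finally show ?thesis .
    next
      case False
      hence "int w ^ p dvd poly G (h ^ j) ^ p" using G(2) j by (intro dvd_power_same) auto
      thus ?thesis by (simp add: F_def)
    qed
  qed
  then obtain g where g: "ev F \<zeta> = of_int (int w ^ p) * ev g \<zeta>" by (auto simp: dvdZ_def)
  have "(ev F \<zeta>) * cnj (ev F \<zeta>) = (ev (stickelberger_prod x y s) \<zeta> * cnj (ev (stickelberger_prod x y s) \<zeta>)) * (ev G \<zeta> * cnj (ev G \<zeta>)) ^ p"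
    by (simp add: F_def power_mult_distrib mult_ac)
  also have "\<dots> = of_nat w ^ p * of_nat w ^ p" unfolding norm_stickelberger_prod[OF s] N G ..
  finally have "of_nat w ^ p * of_nat w ^ p * (ev g \<zeta> * cnj (ev g \<zeta>)) = of_nat w ^ p * of_nat w ^ p"
    unfolding g by (simp add: mult_ac)
  hence "ev g \<zeta> * cnj (ev g \<zeta>) = 1" using w by simp
  from unit_circle_imp_root_of_unity[OF this] obtain r u where "r < p" "u \<in> {1, -1}" "ev g \<zeta> = of_int u * \<zeta> ^ r"
    by blast
  thus ?thesis using g unfolding F_def by (intro exI[of _ G] exI[of _ r] exI[of _ u]) simp
qed

text \<open>The logarithmic derivative of x + y X^i is, up to the factor -1/(1 - t), the polynomial
  below, because 1 / (1 - t X^i) is a geometric sum modulo X^p - 1.\<close>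

definition log_deriv_series :: "int \<Rightarrow> nat \<Rightarrow> int poly" where
  "log_deriv_series t i = (\<Sum>k\<in>{1..p}. monom (t ^ k) (i * k))"

text \<open>With W = t X^i one has x + y X^i = x (1 - W) modulo p, and (1 - W)(1 + ... + W^(p-1)) =
  1 - W^p = 1 - t in the quotient by the ideal. Keeping 1 - t as a factor avoids a division.\<close>

lemma euler_op_linear:
  assumes t: "[t * x = - y] (mod int p)"
  shows "smult (1 - t) (euler_op ([:x:] + monom y i)) + smult (int i) (([:x:] + monom y i) * log_deriv_series t i) \<in> cyc_ideal p"
proof -
  define W where "W = monom t i"
  define Z where "Z = (\<Sum>k<p. W ^ k)"
  have Wk: "W ^ k = monom (t ^ k) (i * k)" for k
    by (induction k) (simp_all add: W_def mult_monom monom_0 one_pCons)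
  have V: "log_deriv_series t i = W * Z"
  proof -
    have "log_deriv_series t i = (\<Sum>k\<in>{1..p}. W ^ k)" by (simp add: log_deriv_series_def Wk)
    also have "\<dots> = (\<Sum>k<p. W ^ Suc k)"
      by (rule sum.reindex_bij_witness[of _ Suc "\<lambda>k. k - 1"]) auto
    finally show ?thesis by (simp add: Z_def sum_distrib_left)
  qed
  have Z: "(1 - W) * Z = 1 - W ^ p"
    using power_diff_1_eq[of W p] by (simp add: Z_def algebra_simps)
  have "int p dvd t * x + y" using t by (simp add: cong_iff_dvd_diff)
  then obtain y' where y': "t * x + y = int p * y'" ..
  have "int p dvd t ^ p - t"
  proof (cases "int p dvd t")
    case True
    thus ?thesis using p by (simp add: dvd_diff dvd_power_iff dvd_trans[OF _ dvd_power])
  next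
    case False
    have "[t * t ^ (p - 1) = t * 1] (mod int p)" by (intro cong_mult fermat_int p False cong_refl)
    thus ?thesis using p by (simp add: cong_iff_dvd_diff flip: power_Suc)
  qed
  then obtain t' where t': "t ^ p - t = int p * t'" ..
  have "(monom 1 p - 1 :: int poly) dvd (monom 1 p) ^ i - 1"
    using power_diff_1_eq[of "monom 1 p :: int poly" i] by simp
  then obtain K where K: "monom 1 p ^ i - 1 = (monom 1 p - 1 :: int poly) * K" ..
  have mp: "monom 1 (i * p) = (monom 1 p :: int poly) ^ i"
  proof (induction i)
    case (Suc i)
    have "monom 1 (Suc i * p) = monom 1 p * (monom 1 (i * p) :: int poly)" by (simp add: mult_monom)
    thus ?case by (simp add: Suc)
  qed (simp add: monom_0 one_pCons)
  have Wp: "W ^ p = smult (t ^ p) (1 + (monom 1 p - 1) * K)"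
  proof -
    have "W ^ p = smult (t ^ p) (monom 1 (i * p))" by (simp add: Wk smult_monom)
    also have "monom 1 (i * p) = 1 + (monom 1 p - 1) * K" unfolding mp using K by (simp add: algebra_simps)
    finally show ?thesis .
  qed
  define E where "E = (monom 1 i :: int poly)"
  define M where "M = (monom 1 p - 1 :: int poly)"
  have y: "[:y:] = [:int p:] * [:y':] - [:t:] * [:x:]"
  proof -
    have "y = int p * y' - t * x" using y' by linarith
    thus ?thesis by simp
  qed
  have W: "W = [:t:] * E" by (simp add: W_def E_def smult_monom)
  have R: "(1 - W) * Z = 1 - ([:t:] + [:int p:] * [:t':]) * (1 + M * K)"
  proof -
    have "[:t ^ p:] = [:t:] + [:int p:] * [:t':]" using t' by (simp add: algebra_simps)
    thus ?thesis unfolding Z Wp smult_as_mult M_def by simp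
  qed
  have D: "euler_op ([:x:] + monom y i) = [:int i:] * [:y:] * E"
    by (simp add: euler_op_add euler_op_const euler_op_monom E_def smult_monom mult.commute)
  have a: "[:x:] + monom y i = [:x:] + [:y:] * E"
    by (simp add: E_def smult_monom)
  \<comment> \<open>The two identities hold for indeterminates in place of the constants. Between
    them (1 - W) Z is replaced by its known value; the outcome is a multiple of p plus a multiple of
    X^p - 1.\<close>
  have id: "(1 - t1) * (i1 * (p1 * y2 - t1 * x1) * E) + i1 * ((x1 + (p1 * y2 - t1 * x1) * E) * (t1 * E * Z)) =
     p1 * ((1 - t1) * i1 * y2 * E + i1 * y2 * E * (t1 * E) * Z) - (1 - t1) * i1 * t1 * x1 * E + i1 * x1 * t1 * E * ((1 - t1 * E) * Z)"
    for t1 i1 p1 y2 x1 :: "int poly"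
    by (simp add: algebra_simps)
  have id': "p1 * q1 - (1 - t1) * i1 * t1 * x1 * E + i1 * x1 * t1 * E * (1 - (t1 + p1 * t2) * (1 + M * K)) =
     p1 * (q1 - i1 * x1 * t1 * E * t2 * (1 + M * K)) + M * (- (i1 * x1 * t1 * E * t1 * K))"
    for t1 i1 p1 q1 x1 t2 :: "int poly"
    by (simp add: algebra_simps)
  have "smult (1 - t) (euler_op ([:x:] + monom y i)) + smult (int i) (([:x:] + monom y i) * log_deriv_series t i) = 
    (1 - [:t:]) * ([:int i:] * ([:int p:] * [:y':] - [:t:] * [:x:]) * E) + 
      [:int i:] * (([:x:] + ([:int p:] * [:y':] - [:t:] * [:x:]) * E) * ([:t:] * E * Z))"
  proof -
    have "[:1 - t:] = 1 - [:t:]" by (simp add: one_pCons)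
    thus ?thesis unfolding D unfolding a V unfolding y W smult_as_mult by (simp only:)
  qed
  also have "\<dots> \<in> cyc_ideal p"
    unfolding id R[unfolded W] id' unfolding M_def
    by (intro cyc_ideal_add cyc_ideal_unity) (simp only: cyc_ideal_smult_p flip: smult_as_mult)
  finally show ?thesis .
qed

text \<open>Logarithmic derivatives of the factors add up; the product rule is applied with
  denominators cleared.\<close>

lemma euler_op_stickelberger_prod:
  assumes t: "[t * x = - y] (mod int p)" and "finite J"
  shows "smult (1 - t) (euler_op (\<Prod>j\<in>J. [:x:] + monom y (f j))) + 
    (\<Prod>j\<in>J. [:x:] + monom y (f j)) * (\<Sum>j\<in>J. smult (int (f j)) (log_deriv_series t (f j))) \<in> cyc_ideal p"
  using assms(2)
proof (induction J rule: finite_induct)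
  case empty
  show ?case using cyc_ideal_smult_p[of p 0] by (simp add: euler_op_1)
next
  case (insert j J)
  define a where "a = [:x:] + monom y (f j)"
  define A where "A = (\<Prod>j\<in>J. [:x:] + monom y (f j))"
  define U where "U = (\<Sum>j\<in>J. smult (int (f j)) (log_deriv_series t (f j)))"
  have 1: "A * (smult (1 - t) (euler_op a) + smult (int (f j)) (a * log_deriv_series t (f j))) \<in> cyc_ideal p"
    unfolding a_def by (intro cyc_ideal_mult euler_op_linear t)
  have 2: "a * (smult (1 - t) (euler_op A) + A * U) \<in> cyc_ideal p"
    using insert.IH unfolding A_def U_def by (rule cyc_ideal_mult)
  have id: "A * (d * Da + i * (a * V)) + a * (d * DA + A * U) = d * (Da * A + a * DA) + (a * A) * (i * V + U)"
    for d i Da DA V :: "int poly" by (simp add: algebra_simps)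
  have e1: "(\<Prod>j\<in>insert j J. [:x:] + monom y (f j)) = a * A"
    unfolding a_def A_def by (rule prod.insert[OF insert.hyps])
  have e2: "(\<Sum>j\<in>insert j J. smult (int (f j)) (log_deriv_series t (f j))) = smult (int (f j)) (log_deriv_series t (f j)) + U"
    unfolding U_def by (rule sum.insert[OF insert.hyps])
  show ?case using cyc_ideal_add[OF 1 2] unfolding e1 e2 unfolding euler_op_mult smult_as_mult id .
qed

text \<open>In X^e A G^p = c + \<open>Cyc\<close> B, the logarithmic derivative of G^p is 0 modulo p
  and that of X^e is the constant e. Multiples of \<open>Cyc\<close> have vanishing moments in the
  relevant orders, so c times the moment of order n - 1 of the logarithmic derivative of A vanishes,
  and that moment factors as \<phi>_n(t) times the sum over the carry set.\<close>

lemma kummer: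
  fixes x y h t :: int and w :: nat
  assumes w: "w > 0" "\<not> p dvd w"
    and N: "(\<Prod>k\<in>{1..<p}. of_int x + of_int y * \<zeta> ^ k) = of_nat w ^ p"
    and h: "int w ^ p dvd x + h * y" "[h ^ p = 1] (mod int w ^ p)"
    and h1: "\<And>q. prime q \<Longrightarrow> q dvd w \<Longrightarrow> \<not> [h = 1] (mod int q)"
    and t: "[t * x = - y] (mod int p)"
    and s: "s \<in> {1..p-2}" and n: "n \<in> {2..p-2}"
  shows "[mirimanoff_sum p t n * (\<Sum>j\<in>carry p s. int j ^ (p - 1 - n)) = 0] (mod int p)"
proof -
  from stickelberger_relation[OF w N h h1 s] obtain G r u where
    r: "r < p" and u: "u \<in> {1,-1}" and rel: "ev (stickelberger_prod x y s * G ^ p) \<zeta> = of_int (u * int w ^ p) * \<zeta> ^ r"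
    by blast
  define A where "A = stickelberger_prod x y s"
  define c where "c = u * int w ^ p"
  \<comment> \<open>Multiplication by X^(p - r) clears the power of zeta in the relation.\<close>
  define e where "e = p - r"
  define E where "E = monom 1 e * A * G ^ p"
  have "ev E \<zeta> = of_int c * (\<zeta> ^ r * \<zeta> ^ e)" using rel by (simp add: E_def A_def c_def mult_ac)
  also have "\<zeta> ^ r * \<zeta> ^ e = 1" using r by (simp add: e_def flip: power_add)
  finally have "ev (E - [:c:]) \<zeta> = 0" by simp
  then obtain B where "E - [:c:] = Cyc * B" unfolding Cyc_dvd_iff ..
  hence EB: "E = [:c:] + Cyc * B" by (simp add: algebra_simps)
  define U where "U = (\<Sum>j\<in>carry p s. smult (int (j ^ (p - 2))) (log_deriv_series t (j ^ (p - 2))))"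
  have fin: "finite (carry p s)" by (simp add: carry_def)
  have dA: "smult (1 - t) (euler_op A) + A * U \<in> cyc_ideal p"
    unfolding A_def U_def stickelberger_prod_def by (rule euler_op_stickelberger_prod[OF t fin])
  define Y where "Y = (monom 1 e :: int poly)"
  define R where "R = [:1 - t:] * (Y * A * (G ^ (p - 1) * euler_op G))"
  have id: "d * ((e * Y * A + Y * DA) * g + Y * A * (q * g')) + (U * (Y * A * g) - d * e * (Y * A * g)) = 
      Y * g * (d * DA + A * U) + q * (d * (Y * A * g'))"
    for d e DA g g' q :: "int poly"
    by (simp add: algebra_simps)
  have E: "E = Y * A * G ^ p" by (simp add: E_def Y_def)
  have de: "[:(1 - t) * int e:] = [:1 - t:] * [:int e:]" by simp
  have "euler_op Y = [:int e:] * Y" by (simp add: Y_def euler_op_monom smult_monom)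
  hence DE: "euler_op E = ([:int e:] * Y * A + Y * euler_op A) * G ^ p + Y * A * ([:int p:] * (G ^ (p - 1) * euler_op G))"
    unfolding E euler_op_mult euler_op_power smult_as_mult by (simp only:)
  have "smult (1 - t) (euler_op E) + (U * E - smult ((1 - t) * int e) E) = 
     Y * G ^ p * (smult (1 - t) (euler_op A) + A * U) + smult (int p) R"
    unfolding smult_as_mult de DE unfolding E R_def by (rule id)
  also have "\<dots> \<in> cyc_ideal p" by (intro cyc_ideal_add cyc_ideal_mult dA cyc_ideal_smult_p)
  finally have I: "smult (1 - t) (euler_op E) + (U * E - smult ((1 - t) * int e) E) \<in> cyc_ideal p" .
  \<comment> \<open>With E = c + \<open>Cyc\<close> B inserted, the expression is c U plus a
    constant, which has no moments of positive order, plus a multiple of \<open>Cyc\<close>.\<close>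
  have UE: "U * E - smult ((1 - t) * int e) E = smult c U + ([:- ((1 - t) * int e * c):] + Cyc * (U * B - smult ((1 - t) * int e) B))"
  proof -
    have "U * (cc + Cyc * B) - d * (cc + Cyc * B) = cc * U + (- (d * cc) + Cyc * (U * B - d * B))" for cc d
      by (simp add: algebra_simps)
    moreover have "[:- ((1 - t) * int e * c):] = - ([:(1 - t) * int e:] * [:c:])" by simp
    ultimately show ?thesis unfolding EB smult_as_mult by (simp only:)
  qed
  \<comment> \<open>Moments of order m and, through the derivative of E, of order m + 1 = n occur.
    The constants require m > 0 and the multiples of \<open>Cyc\<close> require n \<le> p - 2, which
    is the range of n.\<close>
  define m where "m = n - 1"
  have m: "m > 0" "Suc m \<le> p - 2" "n = Suc m" using n by (auto simp: m_def)
  have "int p dvd euler_moment m (smult (1 - t) (euler_op E) + (U * E - smult ((1 - t) * int e) E))"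
    using p by (intro euler_moment_cyc_ideal I) simp
  also have "euler_moment m (smult (1 - t) (euler_op E) + (U * E - smult ((1 - t) * int e) E)) = 
    (1 - t) * euler_moment (Suc m) (Cyc * B) + (c * euler_moment m U + euler_moment m (Cyc * (U * B - smult ((1 - t) * int e) B)))"
    unfolding UE euler_moment_add euler_moment_smult euler_moment_euler_op unfolding EB euler_moment_add
    using m by (simp add: euler_moment_const)
  finally have "int p dvd (1 - t) * euler_moment (Suc m) (Cyc * B) + (c * euler_moment m U + euler_moment m (Cyc * (U * B - smult ((1 - t) * int e) B)))" .
  moreover have "int p dvd euler_moment (Suc m) (Cyc * B)" "int p dvd euler_moment m (Cyc * (U * B - smult ((1 - t) * int e) B))"
    using m by (intro euler_moment_Cyc_mult; simp)+
  ultimately have "int p dvd c * euler_moment m U" by (meson dvd_add_left_iff dvd_add_right_iff dvd_mult)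
  moreover have "\<not> int p dvd c"
    using u w p prime_dvd_power[of "int p" "int w" p] by (auto simp: c_def)
  ultimately have LU: "int p dvd euler_moment m U" using p by (simp add: prime_dvd_mult_iff)
  have "euler_moment m U = (\<Sum>j\<in>carry p s. int (j ^ (p - 2)) * (\<Sum>k\<in>{1..p}. t ^ k * int (j ^ (p - 2) * k) ^ m))"
    unfolding U_def log_deriv_series_def euler_moment_sum euler_moment_smult euler_moment_monom ..
  also have "\<dots> = (\<Sum>j\<in>carry p s. int j ^ ((p - 2) * n) * (\<Sum>k\<in>{1..p}. t ^ k * int k ^ m))"
    unfolding m(3) by (intro sum.cong refl)
      (simp add: sum_distrib_left power_mult_distrib power_add mult_ac flip: power_mult)
  also have "[\<dots> = (\<Sum>j\<in>carry p s. int j ^ (p - 1 - n) * mirimanoff_sum p t n)] (mod int p)"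
  proof (rule cong_sum, rule cong_mult)
    fix j assume j: "j \<in> carry p s"
    have nd: "\<not> int p dvd int j" using j not_dvd_of_range[of j p] by (simp add: carry_def)
    \<comment> \<open>The factor j^((p-2) n) is j^(-n); its exponent is brought to p - 1 - n by
      splitting off a multiple of p - 1.\<close>
    have "(p - 2) * n = (p - 1) * (n - 1) + (p - 1 - n)"
    proof -
      obtain k where k: "p - 2 = n + k" using n by (metis atLeastAtMost_iff le_Suc_ex)
      obtain l where l: "n = Suc l" using n by (cases n) auto
      have "p = l + k + 3" using k l p by simp
      thus ?thesis by (simp add: l algebra_simps)
    qed
    hence "int j ^ ((p - 2) * n) = (int j ^ (p - 1)) ^ (n - 1) * int j ^ (p - 1 - n)"
      by (simp only: power_add power_mult)
    also have "[\<dots> = 1 ^ (n - 1) * int j ^ (p - 1 - n)] (mod int p)"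
      by (intro cong_mult cong_pow fermat_int p nd cong_refl)
    finally show "[int j ^ ((p - 2) * n) = int j ^ (p - 1 - n)] (mod int p)" by simp
  next
    have "{1..p} = insert p {1..<p}" using p by auto
    \<comment> \<open>The series runs up to k = p, and that last term vanishes modulo p because m >
      0.\<close>
    hence "(\<Sum>k\<in>{1..p}. t ^ k * int k ^ m) = t ^ p * int p ^ m + mirimanoff_sum p t n"
      using m by (simp add: mirimanoff_sum_def mult.commute)
    thus "[(\<Sum>k\<in>{1..p}. t ^ k * int k ^ m) = mirimanoff_sum p t n] (mod int p)"
      using m by (simp add: cong_iff_dvd_diff)
  qed
  also have "(\<Sum>j\<in>carry p s. int j ^ (p - 1 - n) * mirimanoff_sum p t n) = mirimanoff_sum p t n * (\<Sum>j\<in>carry p s. int j ^ (p - 1 - n))"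
    by (simp add: sum_distrib_left mult.commute)
  finally show ?thesis using LU by (metis cong_0_iff cong_sym cong_trans)
qed

text \<open>As p does not divide z, it does not divide x + y, so x + y and S = (x^p + y^p)/(x + y)
  are coprime with product (-z)^p. Hence S is a p-th power w^p. The residue -x/y is a p-th root of
  unity modulo w^p, and it is nontrivial modulo each prime factor of w since such a prime cannot
  divide x + y.\<close>

lemma fermat_mirimanoff:
  fixes x y z t :: int
  assumes xy: "coprime x y" and flt: "x ^ p + y ^ p + z ^ p = 0"
    and nd: "\<not> int p dvd x" "\<not> int p dvd y" "\<not> int p dvd z"
    and t: "[t * x = - y] (mod int p)" and m: "m \<in> {2..p-2}"
  shows "[mirimanoff_sum p t m * mirimanoff_sum p t (p - m) = 0] (mod int p)"
proof -
  define S where "S = (\<Sum>i<p. (- y) ^ (p - Suc i) * x ^ i)"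
  have odd: "odd p" using p prime_odd_nat by blast
  have S: "(x + y) * S = x ^ p + y ^ p"
    using power_diff_sumr2[of x p "- y"] odd by (simp add: S_def)
  have z0: "z \<noteq> 0" and y0: "y \<noteq> 0" using nd by auto
  hence zp: "x ^ p + y ^ p \<noteq> 0" using flt by (metis add.left_neutral power_not_zero)
  have xy0: "x + y \<noteq> 0" using S zp by auto
  have N: "(\<Prod>k\<in>{1..<p}. of_int x + of_int y * \<zeta> ^ k) = of_int S"
  proof -
    have "of_int (x + y) * (\<Prod>k\<in>{1..<p}. of_int x + of_int y * \<zeta> ^ k) = (\<Prod>k<p. of_int x + of_int y * \<zeta> ^ k)"
    proof -
      have "{..<p} = insert 0 {1..<p}" using p by auto
      thus ?thesis by simp
    qed
    also have "\<dots> = (\<Prod>k<p. of_int (- y) * (of_int x / of_int (- y) - \<zeta> ^ k))"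
      using y0 by (intro prod.cong refl) (simp add: field_simps)
    also have "\<dots> = of_int (- y) ^ p * ((of_int x / of_int (- y)) ^ p - 1)"
      by (simp only: prod.distrib prod_constant card_lessThan prod_zeta_all)
    also have "\<dots> = of_int (x ^ p + y ^ p)"
      using y0 odd by (simp add: power_divide field_simps)
    also have "\<dots> = of_int (x + y) * of_int S" unfolding of_int_mult[symmetric] S ..
    finally show ?thesis using xy0 by (metis mult_left_cancel of_int_eq_0_iff)
  qed
  \<comment> \<open>Coprimality yields a p-th power only for |S|. Positivity follows because S, the
    product of the nontrivial conjugates, has the form v times its complex conjugate; s = 1 supplies
    such a v.\<close>
  have S0: "S > 0"
  proof -
    have "1 \<in> {1..p-2}" using p by auto
    from norm_stickelberger_prod[OF this, of x y] obtain v where "v * cnj v = of_int S" unfolding N by blast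
    hence "of_real (norm v ^ 2) = (of_int S :: complex)" using complex_norm_square[of v] by simp
    hence "of_int S = norm v ^ 2" by (metis of_real_eq_iff of_real_of_int_eq)
    hence "S \<ge> 0" by (metis of_int_0_le_iff zero_le_power2)
    moreover have "S \<noteq> 0" using S zp by auto
    ultimately show ?thesis by simp
  qed
  have pz: "\<not> int p dvd x + y"
  proof
    assume "int p dvd x + y"
    hence "int p dvd x ^ p + y ^ p" by (simp flip: S)
    hence "int p dvd z ^ p" using flt by (metis add.commute dvd_0_right dvd_add_right_iff)
    thus False using nd(3) p prime_dvd_power[of "int p" z p] by simp
  qed
  have cop: "coprime (x + y) S"
  proof (rule ccontr)
    assume "\<not> coprime (x + y) S"
    then obtain q where q: "prime q" "int q dvd x + y" "int q dvd S"
      by (rule not_coprime_prime_factor)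
    have "- y - x = - (x + y)" by simp
    hence mx: "[- y = x] (mod int q)" using q(2) unfolding cong_iff_dvd_diff by (metis dvd_minus_iff)
    \<comment> \<open>Modulo a common prime factor q of x + y and S one has y = -x, so S reduces to
      p x^(p-1).\<close>
    have "[S = (\<Sum>i<p. x ^ (p - Suc i) * x ^ i)] (mod int q)"
      unfolding S_def by (intro cong_sum cong_mult cong_pow mx cong_refl)
    also have "(\<Sum>i<p. x ^ (p - Suc i) * x ^ i) = int p * x ^ (p - 1)"
      by (simp flip: power_add)
    finally have "int q dvd int p * x ^ (p - 1)" using q(3) cong_dvd_iff by blast
    hence "int q dvd int p \<or> int q dvd x" using prime_dvd_multD[of "int q"] prime_dvd_power[of "int q"] q(1) unfolding prime_nat_int_transfer by blast
    moreover have "\<not> int q dvd x"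
    proof
      assume "int q dvd x"
      moreover from this have "int q dvd y" using q(2) by (simp add: dvd_add_right_iff)
      ultimately have "is_unit (int q)" using xy coprime_common_divisor by blast
      thus False using q(1) by simp
    qed
    moreover have "\<not> int q dvd int p"
    proof
      assume "int q dvd int p"
      hence "q = p" using q(1) p by (simp add: primes_dvd_imp_eq)
      thus False using q(2) pz by simp
    qed
    ultimately show False by blast
  qed
  have "(x + y) * S = (- z) ^ p" using S flt odd by simp
  hence "nat \<bar>x + y\<bar> * nat \<bar>S\<bar> = nat \<bar>z\<bar> ^ p"
    by (metis abs_mult abs_minus_cancel nat_abs_mult_distrib nat_power_eq power_abs abs_ge_zero)
  hence 1: "is_nth_power p (nat \<bar>x + y\<bar> * nat \<bar>S\<bar>)" by simp
  have 2: "coprime (nat \<bar>x + y\<bar>) (nat \<bar>S\<bar>)" using cop by simp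
  have "is_nth_power p (nat \<bar>S\<bar>)" using S0 xy0 by (intro is_nth_power_mult_coprime_natD(2)[OF 2 1]) auto
  then obtain w where "nat \<bar>S\<bar> = w ^ p" by (auto simp: is_nth_power_def)
  hence Sw: "S = int w ^ p" using S0 by (metis abs_of_pos int_nat_eq less_imp_le of_nat_power)
  have w0: "w > 0" using Sw S0 p by (cases "w = 0") (auto simp: power_0_left)
  have dvdS: "q dvd S" if "q dvd int w" for q using that Sw p by (simp add: dvd_power_iff dvd_trans[OF _ dvd_power])
  have wp: "\<not> p dvd w"
  proof
    assume "p dvd w"
    hence "int p dvd x ^ p + y ^ p" using dvdS[of "int p"] by (simp flip: S)
    hence "int p dvd z ^ p" using flt by (metis add.commute dvd_0_right dvd_add_right_iff)
    thus False using nd(3) p prime_dvd_power[of "int p" z p] by simp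
  qed
  have "coprime y (int w)"
  proof (rule ccontr)
    assume "\<not> coprime y (int w)"
    then obtain q where q: "prime q" "int q dvd y" "int q dvd int w"
      by (rule not_coprime_prime_factor)
    have "int q dvd x ^ p + y ^ p" using dvdS[OF q(3)] by (simp flip: S)
    moreover have "int q dvd y ^ p" using q(2) p by (simp add: dvd_trans[OF _ dvd_power])
    ultimately have "int q dvd x ^ p" by (simp add: dvd_add_left_iff)
    hence "int q dvd x" using q(1) prime_dvd_power[of "int q"] by simp
    with q(2) have "is_unit (int q)" using xy coprime_common_divisor by blast
    thus False using q(1) by simp
  qed
  hence yw: "coprime y (int w ^ p)" by simp
  then obtain y' where y': "[y * y' = 1] (mod int w ^ p)" using cong_solve_coprime_int by blast
  define h where "h = - x * y'"
  have hy: "[h * y = - x] (mod int w ^ p)"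
    using cong_mult[OF cong_refl[of "- x"] y'] by (simp add: h_def mult_ac)
  have h1: "int w ^ p dvd x + h * y" using hy by (simp add: cong_iff_dvd_diff add.commute)
  have h2: "[h ^ p = 1] (mod int w ^ p)"
  proof -
    have "[h ^ p * y ^ p = (- x) ^ p] (mod int w ^ p)"
      using cong_pow[OF hy, of p] by (simp add: power_mult_distrib)
    moreover have "[(- x) ^ p = 1 * y ^ p] (mod int w ^ p)"
    proof -
      have "(- x) ^ p - 1 * y ^ p = - ((x + y) * int w ^ p)" using odd S Sw by simp
      thus ?thesis unfolding cong_iff_dvd_diff by simp
    qed
    ultimately have "[h ^ p * y ^ p = 1 * y ^ p] (mod int w ^ p)" by (rule cong_trans)
    moreover have "coprime (y ^ p) (int w ^ p)" using yw by simp
    ultimately show ?thesis using cong_mult_rcancel by blast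
  qed
  have h3: "\<not> [h = 1] (mod int q)" if q: "prime q" "q dvd w" for q
  proof
    assume "[h = 1] (mod int q)"
    hence "[h * y = 1 * y] (mod int q)" by (intro cong_mult cong_refl)
    moreover have "[h * y = - x] (mod int q)"
      using hy by (rule cong_dvd_modulus) (use q p in \<open>simp add: dvd_trans[OF _ dvd_power]\<close>)
    ultimately have "[y = - x] (mod int q)" by (metis cong_sym cong_trans mult_1)
    hence "int q dvd x + y" by (simp add: cong_iff_dvd_diff add.commute)
    moreover have "int q dvd S" using q dvdS by simp
    ultimately have "is_unit (int q)" using cop coprime_common_divisor by blast
    thus False using q(1) by simp
  qed
  have "\<not> int p dvd t"
  proof
    assume "int p dvd t"
    hence "int p dvd - y" using t by (metis cong_dvd_iff dvd_mult2)
    thus False using nd by simp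
  qed
  moreover have "(\<Prod>k\<in>{1..<p}. of_int x + of_int y * \<zeta> ^ k) = of_nat w ^ p" unfolding N Sw by simp
  ultimately show ?thesis
    by (intro mirimanoff_of_kummer[OF p _ _ m] kummer[OF w0 wp _ h1 h2 h3 t])
qed

end

section \<open>Residues of p-adic integers\<close>

lemma Zp_carrier_iff: "x \<in> carrier (Zp p) \<longleftrightarrow>
    (\<forall>n. 0 \<le> x n \<and> x n < int p ^ Suc n \<and> x (Suc n) mod int p ^ Suc n = x n)"
  by (auto simp: Zp_def simp del: power_Suc)

lemma Zp_mult: "(x \<otimes>\<^bsub>Zp p\<^esub> y) n = (x n * y n) mod int p ^ Suc n"
  and Zp_add: "(x \<oplus>\<^bsub>Zp p\<^esub> y) n = (x n + y n) mod int p ^ Suc n"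
  and Zp_zero: "\<zero>\<^bsub>Zp p\<^esub> n = 0"
  and Zp_one: "\<one>\<^bsub>Zp p\<^esub> n = 1 mod int p ^ Suc n"
  by (simp_all add: Zp_def)

locale Zp_ring =
  fixes p :: nat
  assumes p: "prime p" "p > 2"
begin

sublocale cring "Zp p"
  using p by (intro Zp_cring) simp

lemma modulus_gt_1: "1 < int p ^ Suc n"
  using p by (intro one_less_power) auto

lemma one_nth: "\<one>\<^bsub>Zp p\<^esub> n = 1"
  using modulus_gt_1[of n] by (simp add: Zp_one del: power_Suc)

lemma nth_mod: "x \<in> carrier (Zp p) \<Longrightarrow> x n mod int p ^ Suc n = x n"
  by (simp add: Zp_carrier_iff del: power_Suc)

lemma nth_step: "x \<in> carrier (Zp p) \<Longrightarrow> x (Suc n) mod int p ^ Suc n = x n"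
  by (simp add: Zp_carrier_iff del: power_Suc)

lemma nth_0_cong:
  assumes "x \<in> carrier (Zp p)" shows "[x n = x 0] (mod int p)"
proof (induction n)
  case (Suc n)
  have "[x (Suc n) = x n] (mod int p ^ Suc n)"
    using nth_step[OF assms, of n] nth_mod[OF assms, of n] by (simp add: cong_def)
  hence "[x (Suc n) = x n] (mod int p)" by (rule cong_dvd_modulus) simp
  thus ?case using Suc cong_trans by blast
qed simp

lemma range_cong_eq:
  assumes "x \<in> carrier (Zp p)" "y \<in> carrier (Zp p)" "[x n = y n] (mod int p ^ Suc n)"
  shows "x n = y n"
  using assms by (metis cong_def nth_mod)

lemma pow_nth:
  assumes "x \<in> carrier (Zp p)"
  shows "[(x [^]\<^bsub>Zp p\<^esub> k) n = x n ^ k] (mod int p ^ Suc n)"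
proof (induction k)
  case 0
  show ?case by (simp add: one_nth)
next
  case (Suc k)
  have "(x [^]\<^bsub>Zp p\<^esub> Suc k) n = ((x [^]\<^bsub>Zp p\<^esub> k) n * x n) mod int p ^ Suc n"
    by (simp add: Zp_mult)
  also have "[\<dots> = (x [^]\<^bsub>Zp p\<^esub> k) n * x n] (mod int p ^ Suc n)"
    by (simp add: cong_def)
  also have "[(x [^]\<^bsub>Zp p\<^esub> k) n * x n = x n ^ k * x n] (mod int p ^ Suc n)"
    by (intro cong_mult Suc cong_refl)
  finally show ?case by (simp add: mult.commute)
qed

lemma mult_0_cong: "[(x \<otimes>\<^bsub>Zp p\<^esub> y) 0 = x 0 * y 0] (mod int p)"
  by (simp add: Zp_mult cong_def)

lemma pow_0_cong: "x \<in> carrier (Zp p) \<Longrightarrow> [(x [^]\<^bsub>Zp p\<^esub> k) 0 = x 0 ^ k] (mod int p)"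
  using pow_nth[of x k 0] by simp

lemma minus_0_cong:
  assumes "x \<in> carrier (Zp p)" shows "[(\<ominus>\<^bsub>Zp p\<^esub> x) 0 = - x 0] (mod int p)"
proof -
  have "(x \<oplus>\<^bsub>Zp p\<^esub> (\<ominus>\<^bsub>Zp p\<^esub> x)) 0 = 0" using assms by (simp add: r_neg Zp_zero)
  hence "int p dvd x 0 + (\<ominus>\<^bsub>Zp p\<^esub> x) 0" by (simp add: Zp_add dvd_eq_mod_eq_0)
  thus ?thesis by (simp add: cong_iff_dvd_diff add.commute)
qed

lemma unit_inv_0_cong:
  assumes "u \<in> Units (Zp p)" shows "[u 0 * (inv\<^bsub>Zp p\<^esub> u) 0 = 1] (mod int p)"
proof -
  have "(u \<otimes>\<^bsub>Zp p\<^esub> inv\<^bsub>Zp p\<^esub> u) 0 = 1" using assms by (simp add: one_nth)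
  thus ?thesis using mult_0_cong[of u "inv\<^bsub>Zp p\<^esub> u"] by (simp add: cong_sym)
qed

lemma unit_nth_0: 
  assumes "u \<in> Units (Zp p)" shows "\<not> int p dvd u 0"
proof
  assume "int p dvd u 0"
  hence "int p dvd 1" using unit_inv_0_cong[OF assms] by (metis cong_dvd_iff dvd_mult2)
  thus False using p by simp
qed

text \<open>If a = 1 modulo p^(n+1), then a^p - 1 gains one more factor p, from 1 + a + ... +
  a^(p-1).\<close>

lemma euler_int:
  fixes k :: int
  assumes "\<not> int p dvd k" shows "[k ^ (p ^ n * (p - 1)) = 1] (mod int p ^ Suc n)"
proof (induction n)
  case 0
  show ?case using fermat_int[OF p(1) assms] by simp
next
  case (Suc n)
  define a where "a = k ^ (p ^ n * (p - 1))"
  obtain c where c: "a = 1 + int p ^ Suc n * c"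
    using Suc.IH unfolding a_def by (metis add.commute cong_iff_lin cong_sym mult.commute)
  have "a ^ p - 1 = (a - 1) * (\<Sum>i<p. a ^ i)" by (rule power_diff_1_eq)
  moreover have "int p ^ Suc n dvd a - 1" using c by simp
  moreover have "int p dvd (\<Sum>i<p. a ^ i)"
  proof -
    have "[a = 1] (mod int p)" using c by (simp add: cong_iff_dvd_diff)
    hence "[(\<Sum>i<p. a ^ i) = (\<Sum>i<p. 1 ^ i)] (mod int p)" by (intro cong_sum cong_pow)
    thus ?thesis by (simp add: cong_iff_dvd_diff dvd_diff_left_iff)
  qed
  ultimately have "int p ^ Suc n * int p dvd a ^ p - 1" by (simp only: mult_dvd_mono)
  moreover have "a ^ p = k ^ (p ^ Suc n * (p - 1))" by (simp add: a_def mult_ac flip: power_mult)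
  ultimately show ?case by (simp add: cong_iff_dvd_diff mult_ac)
qed

text \<open>Euler's theorem gives an inverse of each component as a power of it; these inverses are
  compatible because inverses modulo p^(n+1) are unique.\<close>

lemma Zp_unitI:
  assumes u: "u \<in> carrier (Zp p)" and nd: "\<not> int p dvd u 0"
  shows "u \<in> Units (Zp p)"
proof -
  define v where "v n = u n ^ (p ^ n * (p - 1) - 1) mod int p ^ Suc n" for n
  have un: "\<not> int p dvd u n" for n
    using nth_0_cong[OF u, of n] nd cong_dvd_iff by blast
  have uv: "[u n * v n = 1] (mod int p ^ Suc n)" for n
  proof -
    have "p ^ n * (p - 1) > 0" using p by simp
    hence "u n * u n ^ (p ^ n * (p - 1) - 1) = u n ^ (p ^ n * (p - 1))" 
      by (simp flip: power_Suc)
    thus ?thesis using euler_int[OF un[of n], of n] 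
      by (simp add: v_def cong_def mod_mult_right_eq del: power_Suc)
  qed
  have vn: "v n mod int p ^ Suc n = v n" for n by (simp add: v_def)
  have "v (Suc n) mod int p ^ Suc n = v n" for n
  proof -
    have cop: "coprime (u n) (int p ^ Suc n)"
      using un[of n] p prime_imp_coprime[of "int p" "u n"] by (simp add: coprime_commute del: power_Suc)
    have "[u (Suc n) * v (Suc n) = 1] (mod int p ^ Suc n)"
      using uv[of "Suc n"] by (rule cong_dvd_modulus) simp
    moreover have "[u (Suc n) = u n] (mod int p ^ Suc n)"
      using nth_step[OF u, of n] nth_mod[OF u, of n] by (simp add: cong_def)
    ultimately have "[u n * v (Suc n) = u n * v n] (mod int p ^ Suc n)"
      using uv[of n] by (meson cong_refl cong_mult cong_sym cong_trans)
    hence "[v (Suc n) = v n] (mod int p ^ Suc n)" using cop cong_mult_lcancel by blast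
    thus ?thesis using vn by (simp add: cong_def del: power_Suc)
  qed
  moreover have "0 \<le> v n \<and> v n < int p ^ Suc n" for n
    using p by (simp add: v_def del: power_Suc)
  ultimately have v: "v \<in> carrier (Zp p)" by (simp add: Zp_carrier_iff del: power_Suc)
  have "u \<otimes>\<^bsub>Zp p\<^esub> v = \<one>\<^bsub>Zp p\<^esub>"
  proof
    fix n show "(u \<otimes>\<^bsub>Zp p\<^esub> v) n = \<one>\<^bsub>Zp p\<^esub> n"
      using uv[of n] by (simp add: Zp_mult Zp_one cong_def del: power_Suc)
  qed
  thus ?thesis using u v m_comm[OF v u] unfolding Units_def by (auto intro!: bexI[of _ v])
qed

text \<open>In the factorization of u^(p-1) - v^(p-1) the cofactor of u - v reduces to (p-1)
  v^(p-2), a unit modulo p. So the whole power of p has to divide u - v: roots of unity of order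
  dividing p - 1 are determined by their residues.\<close>

lemma torsion_eqI:
  assumes u: "u \<in> carrier (Zp p)" "u [^]\<^bsub>Zp p\<^esub> (p - 1) = \<one>\<^bsub>Zp p\<^esub>"
    and v: "v \<in> carrier (Zp p)" "v [^]\<^bsub>Zp p\<^esub> (p - 1) = \<one>\<^bsub>Zp p\<^esub>"
    and uv: "[u 0 = v 0] (mod int p)"
  shows "u = v"
proof
  fix n
  have pow: "[u n ^ (p - 1) = 1] (mod int p ^ Suc n)" "[v n ^ (p - 1) = 1] (mod int p ^ Suc n)"
    using pow_nth[OF u(1), of "p - 1" n] pow_nth[OF v(1), of "p - 1" n] u(2) v(2)
    by (simp_all add: one_nth cong_sym_eq)
  have c: "[u n = v n] (mod int p)"
    using nth_0_cong[OF u(1), of n] nth_0_cong[OF v(1), of n] uv cong_sym cong_trans by meson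
  define S where "S = (\<Sum>i<p-1. v n ^ (p - 1 - Suc i) * u n ^ i)"
  have "(u n - v n) * S = u n ^ (p - 1) - v n ^ (p - 1)"
    unfolding S_def by (rule power_diff_sumr2[symmetric])
  hence d: "int p ^ Suc n dvd (u n - v n) * S"
    using pow by (metis cong_iff_dvd_diff cong_sym cong_trans)
  have "[S = (\<Sum>i<p-1. v n ^ (p - 1 - Suc i) * v n ^ i)] (mod int p)"
    unfolding S_def by (intro cong_sum cong_mult cong_pow c cong_refl)
  also have "(\<Sum>i<p-1. v n ^ (p - 1 - Suc i) * v n ^ i) = int (p - 1) * v n ^ (p - 2)"
    by (simp flip: power_add add: numeral_2_eq_2)
  finally have S: "[S = int (p - 1) * v n ^ (p - 2)] (mod int p)" .
  have "\<not> int p dvd v n"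
  proof
    assume "int p dvd v n"
    moreover have "[v n ^ (p - 1) = 1] (mod int p)"
      using pow(2) by (rule cong_dvd_modulus) simp
    moreover have "v n dvd v n ^ (p - 1)" using p by simp
    ultimately have "int p dvd 1" by (metis cong_dvd_iff dvd_trans)
    thus False using p by simp
  qed
  hence "\<not> int p dvd v n ^ (p - 2)" using p prime_dvd_power[of "int p"] by auto
  moreover have "\<not> p dvd p - 1" using p by (auto dest!: dvd_imp_le)
  hence "\<not> int p dvd int (p - 1)" by (simp only: int_dvd_int_iff not_False_eq_True)
  ultimately have "\<not> int p dvd S"
    using cong_dvd_iff[OF S] p prime_dvd_multD[of "int p"] by auto
  hence "coprime (int p ^ Suc n) S" using p prime_imp_coprime[of "int p" S] by (simp del: power_Suc)
  hence "int p ^ Suc n dvd u n - v n" using d by (simp add: coprime_dvd_mult_left_iff del: power_Suc)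
  hence "[u n = v n] (mod int p ^ Suc n)" by (simp add: cong_iff_dvd_diff)
  thus "u n = v n" by (rule range_cong_eq[OF u(1) v(1)])
qed

lemma Zp_cong_iff:
  assumes u: "u \<in> carrier (Zp p)" and v: "v \<in> carrier (Zp p)"
  shows "Zp_cong p u v \<longleftrightarrow> [u 0 = v 0] (mod int p)"
proof -
  define d where "d = u \<ominus>\<^bsub>Zp p\<^esub> v"
  have d: "d \<in> carrier (Zp p)" using u v by (simp add: d_def)
  have d0: "[d 0 = u 0 - v 0] (mod int p)"
  proof -
    have "[d 0 = u 0 + (\<ominus>\<^bsub>Zp p\<^esub> v) 0] (mod int p)" by (simp add: d_def a_minus_def Zp_add cong_def)
    moreover have "[u 0 + (\<ominus>\<^bsub>Zp p\<^esub> v) 0 = u 0 + (- v 0)] (mod int p)"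
      by (intro cong_add cong_refl minus_0_cong v)
    ultimately show ?thesis using cong_trans by fastforce
  qed
  have "d \<in> PIdl\<^bsub>Zp p\<^esub> (Zp_of_int p (int p)) \<longleftrightarrow> int p dvd d 0"
  proof
    assume "d \<in> PIdl\<^bsub>Zp p\<^esub> (Zp_of_int p (int p))"
    then obtain w where "d = w \<otimes>\<^bsub>Zp p\<^esub> Zp_of_int p (int p)" by (auto simp: cgenideal_def)
    thus "int p dvd d 0" by (simp add: Zp_mult Zp_of_int_def)
  next
    assume dv: "int p dvd d 0"
    have dvn: "int p dvd d n" for n using cong_dvd_iff[OF nth_0_cong[OF d, of n]] dv by blast
    \<comment> \<open>Division by p costs one digit of precision, so component n of the quotient is
      taken from component n + 1 of d.\<close>
    define w where "w n = d (Suc n) div int p" for n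
    have dw: "d (Suc n) = int p * w n" for n using dvn by (simp add: w_def)
    have "0 \<le> w n \<and> w n < int p ^ Suc n" for n
    proof -
      have "0 \<le> int p * w n" "int p * w n < int p * int p ^ Suc n"
        using d[unfolded Zp_carrier_iff, rule_format, of "Suc n"] by (simp_all add: dw)
      thus ?thesis using p by (simp add: zero_le_mult_iff del: power_Suc)
    qed
    moreover have "w (Suc n) mod int p ^ Suc n = w n" for n
    proof -
      have "(int p * w (Suc n)) mod (int p * int p ^ Suc n) = int p * w n"
        using nth_step[OF d, of "Suc n"] by (simp only: dw power_Suc)
      thus ?thesis using p by (simp add: mult_mod_right[symmetric] del: power_Suc)
    qed
    ultimately have w: "w \<in> carrier (Zp p)" by (simp add: Zp_carrier_iff del: power_Suc)
    have "d = w \<otimes>\<^bsub>Zp p\<^esub> Zp_of_int p (int p)"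
    proof
      fix n
      have "(w \<otimes>\<^bsub>Zp p\<^esub> Zp_of_int p (int p)) n = (int p * w n) mod int p ^ Suc n"
        by (simp add: Zp_mult Zp_of_int_def mod_mult_right_eq mult.commute del: power_Suc)
      also have "\<dots> = d n" using nth_step[OF d, of n] by (simp only: dw)
      finally show "d n = (w \<otimes>\<^bsub>Zp p\<^esub> Zp_of_int p (int p)) n" by simp
    qed
    thus "d \<in> PIdl\<^bsub>Zp p\<^esub> (Zp_of_int p (int p))" using w by (auto simp: cgenideal_def)
  qed
  also have "\<dots> \<longleftrightarrow> [u 0 = v 0] (mod int p)"
    using cong_dvd_iff[OF d0] by (simp add: cong_iff_dvd_diff)
  finally show ?thesis by (simp add: Zp_cong_def d_def)
qed

text \<open>The representative is the p-adic limit of k^(p^n): component n is k^(p^n) modulo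
  p^(n+1), and Euler's theorem gives compatibility as well as the root-of-unity property.\<close>

lemma teichmuller_exists:
  assumes k: "\<not> int p dvd k"
  shows "\<exists>u. u \<in> Units (Zp p) \<and> u [^]\<^bsub>Zp p\<^esub> (p - 1) = \<one>\<^bsub>Zp p\<^esub> \<and> Zp_cong p u (Zp_of_int p k)"
proof -
  define u where "u n = k ^ (p ^ n) mod int p ^ Suc n" for n
  have uc: "[u n = k ^ (p ^ n)] (mod int p ^ Suc n)" for n by (simp add: u_def cong_def)
  have "u (Suc n) mod int p ^ Suc n = u n" for n
  proof -
    have "u (Suc n) mod int p ^ Suc n = k ^ (p ^ Suc n) mod int p ^ Suc n"
      unfolding u_def by (rule mod_mod_cancel) simp
    also have "p ^ Suc n = p ^ n + p ^ n * (p - 1)" using p by (simp add: algebra_simps)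
    also have "k ^ \<dots> = k ^ (p ^ n) * k ^ (p ^ n * (p - 1))" by (rule power_add)
    also have "\<dots> mod int p ^ Suc n = k ^ (p ^ n) * 1 mod int p ^ Suc n"
      using cong_mult[OF cong_refl euler_int[OF k, of n]] by (simp only: cong_def)
    finally show ?thesis by (simp add: u_def)
  qed
  hence u: "u \<in> carrier (Zp p)"
    using p unfolding Zp_carrier_iff u_def by (simp del: power_Suc)
  have u0: "u 0 = k mod int p" by (simp add: u_def)
  have "u [^]\<^bsub>Zp p\<^esub> (p - 1) = \<one>\<^bsub>Zp p\<^esub>"
  proof
    fix n
    have "[(u [^]\<^bsub>Zp p\<^esub> (p - 1)) n = u n ^ (p - 1)] (mod int p ^ Suc n)" by (rule pow_nth[OF u])
    also have "[u n ^ (p - 1) = (k ^ (p ^ n)) ^ (p - 1)] (mod int p ^ Suc n)" by (intro cong_pow uc)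
    also have "(k ^ (p ^ n)) ^ (p - 1) = k ^ (p ^ n * (p - 1))" by (simp flip: power_mult)
    also have "[\<dots> = 1] (mod int p ^ Suc n)" by (rule euler_int[OF k])
    finally have "[(u [^]\<^bsub>Zp p\<^esub> (p - 1)) n = \<one>\<^bsub>Zp p\<^esub> n] (mod int p ^ Suc n)" by (simp add: one_nth)
    thus "(u [^]\<^bsub>Zp p\<^esub> (p - 1)) n = \<one>\<^bsub>Zp p\<^esub> n" using u by (intro range_cong_eq) auto
  qed
  moreover have "Zp_cong p u (Zp_of_int p k)"
    using p by (subst Zp_cong_iff[OF u Zp_of_int_closed]) (auto simp: u0 Zp_of_int_def)
  moreover have "u \<in> Units (Zp p)" using k by (intro Zp_unitI u) (simp add: u0 dvd_mod_iff)
  ultimately show ?thesis by blast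
qed

lemma teichmuller_eqI:
  assumes "u \<in> Units (Zp p)" "u [^]\<^bsub>Zp p\<^esub> (p - 1) = \<one>\<^bsub>Zp p\<^esub>" "[u 0 = k] (mod int p)"
  shows "teichmuller p k = u"
  unfolding teichmuller_def
proof (rule the_equality)
  have zk: "Zp_of_int p k \<in> carrier (Zp p)" "[Zp_of_int p k 0 = k] (mod int p)" 
    by (rule Zp_of_int_closed, use p in simp) (simp add: Zp_of_int_def cong_def)
  have c: "Zp_cong p v (Zp_of_int p k) \<longleftrightarrow> [v 0 = k] (mod int p)" if "v \<in> Units (Zp p)" for v
    using that zk by (metis Zp_cong_iff Units_closed cong_sym cong_trans)
  show "u \<in> Units (Zp p) \<and> u [^]\<^bsub>Zp p\<^esub> (p - 1) = \<one>\<^bsub>Zp p\<^esub> \<and> Zp_cong p u (Zp_of_int p k)"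
    using assms c by blast
  fix v assume v: "v \<in> Units (Zp p) \<and> v [^]\<^bsub>Zp p\<^esub> (p - 1) = \<one>\<^bsub>Zp p\<^esub> \<and> Zp_cong p v (Zp_of_int p k)"
  have vu: "[v 0 = u 0] (mod int p)"
    using v c[of v] assms(3) by (meson cong_sym cong_trans)
  show "v = u"
    by (rule torsion_eqI[of v u]) (use v assms(2) Units_closed[OF assms(1)] Units_closed[of v] vu in simp_all)
qed

lemma teichmuller:
  assumes k: "\<not> int p dvd k"
  shows "teichmuller p k \<in> Units (Zp p)" "[teichmuller p k 0 = k] (mod int p)"
proof -
  obtain u where u: "u \<in> Units (Zp p)" "u [^]\<^bsub>Zp p\<^esub> (p - 1) = \<one>\<^bsub>Zp p\<^esub>" "Zp_cong p u (Zp_of_int p k)"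
    using teichmuller_exists[OF k] by blast
  have zk: "Zp_of_int p k \<in> carrier (Zp p)" "[Zp_of_int p k 0 = k] (mod int p)" 
    by (rule Zp_of_int_closed, use p in simp) (simp add: Zp_of_int_def cong_def)
  have u0: "[u 0 = k] (mod int p)" using u zk by (metis Zp_cong_iff Units_closed cong_trans)
  have "teichmuller p k = u" using u u0 by (intro teichmuller_eqI)
  thus "teichmuller p k \<in> Units (Zp p)" "[teichmuller p k 0 = k] (mod int p)" using u u0 by auto
qed

text \<open>-1 is itself a (p-1)-th root of unity because p - 1 is even.\<close>

lemma teichmuller_minus_1:
  assumes "[- 1 = k] (mod int p)"
  shows "teichmuller p k = \<ominus>\<^bsub>Zp p\<^esub> \<one>\<^bsub>Zp p\<^esub>"
proof (rule teichmuller_eqI)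
  show "\<ominus>\<^bsub>Zp p\<^esub> \<one>\<^bsub>Zp p\<^esub> \<in> Units (Zp p)" by (rule Units_minus_one_closed)
  have "even (p - 1)" using p prime_odd_nat by simp
  then obtain m where m: "p - 1 = 2 * m" by blast
  have "(\<ominus>\<^bsub>Zp p\<^esub> \<one>\<^bsub>Zp p\<^esub>) \<otimes>\<^bsub>Zp p\<^esub> (\<ominus>\<^bsub>Zp p\<^esub> \<one>\<^bsub>Zp p\<^esub>) = \<one>\<^bsub>Zp p\<^esub>"
    using l_minus[of "\<one>\<^bsub>Zp p\<^esub>" "\<ominus>\<^bsub>Zp p\<^esub> \<one>\<^bsub>Zp p\<^esub>"] by simp
  hence "(\<ominus>\<^bsub>Zp p\<^esub> \<one>\<^bsub>Zp p\<^esub>) [^]\<^bsub>Zp p\<^esub> (2::nat) = \<one>\<^bsub>Zp p\<^esub>"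
    unfolding numeral_2_eq_2 nat_pow_Suc nat_pow_0 by simp
  thus "(\<ominus>\<^bsub>Zp p\<^esub> \<one>\<^bsub>Zp p\<^esub>) [^]\<^bsub>Zp p\<^esub> (p - 1) = \<one>\<^bsub>Zp p\<^esub>"
    unfolding m by (subst nat_pow_pow[symmetric]) auto
  show "[(\<ominus>\<^bsub>Zp p\<^esub> \<one>\<^bsub>Zp p\<^esub>) 0 = k] (mod int p)"
    using minus_0_cong[of "\<one>\<^bsub>Zp p\<^esub>"] assms cong_trans by (simp add: one_nth) blast
qed

lemma finsum_0_cong:
  assumes "finite A" "\<And>i. i \<in> A \<Longrightarrow> f i \<in> carrier (Zp p)"
  shows "[finsum (Zp p) f A 0 = (\<Sum>i\<in>A. f i 0)] (mod int p)"
  using assms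
proof (induction A rule: finite_induct)
  case (insert a A)
  have "[(f a \<oplus>\<^bsub>Zp p\<^esub> finsum (Zp p) f A) 0 = f a 0 + finsum (Zp p) f A 0] (mod int p)"
    by (simp add: Zp_add cong_def)
  also have "[f a 0 + finsum (Zp p) f A 0 = f a 0 + (\<Sum>i\<in>A. f i 0)] (mod int p)"
    using insert by (intro cong_add cong_refl insert.IH) auto
  finally show ?case using insert by (simp add: finsum_insert Pi_def)
qed (simp add: Zp_zero)

lemma eval_finsum_monom:
  assumes "finite A" and c: "\<And>k. k \<in> A \<Longrightarrow> c k \<in> carrier (Zp p)" and t: "t \<in> carrier (Zp p)"
  shows "UnivPoly.eval (Zp p) (Zp p) (\<lambda>u. u) t (\<Oplus>\<^bsub>UP (Zp p)\<^esub> k \<in> A. up_ring.monom (UP (Zp p)) (c k) k) =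
    (\<Oplus>\<^bsub>Zp p\<^esub> k \<in> A. c k \<otimes>\<^bsub>Zp p\<^esub> t [^]\<^bsub>Zp p\<^esub> k)"
proof -
  interpret U: UP_cring "Zp p" "UP (Zp p)" by unfold_locales
  interpret pre: UP_pre_univ_prop "Zp p" "Zp p" "\<lambda>u. u" "UP (Zp p)"
    by unfold_locales (auto simp: ring_hom_def)
  interpret H: ring_hom_cring "UP (Zp p)" "Zp p" "UnivPoly.eval (Zp p) (Zp p) (\<lambda>u. u) t"
    by (rule ring_hom_cringI[OF U.UP_cring cring_axioms pre.eval_ring_hom[OF t]])
  let ?h = "UnivPoly.eval (Zp p) (Zp p) (\<lambda>u. u) t"
  have "(\<lambda>k. up_ring.monom (UP (Zp p)) (c k) k) \<in> A \<rightarrow> carrier (UP (Zp p))"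
    by (intro funcsetI U.monom_closed c)
  hence "?h (\<Oplus>\<^bsub>UP (Zp p)\<^esub> k \<in> A. up_ring.monom (UP (Zp p)) (c k) k) = 
    finsum (Zp p) (?h \<circ> (\<lambda>k. up_ring.monom (UP (Zp p)) (c k) k)) A"
    by (rule H.hom_finsum)
  also have "\<dots> = (\<Oplus>\<^bsub>Zp p\<^esub> k \<in> A. c k \<otimes>\<^bsub>Zp p\<^esub> t [^]\<^bsub>Zp p\<^esub> k)"
  proof (rule finsum_cong'[OF refl])
    show "(\<lambda>k. c k \<otimes>\<^bsub>Zp p\<^esub> t [^]\<^bsub>Zp p\<^esub> k) \<in> A \<rightarrow> carrier (Zp p)"
      using c t by (intro funcsetI m_closed nat_pow_closed) auto
    fix k assume "k \<in> A"
    thus "(?h \<circ> (\<lambda>k. up_ring.monom (UP (Zp p)) (c k) k)) k = c k \<otimes>\<^bsub>Zp p\<^esub> t [^]\<^bsub>Zp p\<^esub> k"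
      unfolding comp_def by (rule pre.eval_monom[OF c t])
  qed
  finally show ?thesis .
qed

lemma eval_finsum_monom_0_cong:
  assumes "finite A" and c: "\<And>k. k \<in> A \<Longrightarrow> c k \<in> carrier (Zp p)" and t: "t \<in> carrier (Zp p)"
  shows "[UnivPoly.eval (Zp p) (Zp p) (\<lambda>u. u) t (\<Oplus>\<^bsub>UP (Zp p)\<^esub> k \<in> A. up_ring.monom (UP (Zp p)) (c k) k) 0 =
    (\<Sum>k\<in>A. c k 0 * t 0 ^ k)] (mod int p)"
proof -
  have "[finsum (Zp p) (\<lambda>k. c k \<otimes>\<^bsub>Zp p\<^esub> t [^]\<^bsub>Zp p\<^esub> k) A 0 = (\<Sum>k\<in>A. (c k \<otimes>\<^bsub>Zp p\<^esub> t [^]\<^bsub>Zp p\<^esub> k) 0)] (mod int p)"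
    using assms by (intro finsum_0_cong) auto
  also have "[(\<Sum>k\<in>A. (c k \<otimes>\<^bsub>Zp p\<^esub> t [^]\<^bsub>Zp p\<^esub> k) 0) = (\<Sum>k\<in>A. c k 0 * t 0 ^ k)] (mod int p)"
    by (rule cong_sum, rule cong_trans[OF mult_0_cong], rule cong_mult[OF cong_refl pow_0_cong[OF t]])
  finally show ?thesis by (simp only: eval_finsum_monom[of A c t, OF assms])
qed

end

section \<open>The Galois group and its characters\<close>

lemma minv_complex: "x \<noteq> 0 \<Longrightarrow> inv\<^bsub>(ring_of_type_algebra :: complex ring)\<^esub> x = inverse x"
proof -
  assume x: "x \<noteq> 0"
  interpret cring "ring_of_type_algebra :: complex ring" by (rule cring_from_type_algebra)
  show ?thesis using x by (intro comm_inv_char) (auto simp: ring_of_type_algebra_def)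
qed

lemma ainv_complex: "\<ominus>\<^bsub>(ring_of_type_algebra :: complex ring)\<^esub> x = - x"
proof -
  interpret cring "ring_of_type_algebra :: complex ring" by (rule cring_from_type_algebra)
  show ?thesis by (intro minus_equality) (auto simp: ring_of_type_algebra_def)
qed

lemma ring_of_type_algebra_ops:
  "x \<otimes>\<^bsub>ring_of_type_algebra\<^esub> y = x * y" "x \<oplus>\<^bsub>ring_of_type_algebra\<^esub> y = x + y"
  "\<one>\<^bsub>ring_of_type_algebra\<^esub> = 1" "\<zero>\<^bsub>ring_of_type_algebra\<^esub> = 0"
  by (simp_all add: ring_of_type_algebra_def)

context prime_cyclotomic
begin

sublocale zp: Zp_ring p
  by unfold_locales (rule p)+

text \<open>An explicit form of Q(zeta) as quotients of elements of Z[zeta]; with it, maps on the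
  field can be defined by substituting zeta^k in numerator and denominator.\<close>

definition cyc_field :: "complex set" where
  "cyc_field = {ev f \<zeta> / ev g \<zeta> | f g. ev g \<zeta> \<noteq> 0}"

lemma cycKI: "ev g \<zeta> \<noteq> 0 \<Longrightarrow> ev f \<zeta> / ev g \<zeta> \<in> cyc_field"
  unfolding cyc_field_def by blast

lemma cycKE:
  assumes "z \<in> cyc_field" obtains f g where "z = ev f \<zeta> / ev g \<zeta>" "ev g \<zeta> \<noteq> 0"
  using assms unfolding cyc_field_def by blast

lemma carrier_Q_adjoin: "carrier (Q_adjoin \<zeta>) = cyc_field"
proof -
  let ?F = "generate_field (ring_of_type_algebra :: complex ring) {\<zeta>}"
  have "z \<in> cyc_field" if "z \<in> ?F" for z
    using that
  proof (induction rule: generate_field.induct)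
    case one
    have "ev 1 \<zeta> / ev 1 \<zeta> \<in> cyc_field" by (rule cycKI) simp
    thus ?case by (simp add: ring_of_type_algebra_ops)
  next
    case (incl h)
    have "ev [:0,1:] \<zeta> / ev 1 \<zeta> \<in> cyc_field" by (rule cycKI) simp
    thus ?case using incl by simp
  next
    case (a_inv h)
    then obtain f g where h: "h = ev f \<zeta> / ev g \<zeta>" "ev g \<zeta> \<noteq> 0" by (elim cycKE)
    have "ev (- f) \<zeta> / ev g \<zeta> \<in> cyc_field" by (rule cycKI) (rule h)
    thus ?case by (simp add: ainv_complex h)
  next
    case (m_inv h)
    then obtain f g where h: "h = ev f \<zeta> / ev g \<zeta>" "ev g \<zeta> \<noteq> 0" by (elim cycKE)
    have h0: "h \<noteq> 0" using m_inv by (simp add: ring_of_type_algebra_ops)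
    hence "ev g \<zeta> / ev f \<zeta> \<in> cyc_field" using h by (intro cycKI) auto
    thus ?case unfolding minv_complex[OF h0] unfolding h(1) by simp
  next
    case (eng_add h1 h2)
    then obtain f g f' g' where h: "h1 = ev f \<zeta> / ev g \<zeta>" "ev g \<zeta> \<noteq> 0" "h2 = ev f' \<zeta> / ev g' \<zeta>" "ev g' \<zeta> \<noteq> 0" 
      by (elim cycKE)
    have "ev (f * g' + f' * g) \<zeta> / ev (g * g') \<zeta> \<in> cyc_field" using h by (intro cycKI) simp
    thus ?case using h by (simp add: ring_of_type_algebra_ops add_frac_eq)
  next
    case (eng_mult h1 h2)
    then obtain f g f' g' where h: "h1 = ev f \<zeta> / ev g \<zeta>" "ev g \<zeta> \<noteq> 0" "h2 = ev f' \<zeta> / ev g' \<zeta>" "ev g' \<zeta> \<noteq> 0" 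
      by (elim cycKE)
    have "ev (f * f') \<zeta> / ev (g * g') \<zeta> \<in> cyc_field" using h by (intro cycKI) simp
    thus ?case using h by (simp add: ring_of_type_algebra_ops)
  qed
  moreover have "z \<in> ?F" if "z \<in> cyc_field" for z
  proof -
    have one: "1 \<in> ?F" using generate_field.one[of "ring_of_type_algebra :: complex ring"] by (simp add: ring_of_type_algebra_ops)
    have minus: "- x \<in> ?F" if "x \<in> ?F" for x
      using generate_field.a_inv[OF that] by (simp add: ainv_complex)
    have add: "x + y \<in> ?F" if "x \<in> ?F" "y \<in> ?F" for x y
      using generate_field.eng_add[OF that] by (simp add: ring_of_type_algebra_ops)
    have mult: "x * y \<in> ?F" if "x \<in> ?F" "y \<in> ?F" for x y
      using generate_field.eng_mult[OF that] by (simp add: ring_of_type_algebra_ops)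
    have inv: "inverse x \<in> ?F" if "x \<in> ?F" "x \<noteq> 0" for x
      using generate_field.m_inv[OF that(1)] that(2) by (simp add: ring_of_type_algebra_ops minv_complex)
    have zeta: "\<zeta> \<in> ?F" by (rule generate_field.incl) simp
    have zero: "0 \<in> ?F" using add[OF one minus[OF one]] by simp
    have nat: "of_nat n \<in> ?F" for n by (induction n) (simp_all add: zero add one)
    have int: "of_int n \<in> ?F" for n
      by (cases n rule: int_cases2) (simp_all add: nat minus)
    have ev: "ev f \<zeta> \<in> ?F" for f
      by (induction f) (simp_all add: zero add mult int zeta)
    from \<open>z \<in> cyc_field\<close> obtain f g where z: "z = ev f \<zeta> / ev g \<zeta>" "ev g \<zeta> \<noteq> 0" by (rule cycKE)
    show ?thesis unfolding z(1) divide_inverse by (intro mult inv ev z(2))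
  qed
  ultimately show ?thesis by (auto simp: Q_adjoin_def)
qed

lemma Q_adjoin_ops: "x \<otimes>\<^bsub>Q_adjoin \<zeta>\<^esub> y = x * y" "x \<oplus>\<^bsub>Q_adjoin \<zeta>\<^esub> y = x + y" "\<one>\<^bsub>Q_adjoin \<zeta>\<^esub> = 1"
  by (simp_all add: Q_adjoin_def ring_of_type_algebra_ops)

lemma inverse_mod_p:
  assumes "\<not> p dvd k" shows "\<zeta> ^ (k * k ^ (p - 2)) = \<zeta>" "\<not> p dvd k ^ (p - 2)"
proof -
  have "k * k ^ (p - 2) = k ^ Suc (p - 2)" by simp
  also have "Suc (p - 2) = p - 1" using p by simp
  finally have "[k * k ^ (p - 2) = 1] (mod p)" using fermat_theorem[OF p(1) assms] by simp
  hence "\<zeta> ^ (k * k ^ (p - 2)) = \<zeta> ^ 1" by (simp only: zeta_pow_eq_iff)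
  thus "\<zeta> ^ (k * k ^ (p - 2)) = \<zeta>" by simp
  show "\<not> p dvd k ^ (p - 2)" using assms p prime_dvd_power by blast
qed

text \<open>Conjugating a vanishing value at zeta^k by the inverse of k modulo p would bring it back
  to a vanishing value at zeta.\<close>

lemma ev_conj_nz:
  assumes k: "\<not> p dvd k" and g: "ev g \<zeta> \<noteq> 0" shows "ev g (\<zeta> ^ k) \<noteq> 0"
proof
  assume "ev g (\<zeta> ^ k) = 0"
  hence "ev (pcompose g (monom 1 k)) \<zeta> = 0" by simp
  from ev_conj_0[OF this inverse_mod_p(2)[OF k]] have "ev g (\<zeta> ^ (k * k ^ (p - 2))) = 0"
    by (simp add: mult.commute flip: power_mult)
  thus False using g inverse_mod_p(1)[OF k] by simp
qed

text \<open>The description is over all ways to write z as a fraction. Uniqueness of w, for k prime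
  to p, rests on the irreducibility of \<open>Cyc\<close>. The restriction to the field matches the
  extensional functions in \<open>gal\<close>.\<close>

definition gal_aut :: "nat \<Rightarrow> complex \<Rightarrow> complex" where
  "gal_aut k = (\<lambda>z\<in>cyc_field. THE w. \<exists>f g. ev g \<zeta> \<noteq> 0 \<and> z = ev f \<zeta> / ev g \<zeta> \<and> w = ev f (\<zeta> ^ k) / ev g (\<zeta> ^ k))"

lemma gal_aut_eval:
  assumes k: "\<not> p dvd k" and g: "ev g \<zeta> \<noteq> 0"
  shows "gal_aut k (ev f \<zeta> / ev g \<zeta>) = ev f (\<zeta> ^ k) / ev g (\<zeta> ^ k)"
proof -
  have "(THE w. \<exists>f' g'. ev g' \<zeta> \<noteq> 0 \<and> ev f \<zeta> / ev g \<zeta> = ev f' \<zeta> / ev g' \<zeta> \<and> w = ev f' (\<zeta> ^ k) / ev g' (\<zeta> ^ k)) = ev f (\<zeta> ^ k) / ev g (\<zeta> ^ k)"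
  proof (rule the_equality)
    show "\<exists>f' g'. ev g' \<zeta> \<noteq> 0 \<and> ev f \<zeta> / ev g \<zeta> = ev f' \<zeta> / ev g' \<zeta> \<and> ev f (\<zeta> ^ k) / ev g (\<zeta> ^ k) = ev f' (\<zeta> ^ k) / ev g' (\<zeta> ^ k)"
      using g by blast
  next
    fix w assume "\<exists>f' g'. ev g' \<zeta> \<noteq> 0 \<and> ev f \<zeta> / ev g \<zeta> = ev f' \<zeta> / ev g' \<zeta> \<and> w = ev f' (\<zeta> ^ k) / ev g' (\<zeta> ^ k)"
    then obtain f' g' where h: "ev g' \<zeta> \<noteq> 0" "ev f \<zeta> / ev g \<zeta> = ev f' \<zeta> / ev g' \<zeta>" 
      and w: "w = ev f' (\<zeta> ^ k) / ev g' (\<zeta> ^ k)" by blast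
    have "ev (f * g') \<zeta> = ev (f' * g) \<zeta>" using h g by (simp add: frac_eq_eq)
    hence "ev (f * g') (\<zeta> ^ k) = ev (f' * g) (\<zeta> ^ k)" by (rule ev_conj_eq[OF _ k])
    thus "w = ev f (\<zeta> ^ k) / ev g (\<zeta> ^ k)"
      using ev_conj_nz[OF k g] ev_conj_nz[OF k h(1)] by (simp add: w frac_eq_eq)
  qed
  thus ?thesis unfolding gal_aut_def using cycKI[OF g] by simp
qed

lemma gal_aut_ev: "\<not> p dvd k \<Longrightarrow> gal_aut k (ev f \<zeta>) = ev f (\<zeta> ^ k)"
  using gal_aut_eval[of k 1 f] by simp

lemma gal_aut_zeta: "\<not> p dvd k \<Longrightarrow> gal_aut k \<zeta> = \<zeta> ^ k"
  using gal_aut_ev[of k "[:0,1:]"] by simp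

lemma zeta_in: "\<zeta> \<in> cyc_field"
  using cycKI[of 1 "[:0,1:]"] by simp

lemma ev_in: "ev f \<zeta> \<in> cyc_field"
  using cycKI[of 1 f] by simp

lemma gal_aut_conj:
  assumes k: "\<not> p dvd k" and g: "ev g \<zeta> \<noteq> 0"
  shows "gal_aut k (ev f \<zeta> / ev g \<zeta>) = ev (pcompose f (monom 1 k)) \<zeta> / ev (pcompose g (monom 1 k)) \<zeta>"
    and "ev (pcompose g (monom 1 k)) \<zeta> \<noteq> 0"
  using gal_aut_eval[OF assms] ev_conj_nz[OF assms] by simp_all

lemma gal_aut_closed: "\<not> p dvd k \<Longrightarrow> z \<in> cyc_field \<Longrightarrow> gal_aut k z \<in> cyc_field"
  by (elim cycKE) (metis gal_aut_conj cycKI)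

lemma gal_aut_comp:
  assumes k: "\<not> p dvd k" and l: "\<not> p dvd l" and z: "z \<in> cyc_field"
  shows "gal_aut k (gal_aut l z) = gal_aut (k * l) z"
proof -
  from z obtain f g where h: "z = ev f \<zeta> / ev g \<zeta>" "ev g \<zeta> \<noteq> 0" by (rule cycKE)
  have kl: "\<not> p dvd k * l" using k l p prime_dvd_mult_iff by blast
  have "gal_aut k (gal_aut l z) = ev (pcompose f (monom 1 l)) (\<zeta> ^ k) / ev (pcompose g (monom 1 l)) (\<zeta> ^ k)"
    unfolding h(1) gal_aut_conj(1)[OF l h(2)] by (rule gal_aut_eval[OF k gal_aut_conj(2)[OF l h(2)]])
  also have "\<dots> = gal_aut (k * l) z" unfolding h(1) gal_aut_eval[OF kl h(2)] by (simp flip: power_mult)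
  finally show ?thesis .
qed

lemma gal_aut_cong: "\<zeta> ^ k = \<zeta> ^ l \<Longrightarrow> gal_aut k = gal_aut l"
  by (simp add: gal_aut_def)

lemma gal_aut_1: "z \<in> cyc_field \<Longrightarrow> gal_aut 1 z = z"
  using p by (elim cycKE) (simp add: gal_aut_eval)

lemma gal_aut_add:
  assumes k: "\<not> p dvd k" and "z \<in> cyc_field" "w \<in> cyc_field"
  shows "gal_aut k (z + w) = gal_aut k z + gal_aut k w"
proof -
  obtain f g f' g' where h: "z = ev f \<zeta> / ev g \<zeta>" "ev g \<zeta> \<noteq> 0" "w = ev f' \<zeta> / ev g' \<zeta>" "ev g' \<zeta> \<noteq> 0" 
    using assms(2,3) by (elim cycKE)
  have zw: "z + w = ev (f * g' + f' * g) \<zeta> / ev (g * g') \<zeta>" using h by (simp add: add_frac_eq)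
  have nz: "ev (g * g') \<zeta> \<noteq> 0" using h by simp
  have "gal_aut k (z + w) = ev (f * g' + f' * g) (\<zeta> ^ k) / ev (g * g') (\<zeta> ^ k)"
    unfolding zw by (rule gal_aut_eval[OF k nz])
  also have "\<dots> = gal_aut k z + gal_aut k w"
    using ev_conj_nz[OF k h(2)] ev_conj_nz[OF k h(4)] unfolding h(1,3) gal_aut_eval[OF k h(2)] gal_aut_eval[OF k h(4)]
    by (simp add: add_frac_eq)
  finally show ?thesis .
qed

lemma gal_aut_mult:
  assumes k: "\<not> p dvd k" and "z \<in> cyc_field" "w \<in> cyc_field"
  shows "gal_aut k (z * w) = gal_aut k z * gal_aut k w"
proof -
  obtain f g f' g' where h: "z = ev f \<zeta> / ev g \<zeta>" "ev g \<zeta> \<noteq> 0" "w = ev f' \<zeta> / ev g' \<zeta>" "ev g' \<zeta> \<noteq> 0" 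
    using assms(2,3) by (elim cycKE)
  have zw: "z * w = ev (f * f') \<zeta> / ev (g * g') \<zeta>" using h by simp
  have nz: "ev (g * g') \<zeta> \<noteq> 0" using h by simp
  have "gal_aut k (z * w) = ev (f * f') (\<zeta> ^ k) / ev (g * g') (\<zeta> ^ k)"
    unfolding zw by (rule gal_aut_eval[OF k nz])
  also have "\<dots> = gal_aut k z * gal_aut k w"
    unfolding h(1,3) gal_aut_eval[OF k h(2)] gal_aut_eval[OF k h(4)] by simp
  finally show ?thesis .
qed

lemma gal_aut_rat:
  assumes k: "\<not> p dvd k" and q: "q \<in> \<rat>" shows "gal_aut k q = q"
proof -
  obtain r where r: "q = of_rat r" using q by (rule Rats_cases)
  obtain a b where "r = Rat.Fract a b" "b > 0" by (cases r)
  hence "q = ev (of_int a) \<zeta> / ev (of_int b) \<zeta>" "ev (of_int b) \<zeta> \<noteq> 0" by (simp_all add: r of_rat_rat)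
  thus ?thesis using gal_aut_eval[OF k, of "of_int b" "of_int a"] by simp
qed

lemma gal_aut_bij:
  assumes k: "\<not> p dvd k" shows "bij_betw (gal_aut k) cyc_field cyc_field"
proof (rule bij_betwI[where g = "gal_aut (k ^ (p - 2))"])
  note k' = inverse_mod_p[OF k]
  show "gal_aut k \<in> cyc_field \<rightarrow> cyc_field" "gal_aut (k ^ (p - 2)) \<in> cyc_field \<rightarrow> cyc_field"
    using gal_aut_closed k k' by blast+
  have "gal_aut (k * k ^ (p - 2)) = gal_aut 1" "gal_aut (k ^ (p - 2) * k) = gal_aut 1"
    by (rule gal_aut_cong, use k'(1) in \<open>simp add: mult.commute\<close>)+
  note e = this
  fix z assume z: "z \<in> cyc_field"
  show "gal_aut (k ^ (p - 2)) (gal_aut k z) = z" unfolding gal_aut_comp[OF k'(2) k z] e using z by (rule gal_aut_1)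
  show "gal_aut k (gal_aut (k ^ (p - 2)) z) = z" unfolding gal_aut_comp[OF k k'(2) z] e using z by (rule gal_aut_1)
qed

lemma gal_aut_Bij: "\<not> p dvd k \<Longrightarrow> gal_aut k \<in> Bij cyc_field"
  using gal_aut_bij by (simp add: Bij_def gal_aut_def)

lemma gal_carrier_iff: "\<sigma> \<in> carrier (gal \<zeta>) \<longleftrightarrow> 
    \<sigma> \<in> Bij cyc_field \<and> \<sigma> \<in> ring_iso (Q_adjoin \<zeta>) (Q_adjoin \<zeta>) \<and> (\<forall>q\<in>\<rat>. \<sigma> q = q)"
  by (simp add: gal_def carrier_Q_adjoin)

lemma gal_aut_in_gal: "\<not> p dvd k \<Longrightarrow> gal_aut k \<in> carrier (gal \<zeta>)"
  unfolding gal_carrier_iff ring_iso_def ring_hom_def carrier_Q_adjoin Q_adjoin_ops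
  using gal_aut_Bij gal_aut_bij gal_aut_closed gal_aut_add gal_aut_mult gal_aut_rat[of k 1] gal_aut_rat by auto

lemma gal_eq_gal_aut:
  assumes s: "\<sigma> \<in> carrier (gal \<zeta>)" and z: "\<sigma> \<zeta> = \<zeta> ^ k" and k: "\<not> p dvd k"
  shows "\<sigma> = gal_aut k"
proof (rule extensionalityI[where A = cyc_field])
  have h: "\<sigma> (x * y) = \<sigma> x * \<sigma> y" "\<sigma> (x + y) = \<sigma> x + \<sigma> y" if "x \<in> cyc_field" "y \<in> cyc_field" for x y
    using s that unfolding gal_carrier_iff ring_iso_def ring_hom_def carrier_Q_adjoin Q_adjoin_ops by auto
  show "\<sigma> \<in> extensional cyc_field" using s by (simp add: gal_carrier_iff Bij_def)
  show "gal_aut k \<in> extensional cyc_field" by (simp add: gal_aut_def)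
  have int: "\<sigma> (of_int n) = of_int n" for n using s by (simp add: gal_carrier_iff)
  have int_in: "of_int n \<in> cyc_field" for n using ev_in[of "of_int n"] by simp
  have ev: "\<sigma> (ev f \<zeta>) = ev f (\<zeta> ^ k)" for f
  proof (induction f)
    case 0
    show ?case using int[of 0] by simp
  next
    case (pCons a f)
    have "ev [:0,1:] \<zeta> * ev f \<zeta> = ev ([:0,1:] * f) \<zeta>" by simp
    hence "\<zeta> * ev f \<zeta> \<in> cyc_field" using ev_in[of "[:0,1:] * f"] by simp
    thus ?case using pCons by (simp add: h int int_in zeta_in ev_in z)
  qed
  fix x assume "x \<in> cyc_field"
  then obtain f g where x: "x = ev f \<zeta> / ev g \<zeta>" "ev g \<zeta> \<noteq> 0" by (rule cycKE)
  have "\<sigma> (x * ev g \<zeta>) = \<sigma> x * \<sigma> (ev g \<zeta>)" using x by (intro h cycKI ev_in) (simp add: cycKI)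
  hence "ev f (\<zeta> ^ k) = \<sigma> x * ev g (\<zeta> ^ k)" using x by (simp add: ev)
  thus "\<sigma> x = gal_aut k x" unfolding x(1) gal_aut_eval[OF k x(2)] using ev_conj_nz[OF k x(2)]
    by (simp add: field_simps)
qed

text \<open>An automorphism sends zeta to a root of X^p - 1, hence to a power of zeta, and not to 1
  by injectivity; the image of zeta determines it.\<close>

lemma gal_carrier: "carrier (gal \<zeta>) = gal_aut ` {1..<p}"
proof -
  have "\<sigma> \<in> gal_aut ` {1..<p}" if s: "\<sigma> \<in> carrier (gal \<zeta>)" for \<sigma>
  proof -
    have h: "\<sigma> (x * y) = \<sigma> x * \<sigma> y" if "x \<in> cyc_field" "y \<in> cyc_field" for x y
      using s that unfolding gal_carrier_iff ring_iso_def ring_hom_def carrier_Q_adjoin Q_adjoin_ops by auto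
    have inj: "inj_on \<sigma> cyc_field" and one: "\<sigma> 1 = 1"
      using s by (auto simp: gal_carrier_iff Bij_def bij_betw_def)
    have pow_in: "\<zeta> ^ n \<in> cyc_field" for n using ev_in[of "monom 1 n"] by simp
    have "\<sigma> (\<zeta> ^ n) = \<sigma> \<zeta> ^ n" for n
      by (induction n) (simp_all add: one h zeta_in pow_in)
    from this[of p] have "(\<Prod>k<p. \<sigma> \<zeta> - \<zeta> ^ k) = 0" by (simp add: prod_zeta_all one)
    then obtain k where k: "k < p" "\<sigma> \<zeta> = \<zeta> ^ k" by (auto simp: prod_zero_iff)
    have "k \<noteq> 0"
    proof
      assume "k = 0"
      hence "\<sigma> \<zeta> = \<sigma> 1" using k one by simp
      hence "\<zeta> = 1" using inj zeta_in pow_in[of 0] by (auto dest: inj_onD)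
      thus False using zeta_pow_eq_1_iff[of 1] p by simp
    qed
    hence kr: "k \<in> {1..<p}" using k by auto
    from gal_eq_gal_aut[OF s k(2) not_dvd_of_range[OF kr]] kr show ?thesis by blast
  qed
  thus ?thesis using gal_aut_in_gal not_dvd_of_range by blast
qed

lemma gal_s_eq:
  assumes k: "\<not> p dvd k" and j: "[int k = j] (mod int p)"
  shows "gal_s \<zeta> j = gal_aut k"
proof -
  have e: "\<zeta> powi j = \<zeta> ^ k"
  proof -
    obtain c where c: "j = int k + int p * c" using j by (metis cong_iff_lin mult.commute)
    have "\<zeta> powi (int p * c) = 1" by (simp add: power_int_mult)
    thus ?thesis by (simp add: c power_int_add)
  qed
  show ?thesis unfolding gal_s_def e
  proof (rule the_equality)
    show "gal_aut k \<in> carrier (gal \<zeta>) \<and> gal_aut k \<zeta> = \<zeta> ^ k"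
      using gal_aut_in_gal[OF k] gal_aut_zeta[OF k] by blast
    show "\<sigma> = gal_aut k" if "\<sigma> \<in> carrier (gal \<zeta>) \<and> \<sigma> \<zeta> = \<zeta> ^ k" for \<sigma>
      using that gal_eq_gal_aut[OF _ _ k] by blast
  qed
qed

lemma gal_s_nat: "k \<in> {1..<p} \<Longrightarrow> gal_s \<zeta> (int k) = gal_aut k"
  by (rule gal_s_eq) (use not_dvd_of_range in auto)

lemma gal_s_minus_1: "gal_s \<zeta> (- 1) = gal_aut (p - 1)"
proof (rule gal_s_eq)
  show "\<not> p dvd p - 1" using p by (auto dest!: dvd_imp_le)
  show "[int (p - 1) = - 1] (mod int p)" using p by (simp add: of_nat_diff cong_iff_dvd_diff)
qed

lemma gal_mult: "\<not> p dvd k \<Longrightarrow> \<not> p dvd l \<Longrightarrow> gal_aut k \<otimes>\<^bsub>gal \<zeta>\<^esub> gal_aut l = gal_aut (k * l)"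
proof -
  assume k: "\<not> p dvd k" and l: "\<not> p dvd l"
  have "gal_aut k \<otimes>\<^bsub>gal \<zeta>\<^esub> gal_aut l = compose cyc_field (gal_aut k) (gal_aut l)"
    using gal_aut_Bij[OF k] gal_aut_Bij[OF l] by (simp add: gal_def BijGroup_def carrier_Q_adjoin)
  also have "\<dots> = gal_aut (k * l)"
    by (rule extensionalityI[where A = cyc_field]) (auto simp: compose_def gal_aut_comp[OF k l], simp add: gal_aut_def)
  finally show ?thesis .
qed

lemma gal_aut_inj: "inj_on gal_aut {1..<p}"
proof (rule inj_onI)
  fix k l assume kl: "k \<in> {1..<p}" "l \<in> {1..<p}" "gal_aut k = gal_aut l"
  hence "\<zeta> ^ k = \<zeta> ^ l" using gal_aut_zeta not_dvd_of_range by metis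
  thus "k = l" using kl by (simp add: zeta_pow_eq_iff cong_def)
qed

lemma omega_gal_aut:
  assumes k: "k \<in> {1..<p}" shows "omega_char p \<zeta> (gal_aut k) = teichmuller p (int k)"
proof -
  have "(THE j. j \<in> {1..int p - 1} \<and> gal_aut k = gal_s \<zeta> j) = int k"
  proof (rule the_equality)
    show "int k \<in> {1..int p - 1} \<and> gal_aut k = gal_s \<zeta> (int k)" using k gal_s_nat[OF k] by auto
    fix j assume j: "j \<in> {1..int p - 1} \<and> gal_aut k = gal_s \<zeta> j"
    hence jn: "nat j \<in> {1..<p}" "int (nat j) = j" by auto
    hence "gal_aut (nat j) = gal_aut k" using gal_s_nat[OF jn(1)] j by simp
    thus "j = int k" using inj_onD[OF gal_aut_inj] jn k by metis
  qed
  thus ?thesis unfolding omega_char_def using gal_aut_in_gal not_dvd_of_range[OF k] by simp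
qed

end

locale padic_character = prime_cyclotomic +
  fixes \<chi> :: "(complex \<Rightarrow> complex) \<Rightarrow> nat \<Rightarrow> int"
  assumes chi: "\<chi> \<in> padic_chars p \<zeta>"
begin

lemma chi_unit: "\<not> p dvd k \<Longrightarrow> \<chi> (gal_aut k) \<in> Units (Zp p)"
  using chi gal_aut_in_gal by (auto simp: padic_chars_def hom_def units_of_carrier)

lemma chi_closed: "\<not> p dvd k \<Longrightarrow> \<chi> (gal_aut k) \<in> carrier (Zp p)"
  using chi_unit zp.Units_closed by blast

lemma chi_mult:
  assumes "\<not> p dvd k" "\<not> p dvd l" shows "\<chi> (gal_aut (k * l)) = \<chi> (gal_aut k) \<otimes>\<^bsub>Zp p\<^esub> \<chi> (gal_aut l)"
proof -
  have "\<chi> (gal_aut k \<otimes>\<^bsub>gal \<zeta>\<^esub> gal_aut l) = \<chi> (gal_aut k) \<otimes>\<^bsub>units_of (Zp p)\<^esub> \<chi> (gal_aut l)"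
    using chi assms gal_aut_in_gal by (auto simp: padic_chars_def hom_def)
  thus ?thesis using assms by (simp add: gal_mult units_of_mult)
qed

lemma chi_1: "\<chi> (gal_aut 1) = \<one>\<^bsub>Zp p\<^esub>"
proof -
  have n1: "\<not> p dvd 1" using p by simp
  have "\<chi> (gal_aut 1) \<otimes>\<^bsub>Zp p\<^esub> \<chi> (gal_aut 1) = \<chi> (gal_aut 1) \<otimes>\<^bsub>Zp p\<^esub> \<one>\<^bsub>Zp p\<^esub>"
    using chi_mult[OF n1 n1] chi_closed[OF n1] by simp
  thus ?thesis using zp.Units_l_cancel[OF chi_unit[OF n1] chi_closed[OF n1] zp.one_closed] by blast
qed

lemma chi_pow:
  assumes "\<not> p dvd k" shows "\<chi> (gal_aut (k ^ i)) = \<chi> (gal_aut k) [^]\<^bsub>Zp p\<^esub> i"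
proof (induction i)
  case (Suc i)
  have "\<not> p dvd k ^ i" using assms p prime_dvd_power by blast
  thus ?case using Suc chi_mult[of "k ^ i" k] assms by (simp add: mult.commute)
qed (use chi_1 in simp)

lemma chi_torsion:
  assumes "\<not> p dvd k" shows "\<chi> (gal_aut k) [^]\<^bsub>Zp p\<^esub> (p - 1) = \<one>\<^bsub>Zp p\<^esub>"
proof -
  have "\<zeta> ^ (k ^ (p - 1)) = \<zeta> ^ 1"
    unfolding zeta_pow_eq_iff using fermat_theorem[OF p(1) assms] .
  hence "gal_aut (k ^ (p - 1)) = gal_aut 1" by (rule gal_aut_cong)
  thus ?thesis using chi_pow[OF assms, of "p - 1"] chi_1 by simp
qed

text \<open>The nonzero residues form a cyclic group: if g is a primitive root and \<chi>(g) reduces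
  to g^m, multiplicativity forces the exponent m everywhere.\<close>

lemma chi_exponent: "\<exists>m<p-1. \<forall>k. \<not> p dvd k \<longrightarrow> [\<chi> (gal_aut k) 0 = int k ^ m] (mod int p)"
proof -
  obtain g where g: "residue_primroot p g"
    using prime_primitive_root_exists[of p] p prime_gt_1_nat by blast
  have gen: "bij_betw (\<lambda>i. g ^ i mod p) {..<p - 1} (totatives p)"
    using residue_primroot_is_generator[OF _ g] p by (simp add: totient_prime)
  have tot: "k mod p \<in> totatives p" if "\<not> p dvd k" for k
    using that p prime_imp_coprime[OF p(1) that]
    by (auto simp: totatives_def mod_greater_zero_iff_not_dvd coprime_commute less_imp_le)
  have log: "\<exists>i<p-1. [k = g ^ i] (mod p)" if "\<not> p dvd k" for k
  proof -
    have "k mod p \<in> (\<lambda>i. g ^ i mod p) ` {..<p - 1}"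
      using tot[OF that] gen by (simp add: bij_betw_def)
    thus ?thesis by (auto simp: cong_def)
  qed
  have ng: "\<not> p dvd g" using g p by (metis coprime_absorb_right coprime_commute not_prime_unit residue_primroot_def)
  define a where "a = nat (\<chi> (gal_aut g) 0)"
  have a: "int a = \<chi> (gal_aut g) 0" using chi_closed[OF ng] by (simp add: a_def Zp_carrier_iff)
  have "\<not> int p dvd int a" unfolding a by (rule zp.unit_nth_0[OF chi_unit[OF ng]])
  hence "\<not> p dvd a" by simp
  then obtain m where m: "m < p - 1" "[a = g ^ m] (mod p)" using log by blast
  have "[\<chi> (gal_aut k) 0 = int k ^ m] (mod int p)" if k: "\<not> p dvd k" for k
  proof -
    obtain i where i: "[k = g ^ i] (mod p)" using log[OF k] by blast
    hence "gal_aut k = gal_aut (g ^ i)" by (intro gal_aut_cong) (simp add: zeta_pow_eq_iff)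
    hence "\<chi> (gal_aut k) 0 = (\<chi> (gal_aut g) [^]\<^bsub>Zp p\<^esub> i) 0" by (simp add: chi_pow[OF ng])
    also have "[\<dots> = int a ^ i] (mod int p)" unfolding a by (rule zp.pow_0_cong[OF chi_closed[OF ng]])
    also have "[int a ^ i = int (g ^ m) ^ i] (mod int p)" 
      using m(2) by (intro cong_pow) (simp add: cong_int_iff del: of_nat_power)
    also have "int (g ^ m) ^ i = int (g ^ i) ^ m" by (simp add: mult.commute flip: power_mult)
    also have "[int (g ^ i) ^ m = int k ^ m] (mod int p)"
      using i by (intro cong_pow) (simp add: cong_int_iff cong_sym_eq del: of_nat_power)
    finally show ?thesis .
  qed
  thus ?thesis using m(1) by blast
qed


text \<open>The inverse of k^e is k^(p-1-e) modulo p. Since \<phi>_n carries the exponent n - 1, the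
  index is p - e.\<close>

lemma mirimanoff_at_cong:
  assumes u: "\<And>k. k \<in> {1..<p} \<Longrightarrow> \<phi> (gal_aut k) \<in> Units (Zp p)"
    and e: "\<And>k. k \<in> {1..<p} \<Longrightarrow> [\<phi> (gal_aut k) 0 = int k ^ e] (mod int p)" and "e \<le> p - 1"
    and t: "t \<in> carrier (Zp p)"
  shows "mirimanoff_at p \<zeta> \<phi> t \<in> carrier (Zp p)"
    and "[mirimanoff_at p \<zeta> \<phi> t 0 = mirimanoff_sum p (t 0) (p - e)] (mod int p)"
proof -
  have r: "{1..p - 1} = {1..<p}" using p by auto
  have inv: "inv\<^bsub>Zp p\<^esub> (\<phi> (gal_s \<zeta> (int k))) \<in> carrier (Zp p)" if "k \<in> {1..<p}" for k
    using u[OF that] gal_s_nat[OF that] by simp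
  show "mirimanoff_at p \<zeta> \<phi> t \<in> carrier (Zp p)"
    unfolding mirimanoff_at_def mirimanoff_def r
    by (subst zp.eval_finsum_monom) (use inv t in \<open>auto intro!: zp.finsum_closed\<close>)
  have "[mirimanoff_at p \<zeta> \<phi> t 0 = (\<Sum>k\<in>{1..<p}. (inv\<^bsub>Zp p\<^esub> (\<phi> (gal_s \<zeta> (int k)))) 0 * t 0 ^ k)] (mod int p)"
    unfolding mirimanoff_at_def mirimanoff_def r
    by (rule zp.eval_finsum_monom_0_cong) (use inv t in auto)
  also have "[(\<Sum>k\<in>{1..<p}. (inv\<^bsub>Zp p\<^esub> (\<phi> (gal_s \<zeta> (int k)))) 0 * t 0 ^ k) = (\<Sum>k\<in>{1..<p}. int k ^ (p - 1 - e) * t 0 ^ k)] (mod int p)"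
  proof (rule cong_sum, rule cong_mult[OF _ cong_refl])
    fix k assume k: "k \<in> {1..<p}"
    define v where "v = (inv\<^bsub>Zp p\<^esub> (\<phi> (gal_aut k))) 0"
    have nd: "\<not> int p dvd int k" using not_dvd_of_range[OF k] by simp
    have "[\<phi> (gal_aut k) 0 * v = 1] (mod int p)" unfolding v_def by (rule zp.unit_inv_0_cong[OF u[OF k]])
    moreover have "[\<phi> (gal_aut k) 0 * v = int k ^ e * v] (mod int p)" by (intro cong_mult e k cong_refl)
    ultimately have 1: "[int k ^ e * v = 1] (mod int p)" using cong_sym cong_trans by blast
    have "[v = v * int k ^ (p - 1)] (mod int p)"
      using cong_mult[OF cong_refl[of v] fermat_int[OF p(1) nd]] by (simp add: cong_sym)
    also have "v * int k ^ (p - 1) = (int k ^ e * v) * int k ^ (p - 1 - e)"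
    proof -
      have "int k ^ (p - 1) = int k ^ e * int k ^ (p - 1 - e)"
        using \<open>e \<le> p - 1\<close> by (metis le_add_diff_inverse power_add)
      thus ?thesis by (simp only: mult_ac)
    qed
    also have "[\<dots> = 1 * int k ^ (p - 1 - e)] (mod int p)" by (intro cong_mult 1 cong_refl)
    finally show "[(inv\<^bsub>Zp p\<^esub> (\<phi> (gal_s \<zeta> (int k)))) 0 = int k ^ (p - 1 - e)] (mod int p)"
      by (simp add: v_def gal_s_nat[OF k])
  qed
  finally show "[mirimanoff_at p \<zeta> \<phi> t 0 = mirimanoff_sum p (t 0) (p - e)] (mod int p)"
    by (simp add: mirimanoff_sum_def diff_commute)
qed

end

theorem theorem3p9:
  fixes p :: nat and \<zeta> :: complex and a b c :: int
    and \<chi> :: "(complex \<Rightarrow> complex) \<Rightarrow> nat \<Rightarrow> int"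
  assumes "prime p" and "p > 2"
    and "primitive_root_of_unity p \<zeta>"
    and "a \<noteq> 0" and "b \<noteq> 0" and "c \<noteq> 0"
    and "coprime a b" and "coprime b c" and "coprime a c"
    and "a ^ p + b ^ p + c ^ p = 0"
    and "\<not> int p dvd a * b * c"
    and "\<chi> \<in> padic_chars p \<zeta>" and "\<chi> \<noteq> unit_char p \<zeta>" and "even_char p \<zeta> \<chi>"
  shows "odd_char p \<zeta> (dual_char p \<zeta> \<chi>) \<and> dual_char p \<zeta> \<chi> \<noteq> omega_char p \<zeta> \<and>
    (\<forall>(x, y) \<in> {(a, b), (b, a), (b, c), (c, b), (c, a), (a, c)}.
      let t = Zp_of_int p (- y) \<otimes>\<^bsub>Zp p\<^esub> inv\<^bsub>Zp p\<^esub> (Zp_of_int p x) in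
      Zp_cong p (mirimanoff_at p \<zeta> (dual_char p \<zeta> \<chi>) t \<otimes>\<^bsub>Zp p\<^esub> mirimanoff_at p \<zeta> \<chi> t)
        \<zero>\<^bsub>Zp p\<^esub>)"
proof -
  interpret padic_character p \<zeta> \<chi>
    using assms by unfold_locales
  have chi_ext: "\<chi> \<in> extensional (carrier (gal \<zeta>))" using chi by (simp add: padic_chars_def)
  have chi_nontriv: "\<exists>k\<in>{1..<p}. \<chi> (gal_aut k) \<noteq> \<one>\<^bsub>Zp p\<^esub>"
  proof (rule ccontr)
    assume "\<not> ?thesis"
    hence "\<chi> = unit_char p \<zeta>"
      by (intro extensionalityI[OF chi_ext]) (auto simp: unit_char_def gal_carrier)
    thus False using assms by simp
  qed
  obtain m where m: "m < p - 1" "\<And>k. \<not> p dvd k \<Longrightarrow> [\<chi> (gal_aut k) 0 = int k ^ m] (mod int p)"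
    using chi_exponent by blast
  have np1: "\<not> p dvd p - 1" "p - 1 \<in> {1..<p}" using assms(2) by (auto dest!: dvd_imp_le)
  have chi_m1: "\<chi> (gal_aut (p - 1)) = \<one>\<^bsub>Zp p\<^esub>"
    using assms(14) by (simp add: even_char_def gal_s_minus_1)
  have "m \<noteq> 0"
  proof
    assume "m = 0"
    obtain k where k: "k \<in> {1..<p}" "\<chi> (gal_aut k) \<noteq> \<one>\<^bsub>Zp p\<^esub>" using chi_nontriv by blast
    note nk = not_dvd_of_range[OF k(1)]
    \<comment> \<open>With exponent 0 all values of \<chi> are 1 modulo p, and a (p-1)-th root of
      unity with residue 1 equals 1.\<close>
    have "\<chi> (gal_aut k) = \<one>\<^bsub>Zp p\<^esub>"
      by (rule zp.torsion_eqI)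
        (use m(2)[OF nk] \<open>m = 0\<close> chi_closed[OF nk] chi_torsion[OF nk] in \<open>simp_all add: zp.one_nth\<close>)
    thus False using k by simp
  qed
  \<comment> \<open>Exponent 1 would give \<chi>(-1) = -1 modulo p, against evenness.\<close>
  moreover have "m \<noteq> 1"
  proof
    assume "m = 1"
    hence "[1 = int (p - 1)] (mod int p)" using m(2)[OF np1(1)] chi_m1 by (simp add: zp.one_nth)
    hence "[int 1 = int (p - 1)] (mod int p)" by simp
    hence "1 = p - 1" unfolding cong_int_iff using assms(2) by (simp add: cong_def)
    thus False using assms(2) by simp
  qed
  ultimately have mr: "m \<in> {2..p-2}" using m(1) by auto
  have dual: "dual_char p \<zeta> \<chi> (gal_aut k) = teichmuller p (int k) \<otimes>\<^bsub>Zp p\<^esub> inv\<^bsub>Zp p\<^esub> (\<chi> (gal_aut k))" if "k \<in> {1..<p}" for k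
    using that gal_aut_in_gal[OF not_dvd_of_range[OF that]] by (simp add: dual_char_def omega_gal_aut)
  have teich: "teichmuller p (int k) \<in> Units (Zp p)" "[teichmuller p (int k) 0 = int k] (mod int p)" if "k \<in> {1..<p}" for k
    by (rule zp.teichmuller, use not_dvd_of_range[OF that] in simp)+
  have odd: "odd_char p \<zeta> (dual_char p \<zeta> \<chi>)"
  proof -
    have "[- 1 = int (p - 1)] (mod int p)" using assms(2) by (simp add: of_nat_diff cong_iff_dvd_diff)
    note tm = zp.teichmuller_minus_1[OF this]
    show ?thesis
      unfolding odd_char_def gal_s_minus_1 dual[OF np1(2)] chi_m1 tm by simp
  qed
  have ne: "dual_char p \<zeta> \<chi> \<noteq> omega_char p \<zeta>"
  proof
    assume eq: "dual_char p \<zeta> \<chi> = omega_char p \<zeta>"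
    obtain k where k: "k \<in> {1..<p}" "\<chi> (gal_aut k) \<noteq> \<one>\<^bsub>Zp p\<^esub>" using chi_nontriv by blast
    define T where "T = teichmuller p (int k)"
    have T: "T \<in> Units (Zp p)" using teich[OF k(1)] by (simp add: T_def)
    have cu: "\<chi> (gal_aut k) \<in> Units (Zp p)" using chi_unit not_dvd_of_range[OF k(1)] by blast
    have "T \<otimes>\<^bsub>Zp p\<^esub> inv\<^bsub>Zp p\<^esub> (\<chi> (gal_aut k)) = T \<otimes>\<^bsub>Zp p\<^esub> \<one>\<^bsub>Zp p\<^esub>"
      using dual[OF k(1)] omega_gal_aut[OF k(1)] eq zp.Units_closed[OF T, unfolded T_def] by (simp add: T_def)
    hence "inv\<^bsub>Zp p\<^esub> (\<chi> (gal_aut k)) = \<one>\<^bsub>Zp p\<^esub>"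
      using zp.Units_l_cancel[OF T zp.Units_inv_closed[OF cu] zp.one_closed] by blast
    hence "\<chi> (gal_aut k) = \<one>\<^bsub>Zp p\<^esub>" using zp.Units_r_inv[OF cu] zp.Units_closed[OF cu] by simp
    thus False using k by simp
  qed
  have main: "Zp_cong p (mirimanoff_at p \<zeta> (dual_char p \<zeta> \<chi>) t \<otimes>\<^bsub>Zp p\<^esub> mirimanoff_at p \<zeta> \<chi> t) \<zero>\<^bsub>Zp p\<^esub>"
    if xy: "coprime x y" "x ^ p + y ^ p + z ^ p = 0" "\<not> int p dvd x" "\<not> int p dvd y" "\<not> int p dvd z"
      and t: "t = Zp_of_int p (- y) \<otimes>\<^bsub>Zp p\<^esub> inv\<^bsub>Zp p\<^esub> (Zp_of_int p x)" for x y z t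
  proof -
    have cl: "Zp_of_int p v \<in> carrier (Zp p)" for v using assms(2) by (intro Zp_of_int_closed) simp
    have zx: "Zp_of_int p v 0 = v mod int p" for v by (simp add: Zp_of_int_def)
    have ux: "Zp_of_int p x \<in> Units (Zp p)"
      using xy(3) by (intro zp.Zp_unitI cl) (simp add: zx dvd_mod_iff)
    have tc: "t \<in> carrier (Zp p)" unfolding t using ux cl by simp
    have "t \<otimes>\<^bsub>Zp p\<^esub> Zp_of_int p x = Zp_of_int p (- y)"
      unfolding t using ux cl by (simp add: zp.m_assoc)
    hence "[t 0 * (x mod int p) = - y mod int p] (mod int p)"
      using zp.mult_0_cong[of t "Zp_of_int p x"] by (simp add: zx cong_sym)
    hence t0: "[t 0 * x = - y] (mod int p)" by (simp add: cong_def mod_mult_right_eq)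
    have mx: "mirimanoff_at p \<zeta> \<chi> t \<in> carrier (Zp p)"
      "[mirimanoff_at p \<zeta> \<chi> t 0 = mirimanoff_sum p (t 0) (p - m)] (mod int p)"
      by (rule mirimanoff_at_cong[OF chi_unit m(2) _ tc]; use m(1) not_dvd_of_range in fastforce)+
    have du: "dual_char p \<zeta> \<chi> (gal_aut k) \<in> Units (Zp p)" if "k \<in> {1..<p}" for k
      unfolding dual[OF that] using teich[OF that] chi_unit[OF not_dvd_of_range[OF that]] by simp
    \<comment> \<open>The exponent of \<omega> / \<chi> is 1 - m; p - m is its representative modulo
      p - 1 in the natural numbers.\<close>
    have dc: "[dual_char p \<zeta> \<chi> (gal_aut k) 0 = int k ^ (p - m)] (mod int p)" if k: "k \<in> {1..<p}" for k
    proof -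
      define v where "v = (inv\<^bsub>Zp p\<^esub> (\<chi> (gal_aut k))) 0"
      have nd: "\<not> int p dvd int k" using not_dvd_of_range[OF k] by simp
      have "[\<chi> (gal_aut k) 0 * v = 1] (mod int p)" unfolding v_def 
        by (rule zp.unit_inv_0_cong[OF chi_unit[OF not_dvd_of_range[OF k]]])
      moreover have "[\<chi> (gal_aut k) 0 * v = int k ^ m * v] (mod int p)" 
        by (intro cong_mult m(2) not_dvd_of_range[OF k] cong_refl)
      ultimately have 1: "[int k ^ m * v = 1] (mod int p)" using cong_sym cong_trans by blast
      have "[dual_char p \<zeta> \<chi> (gal_aut k) 0 = teichmuller p (int k) 0 * v] (mod int p)"
        unfolding dual[OF k] v_def by (rule zp.mult_0_cong)
      also have "[teichmuller p (int k) 0 * v = int k * v] (mod int p)"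
        by (intro cong_mult teich k cong_refl)
      also have "[int k * v = int k * v * int k ^ (p - 1)] (mod int p)"
        using cong_mult[OF cong_refl[of "int k * v"] fermat_int[OF assms(1) nd]] by (simp add: cong_sym)
      also have "int k * v * int k ^ (p - 1) = (int k ^ m * v) * int k ^ (p - m)"
      proof -
        have "int k * int k ^ (p - 1) = int k ^ m * int k ^ (p - m)"
        proof -
          have "Suc (p - 1) = m + (p - m)" using mr assms(2) by auto
          thus ?thesis by (metis power_Suc power_add)
        qed
        thus ?thesis by (simp only: mult_ac)
      qed
      also have "[\<dots> = 1 * int k ^ (p - m)] (mod int p)" by (intro cong_mult 1 cong_refl)
      finally show ?thesis by simp
    qed
    have md: "mirimanoff_at p \<zeta> (dual_char p \<zeta> \<chi>) t \<in> carrier (Zp p)"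
      "[mirimanoff_at p \<zeta> (dual_char p \<zeta> \<chi>) t 0 = mirimanoff_sum p (t 0) (p - (p - m))] (mod int p)"
      using mirimanoff_at_cong[of "dual_char p \<zeta> \<chi>" "p - m" t, OF du dc _ tc] mr by auto
    have "[(mirimanoff_at p \<zeta> (dual_char p \<zeta> \<chi>) t \<otimes>\<^bsub>Zp p\<^esub> mirimanoff_at p \<zeta> \<chi> t) 0 = 
        mirimanoff_at p \<zeta> (dual_char p \<zeta> \<chi>) t 0 * mirimanoff_at p \<zeta> \<chi> t 0] (mod int p)"
      by (rule zp.mult_0_cong)
    also have "[mirimanoff_at p \<zeta> (dual_char p \<zeta> \<chi>) t 0 * mirimanoff_at p \<zeta> \<chi> t 0 = 
       mirimanoff_sum p (t 0) (p - (p - m)) * mirimanoff_sum p (t 0) (p - m)] (mod int p)"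
      by (intro cong_mult md mx)
    \<comment> \<open>The inverse character in M takes the exponent p - m of the dual character to
      the index m, so the two factors carry the complementary indices m and p - m.\<close>
    also have "p - (p - m) = m" using mr by auto
    also have "[mirimanoff_sum p (t 0) m * mirimanoff_sum p (t 0) (p - m) = 0] (mod int p)"
      by (rule fermat_mirimanoff[OF xy t0 mr])
    finally show ?thesis
      using md(1) mx(1) by (subst zp.Zp_cong_iff) (auto simp: Zp_zero)
  qed
  have nd: "\<not> int p dvd a" "\<not> int p dvd b" "\<not> int p dvd c" using assms(11) by auto
  have sums: "a ^ p + b ^ p + c ^ p = 0" "b ^ p + a ^ p + c ^ p = 0" "b ^ p + c ^ p + a ^ p = 0"
    "c ^ p + b ^ p + a ^ p = 0" "c ^ p + a ^ p + b ^ p = 0" "a ^ p + c ^ p + b ^ p = 0"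
    using assms(10) by (simp_all add: algebra_simps)
  have cop: "coprime b a" "coprime c b" "coprime c a" using assms(7-9) by (simp_all add: coprime_commute)
  show ?thesis
    using odd ne main[OF assms(7) sums(1)] main[OF cop(1) sums(2)] main[OF assms(8) sums(3)]
      main[OF cop(2) sums(4)] main[OF cop(3) sums(5)] main[OF assms(9) sums(6)] nd
    by (simp add: Let_def)
qed

end
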